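(* Let $\Omega\subset\widehat{\mathbb{C}}$ be a hyperbolic multiply connected domain, let $z_0\in\Omega$, and let $p\in\partial\Omega$. Let $\pi\colon\mathbb{D}\to\Omega$ be a universal covering such that $\pi(0)=z_0$, with deck transformation group $\Gamma$. Then there is a one-to-one correspondence $$(\pi^* )^{-1}(p)/\Gamma\simeq\mathcal{A}(p;z_0).$$ More precisely, the following hold. (a) If $\pi^*(e^{i\theta})=p$, then $\pi^*(\gamma(e^{i\theta}))=p$ for every $\gamma\in\Gamma$. (b) If $\pi^*(e^{i\theta})=p$, there exists an access $A$ to $p$ from $z_0$ such that, for any $\gamma\in\Gamma$, any curve $\eta\subset\mathbb{D}$ starting at $0$ and landing non-tangentially at $\gamma(e^{i\theta})$ satisfies $\pi(\eta)\in A$ (in particular, $\pi(\eta)$ lands at $p$). (c) If $A$ is an access to $p$ from $z_0$, then there exists a point $e^{i\theta}\in\partial\mathbb{D}$ such that: (i) for any curve $\eta\in A$, its unique lift $\tilde\eta\subset\pi^{-1}(\eta)$ starting at $0$ lands at $\gamma(e^{i\theta})$ for some $\gamma\in\Gamma$; (ii) if $B\in\mathcal{A}(p;z_0)$ is distinct from $A$, with corresponding point $e^{i\alpha}\in\partial\mathbb{D}$, then there does not exist a deck transformation $\gamma\in\Gamma$ with $\gamma(e^{i\theta})=e^{i\alpha}$.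
   Context: $\widehat{\mathbb{C}}$ is the Riemann sphere, $\mathbb{D}$ the open unit disk. A domain $\Omega\subset\widehat{\mathbb{C}}$ is hyperbolic if it omits at least three points, multiply connected if it is not simply connected. $\pi$ is a holomorphic universal covering, and $\Gamma=\{\gamma\in\mathrm{Aut}(\mathbb{D}):\pi\circ\gamma=\pi\}$, acting also on $\partial\mathbb{D}$. The radial limit is $\pi^*(e^{i\theta})=\lim_{r\to1^-}\pi(re^{i\theta})$ when it exists, and $(\pi^* )^{-1}(p)$ is the set of $e^{i\theta}\in\partial\mathbb{D}$ where it exists and equals $p$. A curve $\eta\colon[0,1)\to\widehat{\mathbb{C}}$ lands at $q$ if $\eta(t)\to q$ as $t\to1^-$; a curve in $\mathbb{D}$ lands non-tangentially at $e^{i\theta}$ if it lands at $e^{i\theta}$ and, for $t$ close to $1$, is contained in a Stolz angle $\{z\in\mathbb{D}:|\arg(1-e^{-i\theta}z)|<\alpha,|z-e^{i\theta}|<\rho\}$, $0<\alpha<\pi/2$, $\rho>0$. Accesses. Two curves $\eta_1,\eta_2\colon[0,1)\to\Omega$ with $\eta_1(0)=\eta_2(0)=z_0$, both landing at $p\in\partial\Omega$, are equivalent if they are homotopic through a homotopy that fixes only $p$: there is a continuous $H\colon[0,1]\times[0,1)\to\Omega$, extending continuously to $[0,1]\times[0,1]$ by $H(s,1)=p$ for all $s\in[0,1]$, with $H(0,t)=\eta_1(t)$ and $H(1,t)=\eta_2(t)$ (the initial points $H(s,0)$ are allowed to move in $\Omega$). An access to $p$ from $z_0$ is an equivalence class of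 curves in $\Omega$ joining $z_0$ to $p$; $\mathcal{A}(p;z_0)$ is the set of all accesses to $p$ from $z_0$ (empty if $p$ is not accessible). In (c)(ii), the point corresponding to $B$ is the point given by (c)(i) applied to $B$. *)

theory Defs
  imports "HOL-Complex_Analysis.Complex_Analysis"
begin

datatype riemann_sphere = Finite complex | Infinity

fun option_of_sphere :: "riemann_sphere \<Rightarrow> complex option" where
  "option_of_sphere (Finite z) = Some z"
| "option_of_sphere Infinity = None"

lemma bij_option_of_sphere: "bij option_of_sphere"
proof (rule bijI)
  show "inj option_of_sphere"
  proof (rule injI)
    fix p q assume "option_of_sphere p = option_of_sphere q"
    then show "p = q" by (cases p; cases q) auto
  qed
  have "\<exists>p. x = option_of_sphere p" for x
    by (cases x) (metis option_of_sphere.simps(2), metis option_of_sphere.simps(1))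
  then show "surj option_of_sphere" by (simp add: surj_def)
qed

instantiation riemann_sphere :: topological_space
begin

definition open_riemann_sphere :: "riemann_sphere set \<Rightarrow> bool" where
  "open_riemann_sphere U \<longleftrightarrow>
     openin (Alexandroff_compactification euclidean) (option_of_sphere ` U)"

instance
proof
  have inj: "inj option_of_sphere" and surj: "range option_of_sphere = UNIV"
    using bij_option_of_sphere by (auto simp: bij_def)
  show "open (UNIV :: riemann_sphere set)"
    using openin_topspace[of "Alexandroff_compactification (euclidean :: complex topology)"]
    by (simp add: open_riemann_sphere_def surj notin_range_Some flip: UNIV_option_conv)
  show "open (S \<inter> T)" if "open S" "open T" for S T :: "riemann_sphere set"
    using that by (simp add: open_riemann_sphere_def image_Int[OF inj] openin_Int)
  show "open (\<Union>K)" if "\<forall>S\<in>K. open S" for K :: "riemann_sphere set set"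
    using that by (auto simp: open_riemann_sphere_def image_Union intro!: openin_Union)
qed

end

text \<open>The two affine charts \<open>z\<close> and \<open>1 / z\<close>; their values at \<open>\<infinity>\<close> and at \<open>0\<close>
  respectively are irrelevant. The library value \<open>inverse 0 = 0\<close> is used for the latter.\<close>

fun chart_finite :: "riemann_sphere \<Rightarrow> complex" where
  "chart_finite (Finite z) = z"
| "chart_finite Infinity = 0"

fun chart_infinity :: "riemann_sphere \<Rightarrow> complex" where
  "chart_infinity (Finite z) = inverse z"
| "chart_infinity Infinity = 0"

text \<open>Intended for open \<open>A\<close>, in which case continuity makes the domains on which the two
  local expressions are considered open.\<close>

definition sphere_holomorphic_on :: "(complex \<Rightarrow> riemann_sphere) \<Rightarrow> complex set \<Rightarrow> bool" where
  "sphere_holomorphic_on f A \<longleftrightarrow>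
     continuous_on A f \<and>
     (chart_finite \<circ> f) holomorphic_on {z \<in> A. f z \<noteq> Infinity} \<and>
     (chart_infinity \<circ> f) holomorphic_on {z \<in> A. f z \<noteq> Finite 0}"

definition sphere_domain :: "riemann_sphere set \<Rightarrow> bool" where
  "sphere_domain \<Omega> \<longleftrightarrow> open \<Omega> \<and> connected \<Omega> \<and> \<Omega> \<noteq> {}"

definition hyperbolic_domain :: "riemann_sphere set \<Rightarrow> bool" where
  "hyperbolic_domain \<Omega> \<longleftrightarrow>
     sphere_domain \<Omega> \<and> (\<exists>a b c. a \<noteq> b \<and> a \<noteq> c \<and> b \<noteq> c \<and> {a, b, c} \<inter> \<Omega> = {})"

abbreviation unit_disk :: "complex set" where
  "unit_disk \<equiv> ball 0 1"

abbreviation unit_circle :: "complex set" where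
  "unit_circle \<equiv> sphere 0 1"

text \<open>The disk being simply connected, every covering by it is universal.\<close>

definition holomorphic_universal_covering ::
    "(complex \<Rightarrow> riemann_sphere) \<Rightarrow> riemann_sphere set \<Rightarrow> bool" where
  "holomorphic_universal_covering \<pi> \<Omega> \<longleftrightarrow>
     covering_space unit_disk \<pi> \<Omega> \<and> sphere_holomorphic_on \<pi> unit_disk"

definition disk_automorphisms :: "(complex \<Rightarrow> complex) set" where
  "disk_automorphisms = {\<gamma>. \<gamma> holomorphic_on unit_disk \<and> bij_betw \<gamma> unit_disk unit_disk}"

text \<open>Automorphisms are total functions whose values outside the disk are arbitrary, so each
  automorphism has many representatives here. They all have the same boundary action, since
  \<open>boundary_action\<close> only looks at values inside the disk.\<close>

definition deck_group :: "(complex \<Rightarrow> riemann_sphere) \<Rightarrow> (complex \<Rightarrow> complex) set" where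
  "deck_group \<pi> = {\<gamma> \<in> disk_automorphisms. \<forall>z\<in>unit_disk. \<pi> (\<gamma> z) = \<pi> z}"

text \<open>The continuous extension of \<open>\<gamma>\<close> to the closed disk, evaluated at \<open>\<xi>\<close>.\<close>

definition boundary_action :: "(complex \<Rightarrow> complex) \<Rightarrow> complex \<Rightarrow> complex" where
  "boundary_action \<gamma> \<xi> = Lim (at \<xi> within unit_disk) \<gamma>"

text \<open>Points \<open>e\<^sup>i\<^sup>\<theta>\<close> of the unit circle are represented by the complex number \<open>\<xi>\<close> itself.\<close>

definition radial_preimage :: "(complex \<Rightarrow> riemann_sphere) \<Rightarrow> riemann_sphere \<Rightarrow> complex set" where
  "radial_preimage \<pi> p =
     {\<xi> \<in> unit_circle. ((\<lambda>r. \<pi> (complex_of_real r * \<xi>)) \<longlongrightarrow> p) (at_left 1)}"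

definition deck_orbit_rel ::
    "(complex \<Rightarrow> riemann_sphere) \<Rightarrow> riemann_sphere \<Rightarrow> (complex \<times> complex) set" where
  "deck_orbit_rel \<pi> p =
     {(\<xi>, \<zeta>). \<xi> \<in> radial_preimage \<pi> p \<and> \<zeta> \<in> radial_preimage \<pi> p \<and>
             (\<exists>\<gamma>\<in>deck_group \<pi>. \<zeta> = boundary_action \<gamma> \<xi>)}"

text \<open>A curve \<open>[0,1) \<rightarrow> S\<close> is a total function on the reals whose values outside \<open>[0,1)\<close> are
  disregarded.\<close>

definition curve_from :: "'a::topological_space set \<Rightarrow> 'a \<Rightarrow> (real \<Rightarrow> 'a) \<Rightarrow> bool" where
  "curve_from S a \<eta> \<longleftrightarrow> continuous_on {0..<1} \<eta> \<and> \<eta> ` {0..<1} \<subseteq> S \<and> \<eta> 0 = a"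

definition lands_at :: "(real \<Rightarrow> 'a::topological_space) \<Rightarrow> 'a \<Rightarrow> bool" where
  "lands_at \<eta> q \<longleftrightarrow> (\<eta> \<longlongrightarrow> q) (at_left 1)"

definition stolz_angle :: "complex \<Rightarrow> real \<Rightarrow> real \<Rightarrow> complex set" where
  "stolz_angle \<xi> \<alpha> \<rho> = {z \<in> unit_disk. \<bar>Arg (1 - cnj \<xi> * z)\<bar> < \<alpha> \<and> cmod (z - \<xi>) < \<rho>}"

definition lands_nontangentially_at :: "(real \<Rightarrow> complex) \<Rightarrow> complex \<Rightarrow> bool" where
  "lands_nontangentially_at \<eta> \<xi> \<longleftrightarrow>
     lands_at \<eta> \<xi> \<and>
     (\<exists>\<alpha> \<rho>. 0 < \<alpha> \<and> \<alpha> < pi / 2 \<and> 0 < \<rho> \<and> (\<forall>\<^sub>F t in at_left 1. \<eta> t \<in> stolz_angle \<xi> \<alpha> \<rho>))"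

definition landing_curves ::
    "riemann_sphere set \<Rightarrow> riemann_sphere \<Rightarrow> riemann_sphere \<Rightarrow> (real \<Rightarrow> riemann_sphere) set" where
  "landing_curves \<Omega> z\<^sub>0 p = {\<eta>. curve_from \<Omega> z\<^sub>0 \<eta> \<and> lands_at \<eta> p}"

text \<open>The initial points \<open>H (s, 0)\<close> may move in \<open>\<Omega>\<close>; only the landing point is fixed. Curves
  agreeing on \<open>[0,1)\<close> are related, so the arbitrary values elsewhere do not split classes.\<close>

definition access_rel ::
    "riemann_sphere set \<Rightarrow> riemann_sphere \<Rightarrow> riemann_sphere
      \<Rightarrow> ((real \<Rightarrow> riemann_sphere) \<times> (real \<Rightarrow> riemann_sphere)) set" where
  "access_rel \<Omega> z\<^sub>0 p =
     {(\<eta>\<^sub>1, \<eta>\<^sub>2). \<eta>\<^sub>1 \<in> landing_curves \<Omega> z\<^sub>0 p \<and> \<eta>\<^sub>2 \<in> landing_curves \<Omega> z\<^sub>0 p \<and>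
        (\<exists>H :: real \<times> real \<Rightarrow> riemann_sphere.
           continuous_on ({0..1} \<times> {0..1}) H \<and>
           H ` ({0..1} \<times> {0..<1}) \<subseteq> \<Omega> \<and>
           (\<forall>s\<in>{0..1}. H (s, 1) = p) \<and>
           (\<forall>t\<in>{0..<1}. H (0, t) = \<eta>\<^sub>1 t \<and> H (1, t) = \<eta>\<^sub>2 t))}"

definition accesses ::
    "riemann_sphere set \<Rightarrow> riemann_sphere \<Rightarrow> riemann_sphere
      \<Rightarrow> (real \<Rightarrow> riemann_sphere) set set" where
  "accesses \<Omega> z\<^sub>0 p = landing_curves \<Omega> z\<^sub>0 p // access_rel \<Omega> z\<^sub>0 p"

definition lift_from :: "(complex \<Rightarrow> riemann_sphere) \<Rightarrow> complex \<Rightarrow> (real \<Rightarrow> riemann_sphere)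
    \<Rightarrow> (real \<Rightarrow> complex) \<Rightarrow> bool" where
  "lift_from \<pi> a \<eta> \<eta>' \<longleftrightarrow>
     curve_from unit_disk a \<eta>' \<and> (\<forall>t\<in>{0..<1}. \<pi> (\<eta>' t) = \<eta> t)"

text \<open>\<open>\<xi>\<close> is a point corresponding to the access \<open>A\<close>: every curve in \<open>A\<close> has a unique lift
  starting at \<open>0\<close> (unique as a curve on \<open>[0,1)\<close>), and it lands in the orbit of \<open>\<xi>\<close>.\<close>

definition corresponding_point ::
    "(complex \<Rightarrow> riemann_sphere) \<Rightarrow> (real \<Rightarrow> riemann_sphere) set \<Rightarrow> complex \<Rightarrow> bool" where
  "corresponding_point \<pi> A \<xi> \<longleftrightarrow>
     \<xi> \<in> unit_circle \<and>
     (\<forall>\<eta>\<in>A. \<exists>\<eta>'. lift_from \<pi> 0 \<eta> \<eta>' \<and>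
        (\<forall>\<eta>''. lift_from \<pi> 0 \<eta> \<eta>'' \<longrightarrow> (\<forall>t\<in>{0..<1}. \<eta>'' t = \<eta>' t)) \<and>
        (\<exists>\<gamma>\<in>deck_group \<pi>. lands_at \<eta>' (boundary_action \<gamma> \<xi>)))"

definition nontangential_curves_project_into ::
    "(complex \<Rightarrow> riemann_sphere) \<Rightarrow> complex \<Rightarrow> (real \<Rightarrow> riemann_sphere) set \<Rightarrow> bool" where
  "nontangential_curves_project_into \<pi> \<xi> A \<longleftrightarrow>
     (\<forall>\<eta>. curve_from unit_disk 0 \<eta> \<and> lands_nontangentially_at \<eta> \<xi> \<longrightarrow> \<pi> \<circ> \<eta> \<in> A)"

end

theory Submission
  imports Defs
begin

text \<open>
  Both sides of the correspondence are read off from curves in the disk. A curve in \<open>\<Omega>\<close> from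
  \<open>z\<^sub>0\<close> landing at \<open>p\<close> lifts to a curve from \<open>0\<close> along which \<open>\<pi>\<close> tends to \<open>p\<close>, and every curve of
  the latter kind projects to one of the former. It therefore suffices to know that such a curve
  in the disk lands at a point \<open>\<xi>\<close> of the circle, that \<open>\<pi>\<close> then tends to \<open>p\<close> along the radius to
  \<open>\<xi>\<close> too, and that two of these curves project to the same access exactly if their landing points
  are equivalent under a deck transformation. The bijection is then induced by sending a curve to
  the landing point of its lift.

  Choose two omitted points \<open>a\<close>, \<open>b\<close> different from \<open>p\<close>. The Moebius transformation with
  \<open>p, a, b \<mapsto> 0, \<infinity>, 1\<close> turns \<open>\<pi>\<close> into a holomorphic function \<open>g\<close> on the disk omitting \<open>0\<close> and \<open>1\<close>,
  and the condition that \<open>\<pi>\<close> tends to \<open>p\<close> into the condition that \<open>g\<close> tends to \<open>0\<close>. The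
  analytic core is \<open>no_long_small_arc\<close>: among all functions omitting \<open>0\<close> and \<open>1\<close> with
  \<open>|g 0| = \<eta>\<close>, smallness of \<open>g\<close> on an arc forces the two ends of the arc to be close together,
  uniformly in \<open>g\<close>. Indeed Schottky's theorem pushes a very small arc towards the circle and bounds
  \<open>log |g|\<close> by a power of \<open>1 / (1 - |z|)\<close>. On the inner side of a long arc this growth is harmless:
  it only matters at the two ends of the arc, where a harmonic barrier with poles absorbs it, so the
  maximum principle would make \<open>g\<close> small at a fixed inner point, which Schottky's theorem forbids.

  The uniformity in \<open>g\<close> is what gives the three facts. Tails of a curve along which \<open>g\<close> tends to
  \<open>0\<close> have small diameter, so the curve lands (\<open>small_curve_lands\<close>). If the projections of two
  curves are homotopic, the lifted homotopy joins them by arcs on which \<open>g\<close> is small, so they land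
  together (\<open>joined_small_curves_land_together\<close>). If a curve lands at \<open>\<xi>\<close>, possibly tangentially,
  then near \<open>\<xi>\<close> it lies in the same component of \<open>{|g| < \<eta>}\<close> as the radius; otherwise there would
  be a point between them where \<open>|g|\<close> has a prescribed value, and moving this point to the centre of
  the disk turns the tail of the curve into a long small arc
  (\<open>landing_imp_same_end_as_radius\<close>). Finally the components of \<open>{|g| < \<eta>}\<close> are simply connected by
  the maximum principle, and therefore two curves which for every \<open>\<eta>\<close> end up in the same component
  are homotopic through curves along which \<open>g\<close> tends to \<open>0\<close> (\<open>same_end_homotopy\<close>).
\<close>

section \<open>Holomorphic functions on the disk omitting 0 and 1\<close>

definition omitting_01 :: "(complex \<Rightarrow> complex) \<Rightarrow> bool" where
  "omitting_01 g \<longleftrightarrow> g holomorphic_on unit_disk \<and> (\<forall>z\<in>unit_disk. g z \<noteq> 0 \<and> g z \<noteq> 1)"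

lemma omitting_01_inverse: "omitting_01 g \<Longrightarrow> omitting_01 (\<lambda>z. inverse (g z))"
  by (auto simp: omitting_01_def inverse_eq_1_iff intro!: holomorphic_intros)

lemma omitting_01_compose:
  assumes "omitting_01 g" "f holomorphic_on unit_disk" "f ` unit_disk \<subseteq> unit_disk"
  shows "omitting_01 (\<lambda>z. g (f z))"
  using assms holomorphic_on_compose_gen[of f "unit_disk" g "unit_disk"]
  unfolding omitting_01_def o_def by blast

text \<open>Schottky's theorem for the open disk, by rescaling with a factor between \<open>t\<close> and \<open>1\<close>. All
  that matters is that the bound does not depend on the function.\<close>

lemma Schottky_bound:
  assumes "0 < t" "t < 1"
  obtains M where "1 \<le> M"
    "\<And>g z. omitting_01 g \<Longrightarrow> cmod (g 0) \<le> r \<Longrightarrow> cmod z \<le> t \<Longrightarrow> cmod (g z) \<le> M"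
proof -
  \<comment> \<open>any number between \<open>t\<close> and \<open>1\<close>, so that the shrunken function lives on the closed disk\<close>
  define t' where "t' = (t + 1) / 2"
  define u where "u = t / t'"
  have t': "0 < t'" "t' < 1" "t < t'" using assms by (auto simp: t'_def)
  have u: "0 < u" "u < 1" using t' assms by (auto simp: u_def)
  define M where "M = exp (pi * exp (pi * (2 + 2 * max r 0 + 12 * u / (1 - u))))"
  have bd: "cmod (g z) \<le> M" if g: "omitting_01 g" "cmod (g 0) \<le> r" "cmod z \<le> t" for g z
  proof -
    define h where "h = (\<lambda>w. g (of_real t' * w))"
    have sub: "of_real t' * w \<in> ball (0::complex) 1" if "w \<in> cball 0 1" for w
    proof -
      have "t' * cmod w \<le> t' * 1" using that t' by (intro mult_left_mono) auto
      with t' have "t' * cmod w < 1" by linarith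
      then show ?thesis using t' by (simp add: norm_mult)
    qed
    have hol: "h holomorphic_on cball 0 1"
    proof -
      have "(g \<circ> (\<lambda>w. of_real t' * w)) holomorphic_on cball 0 1"
        by (rule holomorphic_on_compose_gen[where t = "unit_disk"])
           (use g(1) sub in \<open>auto simp: omitting_01_def intro!: holomorphic_intros\<close>)
      then show ?thesis by (simp add: h_def o_def)
    qed
    have om: "\<not> (h w = 0 \<or> h w = 1)" if "w \<in> cball 0 1" for w
      using g(1) sub[OF that] by (auto simp: h_def omitting_01_def)
    have "cmod (h (z / t')) \<le> M"
      unfolding M_def
      by (rule Schottky[OF hol _ om u])
         (use g t' u in \<open>auto simp: h_def u_def norm_divide divide_right_mono\<close>)
    then show ?thesis using t' by (simp add: h_def)
  qed
  show ?thesis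
  proof
    show "1 \<le> M" by (simp add: M_def)
  qed (rule bd)
qed

text \<open>The function \<open>1 / g\<close> also omits \<open>0\<close> and \<open>1\<close>. If \<open>g 0\<close> were not small, Schottky's theorem
  would bound \<open>1 / g\<close> near the centre.\<close>

lemma small_near_imp_small_at_0:
  assumes "0 < t" "t < 1" "0 < \<eta>"
  obtains \<epsilon> where "0 < \<epsilon>"
    "\<And>g z. omitting_01 g \<Longrightarrow> cmod z \<le> t \<Longrightarrow> cmod (g z) \<le> \<epsilon> \<Longrightarrow> cmod (g 0) < \<eta>"
proof -
  obtain M where M: "1 \<le> M" "\<And>g z. omitting_01 g \<Longrightarrow> cmod (g 0) \<le> 1 / \<eta> \<Longrightarrow> cmod z \<le> t \<Longrightarrow> cmod (g z) \<le> M"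
    using Schottky_bound[OF assms(1,2)] by blast
  show ?thesis
  proof
    show "0 < 1 / (2 * M)" using M by simp
    fix g z assume g: "omitting_01 g" "cmod z \<le> t" "cmod (g z) \<le> 1 / (2 * M)"
    show "cmod (g 0) < \<eta>"
    proof (rule ccontr)
      assume "\<not> cmod (g 0) < \<eta>"
      then have "cmod (inverse (g 0)) \<le> 1 / \<eta>"
        using assms(3) by (simp add: norm_inverse inverse_eq_divide norm_divide frac_le)
      from M(2)[OF omitting_01_inverse[OF g(1)] this g(2)]
      have *: "inverse (cmod (g z)) \<le> M" by (simp add: norm_inverse)
      have "g z \<noteq> 0" using g assms by (auto simp: omitting_01_def)
      with * have "1 \<le> M * cmod (g z)" by (simp add: divide_simps)
      also have "\<dots> \<le> M * (1 / (2 * M))" using g(3) M by (intro mult_left_mono) auto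
      finally show False using M by simp
    qed
  qed
qed

text \<open>Exchanging the roles of the two points by a Moebius automorphism reduces this to the previous
  lemma.\<close>

lemma small_at_0_imp_small_near:
  assumes "0 < t" "t < 1" "0 < \<eta>"
  obtains \<epsilon> where "0 < \<epsilon>"
    "\<And>g z. omitting_01 g \<Longrightarrow> cmod z \<le> t \<Longrightarrow> cmod (g 0) \<le> \<epsilon> \<Longrightarrow> cmod (g z) < \<eta>"
proof -
  obtain \<epsilon> where \<epsilon>: "0 < \<epsilon>"
    "\<And>g z. omitting_01 g \<Longrightarrow> cmod z \<le> t \<Longrightarrow> cmod (g z) \<le> \<epsilon> \<Longrightarrow> cmod (g 0) < \<eta>"
    using small_near_imp_small_at_0[OF assms] by blast
  have "cmod (g z) < \<eta>" if g: "omitting_01 g" "cmod z \<le> t" "cmod (g 0) \<le> \<epsilon>" for g z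
  proof -
    let ?f = "Moebius_function 0 (- z)"
    have z: "cmod (- z) < 1" using that assms by simp
    have "omitting_01 (\<lambda>w. g (?f w))"
    proof (rule omitting_01_compose[OF g(1)])
      show "?f holomorphic_on unit_disk" by (rule Moebius_function_holomorphic[OF z])
      show "?f ` unit_disk \<subseteq> unit_disk"
        using Moebius_function_norm_lt_1[OF z] by (simp add: image_subset_iff)
    qed
    from \<epsilon>(2)[OF this, of "- z"] g show ?thesis
      by (simp add: Moebius_function_def)
  qed
  with \<epsilon> that show ?thesis by blast
qed

abbreviation log_plus :: "complex \<Rightarrow> real" where
  "log_plus w \<equiv> ln (max 1 (cmod w))"

text \<open>Positive harmonic functions satisfy Harnack's inequality, and so, up to an additive constant,
  does \<open>log\<^sup>+ |g|\<close>. The reason is that every \<open>m\<close>-th root of \<open>g\<close> omits \<open>0\<close> and \<open>1\<close> as well. With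
  \<open>m\<close> about \<open>log\<^sup>+ |g 0|\<close> the root has modulus at most \<open>e\<close> at the centre, so Schottky's theorem
  bounds it by an absolute constant; the \<open>m\<close>-th power turns this into a bound for \<open>log |g|\<close> that is
  linear in \<open>m\<close>.\<close>

lemma log_plus_Harnack:
  obtains K where "1 \<le> K"
    "\<And>g z. omitting_01 g \<Longrightarrow> cmod z \<le> 1/2 \<Longrightarrow> log_plus (g z) + 1 \<le> K * (log_plus (g 0) + 1)"
proof -
  obtain M where M: "1 \<le> M" "\<And>g z. omitting_01 g \<Longrightarrow> cmod (g 0) \<le> exp 1 \<Longrightarrow> cmod z \<le> 1/2 \<Longrightarrow> cmod (g z) \<le> M"
    using Schottky_bound[of "1/2"] by auto
  have bd: "log_plus (g z) + 1 \<le> (2 * ln M + 1) * (log_plus (g 0) + 1)"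
    if g: "omitting_01 g" "cmod z \<le> 1/2" for g z
  proof -
    obtain l where l: "l holomorphic_on unit_disk" "\<And>z. z \<in> unit_disk \<Longrightarrow> g z = exp (l z)"
      using contractible_imp_holomorphic_log[of g "unit_disk"] g(1)
      by (auto simp: omitting_01_def convex_imp_contractible)
    define L where "L = log_plus (g 0)"
    define m where "m = nat \<lceil>L\<rceil> + 1"
    have L0: "0 \<le> L" by (simp add: L_def)
    have m: "0 < m" "L \<le> real m" "real m \<le> L + 2"
      using L0 by (auto simp: m_def) linarith+
    define h where "h = (\<lambda>z. exp (l z / of_nat m))"
    have hm: "h z ^ m = g z" if "z \<in> unit_disk" for z
      using m l(2)[OF that] by (simp add: h_def exp_of_nat_mult[symmetric])
    have om: "omitting_01 h"
      unfolding omitting_01_def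
    proof (intro conjI ballI)
      show "h holomorphic_on unit_disk" unfolding h_def using l(1) m by (auto intro!: holomorphic_intros)
      fix z :: complex assume z: "z \<in> unit_disk"
      show "h z \<noteq> 0" by (simp add: h_def)
      show "h z \<noteq> 1" using hm[OF z] g(1) z by (auto simp: omitting_01_def)
    qed
    have "cmod (h 0) ^ m = cmod (g 0)" using hm[of 0] by (simp flip: norm_power)
    also have "\<dots> \<le> exp L" by (simp add: L_def)
    also have "\<dots> \<le> exp (real m)" using m by simp
    also have "\<dots> = exp 1 ^ m" by (simp flip: exp_of_nat_mult)
    finally have "cmod (h 0) \<le> exp 1" using m(1) by (simp add: power_mono_iff)
    from M(2)[OF om this g(2)] have "cmod (h z) ^ m \<le> M ^ m" by (intro power_mono) auto
    moreover have "cmod (h z) ^ m = cmod (g z)" using hm[of z] g(2) by (simp flip: norm_power)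
    ultimately have "max 1 (cmod (g z)) \<le> M ^ m" using M(1) by auto
    then have "log_plus (g z) \<le> ln (M ^ m)" by (intro ln_mono) auto
    also have "\<dots> = m * ln M" using M by (simp add: ln_realpow)
    also have "\<dots> \<le> (L + 2) * ln M" using m M by (intro mult_right_mono) auto
    also have "\<dots> \<le> 2 * ln M * (L + 1)"
    proof -
      have "0 \<le> L * ln M" using L0 M by simp
      then show ?thesis by (simp add: algebra_simps)
    qed
    finally show ?thesis unfolding L_def[symmetric] using L0 by (simp add: algebra_simps)
  qed
  show ?thesis
  proof
    show "1 \<le> 2 * ln M + 1" using M by simp
  qed (rule bd)
qed

text \<open>A Harnack chain along the radius: halving the distance to the circle multiplies
  \<open>log\<^sup>+ |g| + 1\<close> by at most a constant \<open>K\<close>, which gives polynomial growth with exponent \<open>log\<^sub>2 K\<close>.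
  A single application of Schottky's theorem on a large disk gives a doubly exponential bound, too
  weak for the barrier used below.\<close>

lemma omitting_01_growth:
  obtains N :: nat and A where "0 < N" "0 < A"
    "\<And>g z. omitting_01 g \<Longrightarrow> cmod (g 0) \<le> r \<Longrightarrow> cmod z < 1 \<Longrightarrow> cmod (g z) \<le> exp (A / (1 - cmod z) ^ N)"
proof -
  obtain K where K: "1 \<le> K"
    "\<And>g z. omitting_01 g \<Longrightarrow> cmod z \<le> 1/2 \<Longrightarrow> log_plus (g z) + 1 \<le> K * (log_plus (g 0) + 1)"
    using log_plus_Harnack by blast
  have chain: "log_plus (g z) + 1 \<le> K ^ k * (log_plus (g 0) + 1)"
    if g: "omitting_01 g" and "cmod z \<le> 1 - 1 / 2 ^ k" for g z k
    using that(2)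
  proof (induction k arbitrary: z)
    case 0
    then show ?case by simp
  next
    case (Suc k)
    have pos: "0 \<le> log_plus (g 0) + 1" by (smt (verit) ln_ge_zero)
    show ?case
    proof (cases "cmod z \<le> 1 - 1 / 2 ^ k")
      case True
      from Suc.IH[OF this] have "log_plus (g z) + 1 \<le> K ^ k * (log_plus (g 0) + 1)" .
      also have "\<dots> \<le> K ^ Suc k * (log_plus (g 0) + 1)"
        using K(1) pos by (intro mult_right_mono) auto
      finally show ?thesis .
    next
      case False
      define R :: real where "R = 1 - 1 / 2 ^ k"
      have R: "0 \<le> R" "R < 1" by (auto simp: R_def)
      have zR: "R < cmod z" "cmod z \<noteq> 0" using False R by (auto simp: R_def)
      define z' where "z' = of_real (R / cmod z) * z"
      have nz': "cmod z' = R" using R zR by (simp add: z'_def norm_mult norm_divide)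
      have "z - z' = of_real ((cmod z - R) / cmod z) * z"
        using zR by (simp add: z'_def field_simps of_real_diff)
      then have "cmod (z - z') = \<bar>(cmod z - R) / cmod z\<bar> * cmod z"
        by (metis norm_mult norm_of_real)
      then have dist: "cmod (z - z') = cmod z - R" using zR by simp
      define h where "h = (\<lambda>w. g (z' + w / 2 ^ k))"
      have sub: "z' + w / 2 ^ k \<in> unit_disk" if "w \<in> unit_disk" for w
      proof -
        have "cmod (z' + w / 2 ^ k) \<le> R + cmod w / 2 ^ k"
          using norm_triangle_ineq[of z' "w / 2 ^ k"] by (simp add: nz' norm_divide norm_power)
        also have "\<dots> < R + 1 / 2 ^ k" using that by (intro add_strict_left_mono divide_strict_right_mono) auto
        also have "\<dots> = 1" by (simp add: R_def)
        finally show ?thesis by simp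
      qed
      have om: "omitting_01 h"
        unfolding h_def
        by (rule omitting_01_compose[OF g]) (use sub in \<open>auto intro!: holomorphic_intros\<close>)
      \<comment> \<open>the disk about \<open>z'\<close> of radius \<open>2 ^ - k\<close> is contained in the unit disk, and \<open>z\<close> is in its inner half\<close>
      define w where "w = (z - z') * 2 ^ k"
      have "cmod w = (cmod z - R) * 2 ^ k" by (simp add: w_def norm_mult norm_power dist)
      also have "\<dots> \<le> (1 - 1 / 2 ^ Suc k - R) * 2 ^ k" using Suc.prems by (intro mult_right_mono) auto
      also have "\<dots> = 1 / 2" by (simp add: R_def field_simps)
      finally have w: "cmod w \<le> 1/2" .
      have hw: "h w = g z" "h 0 = g z'" by (auto simp: h_def w_def)
      have "log_plus (g z) + 1 \<le> K * (log_plus (g z') + 1)" using K(2)[OF om w] hw by simp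
      also have "\<dots> \<le> K * (K ^ k * (log_plus (g 0) + 1))"
        using K(1) Suc.IH[of z'] nz' by (intro mult_left_mono) (auto simp: R_def)
      finally show ?thesis by (simp add: mult.assoc)
    qed
  qed
  obtain N0 where N0: "K < 2 ^ N0" using real_arch_pow[of 2 K] by auto
  define N where "N = Suc N0"
  have N: "K \<le> 2 ^ N" using N0 K(1) by (auto simp: N_def)
  define A where "A = (ln (max 1 (max r 1)) + 1) * 2 ^ N"
  have A: "0 < A" unfolding A_def by (intro mult_pos_pos add_nonneg_pos) auto
  have "cmod (g z) \<le> exp (A / (1 - cmod z) ^ N)"
    if g: "omitting_01 g" "cmod (g 0) \<le> r" "cmod z < 1" for g z
  proof -
    have ex: "\<exists>k. 1 / 2 ^ k \<le> 1 - cmod z"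
    proof -
      obtain k where "(1/2::real) ^ k < 1 - cmod z" using real_arch_pow_inv[of "1 - cmod z" "1/2"] g(3) by auto
      then show ?thesis by (auto simp: power_one_over intro!: exI[of _ k])
    qed
    define k where "k = (LEAST k. 1 / 2 ^ k \<le> 1 - cmod z)"
    have k: "1 / 2 ^ k \<le> 1 - cmod z" unfolding k_def using LeastI_ex[OF ex] .
    have k2: "2 ^ k \<le> 2 / (1 - cmod z)"
    proof (cases k)
      case 0 then show ?thesis using g(3) by (simp add: divide_simps) (smt (verit) norm_ge_zero)
    next
      case (Suc j)
      then have "\<not> 1 / 2 ^ j \<le> 1 - cmod z" using not_less_Least[of j] by (metis k_def lessI)
      then show ?thesis using Suc g(3) by (simp add: divide_simps mult.commute)
    qed
    have pos: "0 \<le> log_plus (g 0) + 1" by (smt (verit) ln_ge_zero)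
    have "ln (max 1 (cmod (g z))) + 1 \<le> K ^ k * (log_plus (g 0) + 1)"
      using chain[OF g(1), of z k] k by simp
    also have "\<dots> \<le> (2 ^ N) ^ k * (log_plus (g 0) + 1)"
      using N K(1) pos by (intro mult_right_mono power_mono) auto
    also have "(2 ^ N) ^ k = ((2::real) ^ k) ^ N" by (simp add: power_mult[symmetric] mult.commute)
    also have "(2 ^ k) ^ N * (log_plus (g 0) + 1) \<le> (2 / (1 - cmod z)) ^ N * (ln (max 1 (max r 1)) + 1)"
      using k2 pos g(2,3) by (intro mult_mono power_mono add_right_mono ln_mono) auto
    also have "\<dots> = A / (1 - cmod z) ^ N" by (simp add: A_def power_divide)
    finally have "ln (max 1 (cmod (g z))) \<le> A / (1 - cmod z) ^ N" by simp
    then have "max 1 (cmod (g z)) \<le> exp (A / (1 - cmod z) ^ N)"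
      by (metis exp_le_cancel_iff exp_ln less_max_iff_disj zero_less_one)
    then show ?thesis by simp
  qed
  moreover have "0 < N" by (simp add: N_def)
  ultimately show ?thesis using that A by blast
qed

section \<open>Small values on arcs\<close>

lemma fashoda_complex:
  assumes "path f" "path g"
    and f: "\<And>z. z \<in> path_image f \<Longrightarrow> a \<le> Re z \<and> Re z \<le> b \<and> c \<le> Im z \<and> Im z \<le> d"
    and g: "\<And>z. z \<in> path_image g \<Longrightarrow> a \<le> Re z \<and> Re z \<le> b \<and> c \<le> Im z \<and> Im z \<le> d"
    and "Re (pathstart f) = a" "Re (pathfinish f) = b"
    and "Im (pathstart g) = c" "Im (pathfinish g) = d"
  obtains z where "z \<in> path_image f" "z \<in> path_image g"
proof -
  define v :: "complex \<Rightarrow> real^2" where "v = (\<lambda>z. \<chi> i. if i = 1 then Re z else Im z)"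
  have v: "v z $ 1 = Re z" "v z $ 2 = Im z" for z by (auto simp: v_def)
  have cont: "continuous_on S v" for S
    unfolding v_def
  proof (rule continuous_on_vec_lambda)
    show "continuous_on S (\<lambda>z. if i = 1 then Re z else Im z)" for i :: 2
      by (cases "i = 1") (auto intro: continuous_intros)
  qed
  have inj: "v z = v w \<Longrightarrow> z = w" for z w by (metis v complex_eqI)
  have cbox: "v z \<in> cbox (vector [a, c]) (vector [b, d]) \<longleftrightarrow> a \<le> Re z \<and> Re z \<le> b \<and> c \<le> Im z \<and> Im z \<le> d" for z
    by (auto simp: mem_box_cart forall_2 v)
  obtain x where "x \<in> path_image (v \<circ> f)" "x \<in> path_image (v \<circ> g)"
  proof (rule fashoda[of "v \<circ> f" "v \<circ> g" "vector [a, c]" "vector [b, d]"])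
    show "path (v \<circ> f)" "path (v \<circ> g)" using assms(1,2) cont by (auto intro: path_continuous_image)
    show "path_image (v \<circ> f) \<subseteq> cbox (vector [a, c]) (vector [b, d])"
         "path_image (v \<circ> g) \<subseteq> cbox (vector [a, c]) (vector [b, d])"
      using f g by (auto simp: path_image_compose cbox)
  qed (use assms in \<open>auto simp: pathstart_compose pathfinish_compose v\<close>)
  then show ?thesis using that inj by (auto simp: path_image_compose)
qed

text \<open>In a cone about the positive real axis with opening of order \<open>1 / N\<close>, the function \<open>1 / v ^ N\<close> has
  real part comparable to its modulus. Its real part is therefore a positive harmonic function in
  that cone which dominates polynomial growth of order \<open>N\<close> at the vertex.\<close>

lemma Re_inverse_power_ge:
  assumes "0 < N" "0 < Re v" "\<bar>Im v\<bar> \<le> Re v / (4 * real N)"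
  shows "Re (1 / v ^ N) \<ge> (3/8) / Re v ^ N"
proof -
  define R where "R = Re v"
  define \<tau> where "\<tau> = Im v / R"
  define u where "u = Complex 1 \<tau> ^ N"
  have R: "0 < R" using assms by (simp add: R_def)
  have \<tau>: "\<bar>\<tau>\<bar> \<le> 1 / (4 * real N)"
    using assms R by (simp add: \<tau>_def R_def[symmetric] abs_mult field_simps)
  have v: "v = of_real R * Complex 1 \<tau>" using R by (simp add: complex_eq_iff \<tau>_def R_def)
  have bin: "cmod (Complex 1 \<tau> ^ n - 1) \<le> (1 + \<bar>\<tau>\<bar>) ^ n - 1" for n
  proof (induction n)
    case (Suc n)
    have n1: "cmod (Complex 1 \<tau>) \<le> 1 + \<bar>\<tau>\<bar>" using cmod_le[of "Complex 1 \<tau>"] by simp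
    have n2: "cmod (Complex 1 \<tau> - 1) = \<bar>\<tau>\<bar>" by (simp add: cmod_def)
    have "Complex 1 \<tau> ^ Suc n - 1 = Complex 1 \<tau> * (Complex 1 \<tau> ^ n - 1) + (Complex 1 \<tau> - 1)"
      by (simp add: algebra_simps)
    then have "cmod (Complex 1 \<tau> ^ Suc n - 1) \<le> cmod (Complex 1 \<tau>) * cmod (Complex 1 \<tau> ^ n - 1) + cmod (Complex 1 \<tau> - 1)"
      by (metis norm_mult norm_triangle_ineq)
    also have "\<dots> \<le> (1 + \<bar>\<tau>\<bar>) * ((1 + \<bar>\<tau>\<bar>) ^ n - 1) + \<bar>\<tau>\<bar>"
      using n1 Suc n2 by (intro add_mono mult_mono) auto
    also have "\<dots> = (1 + \<bar>\<tau>\<bar>) ^ Suc n - 1" by (simp add: algebra_simps)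
    finally show ?case .
  qed simp
  have "(1 + \<bar>\<tau>\<bar>) ^ N \<le> exp (1 / (4 * real N)) ^ N"
    using \<tau> exp_ge_add_one_self[of "1 / (4 * real N)"] by (intro power_mono) linarith+
  also have "\<dots> = exp (1 / 4)" using assms(1) by (simp flip: exp_of_nat_mult)
  also have "\<dots> \<le> 4 / 3" using exp_bound[of "1/4"] by (simp add: power2_eq_square)
  finally have u1: "cmod (u - 1) \<le> 1 / 3" using bin[of N] unfolding u_def by linarith
  then have Re_u: "Re u \<ge> 2 / 3" using abs_Re_le_cmod[of "u - 1"] by simp
  have nu: "cmod u \<le> 4 / 3" using u1 norm_triangle_ineq[of "u - 1" 1] by simp
  have "u \<noteq> 0" using Re_u by auto
  have "(3/8) * (cmod u)\<^sup>2 \<le> (3/8) * (4 / 3)\<^sup>2" using nu by (intro mult_left_mono power_mono) auto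
  also have "\<dots> \<le> Re u" using Re_u by (simp add: power2_eq_square)
  finally have "(3/8) * (cmod u)\<^sup>2 \<le> Re u" .
  moreover have "Re (1 / u) = Re u / (cmod u)\<^sup>2" by (simp add: Re_divide cmod_power2)
  ultimately have "3 / 8 \<le> Re (1 / u)" using \<open>u \<noteq> 0\<close> by (simp add: le_divide_eq)
  moreover have "Re (1 / v ^ N) = Re (1 / u) / R ^ N"
  proof -
    have "1 / v ^ N = (1 / u) / of_real (R ^ N)" by (simp add: v u_def power_mult_distrib)
    then show ?thesis by (metis Re_divide_of_real)
  qed
  ultimately show ?thesis
    unfolding R_def[symmetric] using R by (simp only: divide_right_mono zero_le_power less_imp_le)
qed

text \<open>A two-constants estimate in the flat triangle with base \<open>[-a, a]\<close> and slope \<open>m\<close>. The path \<open>q\<close>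
  runs low across the triangle, so the component \<open>G\<close> of the triangle minus \<open>q\<close> containing the
  inner point \<open>i m a / 4\<close> does not reach the base, where nothing is known about \<open>F\<close>. Its boundary
  consists of points of \<open>q\<close>, where \<open>|F| \<le> exp (- \<Lambda>)\<close>, and of points of the two legs, where
  \<open>log |F|\<close> is at most \<open>A / y ^ N\<close>. The maximum principle is applied to \<open>F\<close> times the exponential of
  a holomorphic \<open>P\<close> whose real part compensates both bounds. The legs are so flat that the poles of
  \<open>P\<close> at the two base vertices dominate \<open>A / y ^ N\<close> there.\<close>

lemma triangle_estimate:
  fixes F :: "complex \<Rightarrow> complex"
  assumes "0 < N" "0 < a" "0 \<le> A" "0 \<le> \<Lambda>"
    and m: "m = 1 / (4 * real N)"
    and hol: "F holomorphic_on {\<zeta>. 0 < Im \<zeta>}"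
    and growth: "\<And>\<zeta>. 0 < Im \<zeta> \<Longrightarrow> Im \<zeta> \<le> m * a \<Longrightarrow> cmod (F \<zeta>) \<le> exp (A / Im \<zeta> ^ N)"
    and q: "path q" "Re (pathstart q) \<le> - a" "a \<le> Re (pathfinish q)"
    and low: "\<And>\<zeta>. \<zeta> \<in> path_image q \<Longrightarrow> 0 < Im \<zeta> \<and> Im \<zeta> < m * a / 4"
    and small: "\<And>\<zeta>. \<zeta> \<in> path_image q \<Longrightarrow> cmod (F \<zeta>) \<le> exp (- \<Lambda>)"
  shows "cmod (F (Complex 0 (m * a / 4))) \<le> exp (2 * ((8/3) * A / m ^ N) / a ^ N - \<Lambda> / 2)"
proof -
  have m01: "0 < m" "m \<le> 1" using assms(1) by (auto simp: m divide_simps)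
  define T where "T = {\<zeta>. 0 < Im \<zeta> \<and> Im \<zeta> < m * (a - \<bar>Re \<zeta>\<bar>)}"
  define \<zeta>0 where "\<zeta>0 = Complex 0 (m * a / 4)"
  have "open T" unfolding T_def by (intro open_Collect_conj open_Collect_less continuous_intros)
  have Ta: "\<bar>Re \<zeta>\<bar> < a" "Im \<zeta> \<le> m * a" if "\<zeta> \<in> T" for \<zeta>
  proof -
    have "0 < m * (a - \<bar>Re \<zeta>\<bar>)" using that unfolding T_def by auto
    then show "\<bar>Re \<zeta>\<bar> < a" using m01 by (simp add: zero_less_mult_iff)
    have "0 \<le> m * \<bar>Re \<zeta>\<bar>" using m01 by simp
    then show "Im \<zeta> \<le> m * a" using that by (simp add: T_def right_diff_distrib)
  qed
  have "T \<subseteq> cbox (Complex (- a) 0) (Complex a (m * a))"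
    using Ta by (force simp: T_def in_cbox_complex_iff abs_less_iff)
  then have "bounded T" using bounded_cbox bounded_subset by blast
  define U where "U = T - path_image q"
  have "open U" unfolding U_def using \<open>open T\<close> q(1) by (simp add: open_Diff closed_path_image)
  have \<zeta>0U: "\<zeta>0 \<in> U" using low[of \<zeta>0] m01 assms(2) by (auto simp: U_def T_def \<zeta>0_def)
  define G where "G = connected_component_set U \<zeta>0"
  have "open G" unfolding G_def by (rule open_connected_component[OF \<open>open U\<close>])
  have "connected G" unfolding G_def by simp
  have "\<zeta>0 \<in> G" using \<zeta>0U by (simp add: G_def)
  have GU: "G \<subseteq> U" unfolding G_def by (rule connected_component_subset)
  have GT: "G \<subseteq> T" using GU by (auto simp: U_def)
  have "bounded G" using \<open>bounded T\<close> GT bounded_subset by blast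
  have "continuous_on (path_image q) Im" by (intro continuous_intros)
  then obtain h where h: "h \<in> path_image q" "\<And>\<zeta>. \<zeta> \<in> path_image q \<Longrightarrow> Im h \<le> Im \<zeta>"
    using continuous_attains_inf[OF compact_path_image[OF q(1)] path_image_nonempty, of Im]
    by blast
  have h0: "0 < Im h" using low[OF h(1)] by simp
  have above: "Im h \<le> Im w" if w: "w \<in> G" for w
  proof (rule ccontr)
    assume nw: "\<not> Im h \<le> Im w"
    have wT: "0 < Im w" "\<bar>Re w\<bar> < a" using w GT Ta by (auto simp: T_def)
    obtain \<sigma> where \<sigma>: "path \<sigma>" "path_image \<sigma> \<subseteq> G" "pathstart \<sigma> = w" "pathfinish \<sigma> = \<zeta>0"
      using \<open>open G\<close> \<open>connected G\<close> w \<open>\<zeta>0 \<in> G\<close>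
      by (metis connected_open_path_connected path_connected_def)
    obtain X0 where X0: "\<And>\<zeta>. \<zeta> \<in> path_image q \<Longrightarrow> cmod \<zeta> \<le> X0"
      using compact_imp_bounded[OF compact_path_image[OF q(1)]] by (auto simp: bounded_iff)
    define X where "X = max X0 a"
    have X: "\<bar>Re \<zeta>\<bar> \<le> X" if "\<zeta> \<in> path_image q" for \<zeta>
      using X0[OF that] abs_Re_le_cmod[of \<zeta>] by (simp add: X_def)
    have aX: "a \<le> X" by (simp add: X_def)
    let ?s = "pathstart q" and ?e = "pathfinish q"
    have se: "?s \<in> path_image q" "?e \<in> path_image q" by auto
    \<comment> \<open>The path \<open>q\<close> is prolonged horizontally to the sides of a large box; the prolongations lie outside the
      triangle. A path in \<open>G\<close> from below \<open>q\<close> is prolonged vertically to the bottom and the top of the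
      box, without meeting \<open>q\<close>. The two long paths must cross.\<close>
    define f where "f = linepath (Complex (- X) (Im ?s)) ?s +++ (q +++ linepath ?e (Complex X (Im ?e)))"
    define g where "g = linepath (Complex (Re w) 0) w +++ (\<sigma> +++ linepath \<zeta>0 (Complex 0 (m * a)))"
    have imf: "path_image f = closed_segment (Complex (- X) (Im ?s)) ?s \<union> path_image q \<union> closed_segment ?e (Complex X (Im ?e))"
      unfolding f_def by (simp add: path_image_join Un_assoc)
    have img: "path_image g = closed_segment (Complex (Re w) 0) w \<union> path_image \<sigma> \<union> closed_segment \<zeta>0 (Complex 0 (m * a))"
      unfolding g_def using \<sigma> by (simp add: path_image_join Un_assoc)
    have segL: "Im z = Im ?s \<and> - X \<le> Re z \<and> Re z \<le> - a" if "z \<in> closed_segment (Complex (- X) (Im ?s)) ?s" for z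
      using that q(2) X[OF se(1)] by (subst (asm) closed_segment_same_Im) (auto simp: closed_segment_eq_real_ivl split: if_splits)
    have segR: "Im z = Im ?e \<and> a \<le> Re z \<and> Re z \<le> X" if "z \<in> closed_segment ?e (Complex X (Im ?e))" for z
      using that q(3) X[OF se(2)] by (subst (asm) closed_segment_same_Im) (auto simp: closed_segment_eq_real_ivl split: if_splits)
    have segB: "Re z = Re w \<and> 0 \<le> Im z \<and> Im z \<le> Im w" if "z \<in> closed_segment (Complex (Re w) 0) w" for z
      using that wT by (subst (asm) closed_segment_same_Re) (auto simp: closed_segment_eq_real_ivl split: if_splits)
    have ma: "0 < m * a" using m01 assms(2) by simp
    have segT: "Re z = 0 \<and> m * a / 4 \<le> Im z \<and> Im z \<le> m * a" if "z \<in> closed_segment \<zeta>0 (Complex 0 (m * a))" for z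
      using that ma by (subst (asm) closed_segment_same_Re) (auto simp: \<zeta>0_def closed_segment_eq_real_ivl split: if_splits)
    have \<sigma>T: "0 < Im z \<and> Im z \<le> m * a \<and> \<bar>Re z\<bar> < a \<and> z \<notin> path_image q" if "z \<in> path_image \<sigma>" for z
      using that \<sigma>(2) GU Ta[of z] by (auto simp: U_def T_def)
    have wm: "Im w < m * a / 4" using nw low[OF h(1)] by linarith
    obtain z where z: "z \<in> path_image f" "z \<in> path_image g"
    proof (rule fashoda_complex[of f g "- X" X 0 "m * a"])
      show "path f" "path g" unfolding f_def g_def using q(1) \<sigma> by auto
      show "- X \<le> Re z \<and> Re z \<le> X \<and> 0 \<le> Im z \<and> Im z \<le> m * a" if "z \<in> path_image f" for z
        using that[unfolded imf] segL[of z] segR[of z] low[of z] low[OF se(1)] low[OF se(2)] X[of z] aX ma assms(2)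
        by (auto simp: abs_le_iff)
      show "- X \<le> Re z \<and> Re z \<le> X \<and> 0 \<le> Im z \<and> Im z \<le> m * a" if "z \<in> path_image g" for z
        using that[unfolded img] segB[of z] segT[of z] \<sigma>T[of z] wT wm aX ma assms(2) by (auto simp: abs_le_iff)
    qed (auto simp: f_def g_def)
    have "z \<in> path_image q"
      using z segL[of z] segR[of z] segB[of z] segT[of z] \<sigma>T[of z] wT assms(2) unfolding imf img by fastforce
    then show False
      using z(2)[unfolded img] segB[of z] segT[of z] \<sigma>T[of z] low[of z] h(2)[of z] nw by auto
  qed
  have clG: "Im h \<le> Im x \<and> Im x \<le> m * (a - \<bar>Re x\<bar>)" if "x \<in> closure G" for x
  proof -
    have "closed {x. Im h \<le> Im x \<and> Im x \<le> m * (a - \<bar>Re x\<bar>)}"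
      by (intro closed_Collect_conj closed_Collect_le continuous_intros)
    moreover have "G \<subseteq> {x. Im h \<le> Im x \<and> Im x \<le> m * (a - \<bar>Re x\<bar>)}"
      using above GT by (auto simp: T_def less_imp_le)
    ultimately show ?thesis using that closure_minimal by blast
  qed
  have front: "x \<in> path_image q \<or> Im x = m * (a - \<bar>Re x\<bar>)" if x: "x \<in> frontier G" for x
  proof (rule ccontr)
    assume n: "\<not> ?thesis"
    have "x \<in> closure G" using x by (simp add: frontier_def)
    with clG[OF this] n h0 have "x \<in> U" by (auto simp: U_def T_def)
    moreover have "x \<in> frontier U"
      using x frontier_of_connected_component_subset unfolding G_def by blast
    ultimately show False using \<open>open U\<close> by (simp add: frontier_def interior_open)
  qed
  define B where "B = (8/3) * A / m ^ N"
  have B: "0 \<le> B" using assms(3) m01 by (simp add: B_def)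
  \<comment> \<open>With this \<open>\<kappa>\<close> the harmonic polynomial \<open>a\<^sup>2 - x\<^sup>2 + y\<^sup>2 - \<kappa> y\<close> is at most \<open>0\<close> on the legs, at most
    \<open>a\<^sup>2\<close> in the triangle and at least \<open>a\<^sup>2 / 2\<close> at \<open>\<zeta>0\<close>.\<close>
  define \<kappa> where "\<kappa> = 2 * a / m"
  define P where "P = (\<lambda>\<zeta>. - of_real B * (1 / (of_real a - \<zeta>) ^ N + 1 / (of_real a + \<zeta>) ^ N)
      + of_real (\<Lambda> / a\<^sup>2) * (of_real (a\<^sup>2) - \<zeta>\<^sup>2 + \<i> * of_real \<kappa> * \<zeta>))"
  define \<Phi> where "\<Phi> = (\<lambda>\<zeta>. F \<zeta> * exp (P \<zeta>))"
  have n\<Phi>: "cmod (\<Phi> \<zeta>) = cmod (F \<zeta>) * exp (Re (P \<zeta>))" for \<zeta> by (simp add: \<Phi>_def norm_mult)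
  have ReP: "Re (P \<zeta>) = - B * (Re (1 / (of_real a - \<zeta>) ^ N) + Re (1 / (of_real a + \<zeta>) ^ N))
      + \<Lambda> / a\<^sup>2 * (a\<^sup>2 - (Re \<zeta>)\<^sup>2 + (Im \<zeta>)\<^sup>2 - \<kappa> * Im \<zeta>)" for \<zeta>
  proof -
    have lin: "Re (- of_real B * (X1 + X2) + of_real k * Y) = - B * (Re X1 + Re X2) + k * Re Y" for X1 X2 Y and k :: real
      by simp
    show ?thesis unfolding P_def lin by (simp add: power2_eq_square)
  qed
  have hol\<Phi>: "\<Phi> holomorphic_on {\<zeta>. 0 < Im \<zeta>}"
  proof -
    have "of_real a - \<zeta> \<noteq> 0" "of_real a + \<zeta> \<noteq> 0" if "0 < Im \<zeta>" for \<zeta>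
      using that by (auto simp: complex_eq_iff)
    then show ?thesis unfolding \<Phi>_def P_def by (intro holomorphic_intros hol) auto
  qed
  have clpos: "closure G \<subseteq> {\<zeta>. 0 < Im \<zeta>}" using clG h0 by force
  have side: "Re (1 / (of_real a - \<zeta>) ^ N) \<ge> (3/8) / (a - Re \<zeta>) ^ N"
      "Re (1 / (of_real a + \<zeta>) ^ N) \<ge> (3/8) / (a + Re \<zeta>) ^ N"
      "0 < a - Re \<zeta>" "0 < a + Re \<zeta>"
    if "\<zeta> \<in> closure G" for \<zeta>
  proof -
    have y: "0 < Im \<zeta>" "Im \<zeta> \<le> m * (a - \<bar>Re \<zeta>\<bar>)" using clG[OF that] h0 by auto
    have le: "m * (a - \<bar>Re \<zeta>\<bar>) \<le> m * (a - Re \<zeta>)" "m * (a - \<bar>Re \<zeta>\<bar>) \<le> m * (a + Re \<zeta>)"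
      using m01 by (auto intro!: mult_left_mono)
    have "0 < m * (a - Re \<zeta>)" "0 < m * (a + Re \<zeta>)" using y le by linarith+
    then show pos: "0 < a - Re \<zeta>" "0 < a + Re \<zeta>" using m01 by (simp_all add: zero_less_mult_iff)
    show "Re (1 / (of_real a - \<zeta>) ^ N) \<ge> (3/8) / (a - Re \<zeta>) ^ N"
      using Re_inverse_power_ge[OF assms(1), of "of_real a - \<zeta>"] pos y le by (simp add: m)
    show "Re (1 / (of_real a + \<zeta>) ^ N) \<ge> (3/8) / (a + Re \<zeta>) ^ N"
      using Re_inverse_power_ge[OF assms(1), of "of_real a + \<zeta>"] pos y le by (simp add: m)
  qed
  have bound: "cmod (\<Phi> x) \<le> 1" if x: "x \<in> frontier G" for x
  proof -
    have xc: "x \<in> closure G" using x by (simp add: frontier_def)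
    note sd = side[OF xc]
    have y: "0 < Im x" "Im x \<le> m * (a - \<bar>Re x\<bar>)" using clG[OF xc] h0 by auto
    have "m * (a - \<bar>Re x\<bar>) \<le> m * a" using m01 by (intro mult_left_mono) auto
    with y have yma: "Im x \<le> m * a" by linarith
    define b1 where "b1 = Re (1 / (of_real a - x) ^ N)"
    define b2 where "b2 = Re (1 / (of_real a + x) ^ N)"
    define s where "s = a\<^sup>2 - (Re x)\<^sup>2 + (Im x)\<^sup>2 - \<kappa> * Im x"
    have "0 \<le> (3/8) / (a - Re x) ^ N" "0 \<le> (3/8) / (a + Re x) ^ N" using sd by auto
    then have b0: "0 \<le> b1" "0 \<le> b2" using sd(1,2) unfolding b1_def b2_def by linarith+
    have ReP': "Re (P x) = - B * (b1 + b2) + \<Lambda> / a\<^sup>2 * s" unfolding ReP b1_def b2_def s_def ..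
    from front[OF x] show ?thesis
    proof
      assume xq: "x \<in> path_image q"
      have "m * a \<le> \<kappa>"
      proof -
        have "m * m \<le> 1" using m01 by (simp add: mult_le_one)
        then have "m * a * m \<le> 2 * a" using assms(2) mult_right_mono[of "m * m" 1 a] by (simp add: algebra_simps)
        then show ?thesis using m01 by (simp add: \<kappa>_def le_divide_eq)
      qed
      then have "(Im x)\<^sup>2 \<le> \<kappa> * Im x" using yma y(1) by (simp add: power2_eq_square mult_right_mono)
      then have "s \<le> a\<^sup>2" unfolding s_def by (smt (verit) zero_le_power2)
      then have "\<Lambda> / a\<^sup>2 * s \<le> \<Lambda> / a\<^sup>2 * a\<^sup>2" using assms(4) by (intro mult_left_mono) auto
      also have "\<dots> = \<Lambda>" using assms(2) by simp
      finally have "Re (P x) \<le> \<Lambda>" unfolding ReP' using B b0 by (smt (verit) mult_nonneg_nonneg mult_minus_left)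
      then have "cmod (F x) * exp (Re (P x)) \<le> exp (- \<Lambda>) * exp \<Lambda>"
        using small[OF xq] by (intro mult_mono) auto
      then show ?thesis by (simp add: n\<Phi> flip: exp_add)
    next
      assume leg: "Im x = m * (a - \<bar>Re x\<bar>)"
      define r where "r = a - \<bar>Re x\<bar>"
      have r: "Im x = m * r" "0 < r" using leg y m01 by (auto simp: r_def zero_less_mult_iff)
      have sq: "(Re x)\<^sup>2 = (a - r)\<^sup>2" by (simp add: r_def)
      have "s = r\<^sup>2 * (m\<^sup>2 - 1)"
        unfolding s_def sq r(1) \<kappa>_def using m01 by (simp add: power2_eq_square algebra_simps)
      also have "\<dots> \<le> 0" using m01 by (simp add: mult_nonneg_nonpos power_le_one)
      finally have s0: "\<Lambda> / a\<^sup>2 * s \<le> 0" using assms(4) by (intro mult_nonneg_nonpos) auto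
      have "(3/8) / r ^ N \<le> b1 + b2"
      proof (cases "0 \<le> Re x")
        case True
        then have "r = a - Re x" by (simp add: r_def)
        then show ?thesis using sd(1) b0 unfolding b1_def b2_def by simp
      next
        case False
        then have "r = a + Re x" by (simp add: r_def)
        then show ?thesis using sd(2) b0 unfolding b1_def b2_def by simp
      qed
      then have "B * ((3/8) / r ^ N) \<le> B * (b1 + b2)" using B by (rule mult_left_mono)
      moreover have "B * ((3/8) / r ^ N) = A / Im x ^ N"
        using r m01 by (simp add: B_def power_mult_distrib)
      ultimately have "Re (P x) \<le> - (A / Im x ^ N)" unfolding ReP' using s0 by simp
      then have "cmod (F x) * exp (Re (P x)) \<le> exp (A / Im x ^ N) * exp (- (A / Im x ^ N))"
        using growth[OF y(1) yma] by (intro mult_mono) auto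
      then show ?thesis by (simp add: n\<Phi> flip: exp_add)
    qed
  qed
  have "cmod (\<Phi> \<zeta>0) \<le> 1"
  proof (rule maximum_modulus_frontier[of \<Phi> G])
    show "\<Phi> holomorphic_on interior G" "continuous_on (closure G) \<Phi>"
      using hol\<Phi> clpos closure_subset interior_subset
      by (meson holomorphic_on_subset order_trans holomorphic_on_imp_continuous_on)+
  qed (use \<open>bounded G\<close> bound \<open>\<zeta>0 \<in> G\<close> in auto)
  moreover have "\<Lambda> / 2 - 2 * B / a ^ N \<le> Re (P \<zeta>0)"
  proof -
    have le: "Re (1 / w ^ N) \<le> 1 / a ^ N" if "a \<le> cmod w" for w
    proof -
      have "Re (1 / w ^ N) \<le> 1 / cmod w ^ N" using complex_Re_le_cmod[of "1 / w ^ N"] by (simp add: norm_divide norm_power)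
      also have "\<dots> \<le> 1 / a ^ N" using that assms(2) by (intro divide_left_mono power_mono mult_pos_pos zero_less_power) auto
      finally show ?thesis .
    qed
    have ge: "a \<le> cmod (of_real a - \<zeta>0)" "a \<le> cmod (of_real a + \<zeta>0)"
      using complex_Re_le_cmod[of "of_real a - \<zeta>0"] complex_Re_le_cmod[of "of_real a + \<zeta>0"] by (auto simp: \<zeta>0_def)
    define X where "X = Re (1 / (of_real a - \<zeta>0) ^ N) + Re (1 / (of_real a + \<zeta>0) ^ N)"
    define Y where "Y = a\<^sup>2 - (Re \<zeta>0)\<^sup>2 + (Im \<zeta>0)\<^sup>2 - \<kappa> * Im \<zeta>0"
    have "X \<le> 2 / a ^ N" using le[OF ge(1)] le[OF ge(2)] unfolding X_def by simp
    then have "B * X \<le> B * (2 / a ^ N)" using B by (rule mult_left_mono)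
    then have X: "B * X \<le> 2 * B / a ^ N" by (simp add: mult.commute)
    have "a\<^sup>2 / 2 \<le> Y" using m01 by (simp add: Y_def \<zeta>0_def \<kappa>_def power2_eq_square)
    then have "\<Lambda> / a\<^sup>2 * (a\<^sup>2 / 2) \<le> \<Lambda> / a\<^sup>2 * Y" using assms(4) by (intro mult_left_mono) auto
    moreover have "\<Lambda> / a\<^sup>2 * (a\<^sup>2 / 2) = \<Lambda> / 2" using assms(2) by simp
    moreover have "Re (P \<zeta>0) = - (B * X) + \<Lambda> / a\<^sup>2 * Y" unfolding ReP X_def Y_def by simp
    ultimately show ?thesis using X by linarith
  qed
  ultimately have "cmod (F \<zeta>0) * exp (\<Lambda> / 2 - 2 * B / a ^ N) \<le> 1"
    unfolding n\<Phi> by (meson exp_le_cancel_iff mult_left_mono norm_ge_zero order_trans)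
  then have "cmod (F \<zeta>0) * exp (\<Lambda> / 2 - 2 * B / a ^ N) * exp (2 * B / a ^ N - \<Lambda> / 2) \<le> 1 * exp (2 * B / a ^ N - \<Lambda> / 2)"
    by (rule mult_right_mono) simp
  then have "cmod (F \<zeta>0) \<le> exp (2 * B / a ^ N - \<Lambda> / 2)"
    by (simp add: mult.assoc flip: exp_add)
  then show ?thesis unfolding \<zeta>0_def B_def .
qed

lemma exp_diff_le_left_half_plane:
  assumes "Re u \<le> 0" "Re v \<le> 0"
  shows "cmod (exp u - exp v) \<le> cmod (u - v)"
proof -
  have "cmod (exp u - exp v) \<le> 1 * cmod (u - v)"
  proof (rule field_differentiable_bound[where f' = exp])
    show "convex {z. Re z \<le> 0}" by (rule convex_halfspace_Re_le)
    show "(exp has_field_derivative exp z) (at z within {z. Re z \<le> 0})" for z :: complex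
      by (auto intro!: derivative_eq_intros)
  qed (use assms in auto)
  then show ?thesis by simp
qed

text \<open>In the coordinate \<open>\<zeta>\<close> with \<open>z = exp (i \<zeta>)\<close> the disk without its centre is the upper half-plane
  modulo translations. An arc on which \<open>g\<close> is very small lies close to the circle, since \<open>|g 0| = \<eta>\<close>,
  so it becomes a low path; if its ends are far apart, it crosses a triangle of fixed size. By the
  estimate in the triangle \<open>g\<close> is then small at a point of fixed modulus less than \<open>1\<close>,
  and hence \<open>|g 0| < \<eta>\<close>.\<close>

lemma no_long_small_arc:
  assumes "0 < \<eta>" "0 < \<delta>"
  obtains \<epsilon> where "0 < \<epsilon>"
    "\<And>g q. omitting_01 g \<Longrightarrow> cmod (g 0) = \<eta> \<Longrightarrow> path q \<Longrightarrow> path_image q \<subseteq> unit_disk \<Longrightarrow>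
       (\<And>z. z \<in> path_image q \<Longrightarrow> cmod (g z) \<le> \<epsilon>) \<Longrightarrow> dist (pathstart q) (pathfinish q) < \<delta>"
proof -
  obtain N :: nat and A' where NA: "0 < N" "0 < A'"
    "\<And>g z. omitting_01 g \<Longrightarrow> cmod (g 0) \<le> \<eta> \<Longrightarrow> cmod z < 1 \<Longrightarrow> cmod (g z) \<le> exp (A' / (1 - cmod z) ^ N)"
    using omitting_01_growth[of \<eta>] by metis
  define A where "A = A' * 2 ^ N"
  define m where "m = 1 / (4 * real N)"
  define a where "a = min (\<delta> / 4) 1"
  define y0 where "y0 = m * a / 4"
  have m: "0 < m" "m \<le> 1" using NA(1) by (auto simp: m_def divide_simps)
  have a: "0 < a" "a \<le> 1" "4 * a \<le> \<delta>" using assms by (auto simp: a_def)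
  have ma: "0 < m * a" "m * a \<le> 1" "m * a \<le> a"
    using m a mult_le_one[of m a] mult_right_mono[of m 1 a] by auto
  have y0: "0 < y0" "4 * y0 \<le> a" using ma by (auto simp: y0_def)
  obtain \<epsilon>1 where \<epsilon>1: "0 < \<epsilon>1"
    "\<And>g z. omitting_01 g \<Longrightarrow> cmod z \<le> exp (- y0) \<Longrightarrow> cmod (g z) \<le> \<epsilon>1 \<Longrightarrow> cmod (g 0) < \<eta>"
    using small_near_imp_small_at_0[of "exp (- y0)" \<eta>] y0 assms by auto
  define C where "C = 2 * ((8/3) * A / m ^ N) / a ^ N"
  \<comment> \<open>so large that the bound provided by the triangle estimate does not exceed \<open>\<epsilon>1\<close>\<close>
  define \<Lambda> where "\<Lambda> = max 0 (2 * (C - ln \<epsilon>1))"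
  have \<Lambda>: "0 \<le> \<Lambda>" "exp (C - \<Lambda> / 2) \<le> \<epsilon>1"
  proof -
    have "2 * (C - ln \<epsilon>1) \<le> \<Lambda>" by (simp add: \<Lambda>_def)
    then have "C - \<Lambda> / 2 \<le> ln \<epsilon>1" by (simp add: field_simps)
    then show "exp (C - \<Lambda> / 2) \<le> \<epsilon>1" using \<epsilon>1(1) by (metis exp_le_cancel_iff exp_ln)
  qed (simp add: \<Lambda>_def)
  define \<epsilon> where "\<epsilon> = min \<epsilon>1 (exp (- \<Lambda>))"
  have no_crossing: False
    if g: "omitting_01 g" "cmod (g 0) = \<eta>" and q: "path q" "Re (pathstart q) + 2 * a \<le> Re (pathfinish q)"
      and sm: "\<And>\<zeta>. \<zeta> \<in> path_image q \<Longrightarrow> 0 < Im \<zeta> \<and> cmod (g (exp (\<i> * \<zeta>))) \<le> \<epsilon>" for g q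
  proof -
    define c where "c = (Re (pathstart q) + Re (pathfinish q)) / 2"
    define F where "F = (\<lambda>\<zeta>. g (exp (\<i> * (\<zeta> + of_real c))))"
    define p where "p = (\<lambda>\<zeta>. \<zeta> - of_real c) \<circ> q"
    have im_p: "\<zeta> \<in> path_image p \<longleftrightarrow> \<zeta> + of_real c \<in> path_image q" for \<zeta>
      by (force simp: p_def path_image_compose image_iff algebra_simps)
    have growth: "cmod (F \<zeta>) \<le> exp (A / Im \<zeta> ^ N)" if "0 < Im \<zeta>" "Im \<zeta> \<le> m * a" for \<zeta>
    proof -
      let ?z = "exp (\<i> * (\<zeta> + of_real c))"
      have nz: "cmod ?z = exp (- Im \<zeta>)" by simp
      \<comment> \<open>the height \<open>Im \<zeta>\<close> is comparable to the distance from the circle\<close>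
      have "exp (- Im \<zeta>) \<le> 1 - Im \<zeta> / 2"
      proof -
        have "Im \<zeta> \<le> 1" using that(2) ma by linarith
        have "1 / (1 + Im \<zeta>) \<le> 1 - Im \<zeta> / 2"
        proof -
          have "0 \<le> Im \<zeta> * (1 - Im \<zeta>)" using that(1) \<open>Im \<zeta> \<le> 1\<close> by simp
          then have "1 \<le> (1 - Im \<zeta> / 2) * (1 + Im \<zeta>)" by (simp add: algebra_simps)
          then show ?thesis using that(1) by (simp add: divide_le_eq)
        qed
        moreover have "exp (- Im \<zeta>) \<le> 1 / (1 + Im \<zeta>)"
          using exp_ge_add_one_self[of "Im \<zeta>"] that(1) by (simp add: exp_minus inverse_eq_divide frac_le)
        ultimately show ?thesis by linarith
      qed
      then have le: "Im \<zeta> / 2 \<le> 1 - cmod ?z" using nz by simp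
      have "cmod (F \<zeta>) \<le> exp (A' / (1 - cmod ?z) ^ N)"
        unfolding F_def using g that(1) by (intro NA(3)) auto
      also have "A' / (1 - cmod ?z) ^ N \<le> A' / (Im \<zeta> / 2) ^ N"
        using le that(1) NA(2) by (intro divide_left_mono power_mono mult_pos_pos zero_less_power) auto
      also have "\<dots> = A / Im \<zeta> ^ N" by (simp add: A_def power_divide)
      finally show ?thesis by simp
    qed
    have low: "0 < Im \<zeta> \<and> Im \<zeta> < m * a / 4" if "\<zeta> \<in> path_image p" for \<zeta>
    proof -
      have z: "0 < Im \<zeta>" "cmod (g (exp (\<i> * (\<zeta> + of_real c)))) \<le> \<epsilon>1"
        using sm[of "\<zeta> + of_real c"] that by (auto simp: im_p \<epsilon>_def)
      have "\<not> cmod (exp (\<i> * (\<zeta> + of_real c))) \<le> exp (- y0)"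
        using \<epsilon>1(2)[OF g(1) _ z(2)] g(2) by auto
      then show ?thesis using z(1) by (simp add: y0_def)
    qed
    have "cmod (F (Complex 0 (m * a / 4))) \<le> exp (C - \<Lambda> / 2)"
      unfolding C_def
    proof (rule triangle_estimate[OF NA(1) a(1) _ \<Lambda>(1) m_def _ growth _ _ _ low])
      show "0 \<le> A" using NA(2) by (simp add: A_def)
      show "F holomorphic_on {\<zeta>. 0 < Im \<zeta>}"
      proof -
        have "(g \<circ> (\<lambda>\<zeta>. exp (\<i> * (\<zeta> + of_real c)))) holomorphic_on {\<zeta>. 0 < Im \<zeta>}"
          using g(1) by (intro holomorphic_on_compose_gen[where t = "unit_disk"] holomorphic_intros)
            (auto simp: omitting_01_def)
        then show ?thesis by (simp add: F_def o_def)
      qed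
      show "path p" unfolding p_def using q(1) by (intro path_continuous_image continuous_intros)
      show "Re (pathstart p) \<le> - a" "a \<le> Re (pathfinish p)"
        using q(2) by (auto simp: p_def pathstart_compose pathfinish_compose c_def field_simps)
      show "cmod (F \<zeta>) \<le> exp (- \<Lambda>)" if "\<zeta> \<in> path_image p" for \<zeta>
        using sm[of "\<zeta> + of_real c"] that by (auto simp: im_p F_def \<epsilon>_def)
    qed
    also have "\<dots> \<le> \<epsilon>1" by (rule \<Lambda>(2))
    finally show False
      using \<epsilon>1(2)[OF g(1), of "exp (\<i> * (Complex 0 (m * a / 4) + of_real c))"] g(2)
      by (auto simp: F_def y0_def)
  qed
  have "dist (pathstart q) (pathfinish q) < \<delta>"
    if g: "omitting_01 g" "cmod (g 0) = \<eta>" and q: "path q" "path_image q \<subseteq> unit_disk"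
      and sm: "\<And>z. z \<in> path_image q \<Longrightarrow> cmod (g z) \<le> \<epsilon>" for g q
  proof (rule ccontr)
    assume far: "\<not> dist (pathstart q) (pathfinish q) < \<delta>"
    have off: "exp (- y0) < cmod z" if "z \<in> path_image q" for z
      using \<epsilon>1(2)[OF g(1), of z] sm[OF that] g(2) by (force simp: \<epsilon>_def)
    then have nz: "path_image q \<subseteq> - {0}" by force
    obtain l where l: "path l" "\<And>t. t \<in> {0..1} \<Longrightarrow> exp (l t) = q t"
      by (rule covering_space_lift_path[OF covering_space_exp_punctured_plane q(1) nz]) auto
    define p where "p = (\<lambda>z. - \<i> * z) \<circ> l"
    have p: "path p" unfolding p_def using l(1) by (intro path_continuous_image continuous_intros)
    have ep: "exp (\<i> * p t) = q t" if "t \<in> {0..1}" for t using l(2)[OF that] by (simp add: p_def)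
    have Imp: "0 < Im (p t)" "Im (p t) < y0" "cmod (g (exp (\<i> * p t))) \<le> \<epsilon>" if "t \<in> {0..1}" for t
    proof -
      have qt: "q t \<in> path_image q" using that by (simp add: path_image_def)
      have "cmod (q t) = exp (- Im (p t))" using ep[OF that] by (metis Re_i_times norm_exp_eq_Re)
      then show "0 < Im (p t)" "Im (p t) < y0" using off[OF qt] subsetD[OF q(2) qt] by simp_all
      show "cmod (g (exp (\<i> * p t))) \<le> \<epsilon>" using sm[OF qt] ep[OF that] by simp
    qed
    have "\<delta> \<le> cmod (exp (\<i> * p 0) - exp (\<i> * p 1))"
      using far ep[of 0] ep[of 1] by (simp add: dist_norm pathstart_def pathfinish_def)
    also have "\<dots> \<le> cmod (\<i> * p 0 - \<i> * p 1)"
      using Imp(1)[of 0] Imp(1)[of 1] by (intro exp_diff_le_left_half_plane) auto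
    also have "\<dots> = cmod (p 0 - p 1)" by (metis mult_1 norm_ii norm_mult right_diff_distrib)
    also have "\<dots> \<le> \<bar>Re (p 0 - p 1)\<bar> + \<bar>Im (p 0 - p 1)\<bar>" by (rule cmod_le)
    finally have "2 * a \<le> \<bar>Re (p 0) - Re (p 1)\<bar>"
      using Imp(1,2)[of 0] Imp(1,2)[of 1] y0 a by auto
    then consider "Re (p 0) + 2 * a \<le> Re (p 1)" | "Re (p 1) + 2 * a \<le> Re (p 0)" by linarith
    then show False
    proof cases
      case 1
      show False
        by (rule no_crossing[OF g p]) (use 1 Imp in \<open>auto simp: pathstart_def pathfinish_def path_image_def\<close>)
    next
      case 2
      show False
        by (rule no_crossing[OF g, of "reversepath p"])
           (use 2 Imp p in \<open>auto simp: path_image_def[of p] pathstart_def[of p] pathfinish_def[of p]\<close>)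
    qed
  qed
  moreover have "0 < \<epsilon>" using \<epsilon>1(1) by (simp add: \<epsilon>_def)
  ultimately show ?thesis using that by blast
qed

section \<open>Landing of curves along which the function is small\<close>

lemma eventually_at_left_1D:
  assumes "\<forall>\<^sub>F t in at_left (1::real). P t"
  obtains T where "0 \<le> T" "T < 1" "\<And>t. T \<le> t \<Longrightarrow> t < 1 \<Longrightarrow> P t"
proof -
  obtain b where b: "b < 1" "\<And>t. b < t \<Longrightarrow> t < 1 \<Longrightarrow> P t"
    using assms unfolding eventually_at_left_field by blast
  show ?thesis
    by (rule that[of "max 0 ((b + 1) / 2)"]) (use b in auto)
qed

lemma tendsto_0_at_left_1D:
  fixes f :: "real \<Rightarrow> complex"
  assumes "(f \<longlongrightarrow> 0) (at_left 1)" "0 < e"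
  obtains T where "0 \<le> T" "T < 1" "\<And>t. T \<le> t \<Longrightarrow> t < 1 \<Longrightarrow> cmod (f t) < e"
  using eventually_at_left_1D[OF tendstoD[OF assms]] by (auto simp: dist_norm)

lemma eventually_at_left_1I:
  assumes "T < (1::real)" "\<And>t. T \<le> t \<Longrightarrow> t < 1 \<Longrightarrow> P t"
  shows "\<forall>\<^sub>F t in at_left 1. P t"
  unfolding eventually_at_left_field using assms by (auto intro!: exI[of _ T])

lemma curve_segment_path:
  fixes c :: "real \<Rightarrow> 'a::topological_space"
  assumes "continuous_on {0..<1} c" "0 \<le> s" "s \<le> t" "t < 1"
  shows "path (c \<circ> linepath s t)" "path_image (c \<circ> linepath s t) = c ` {s..t}"
    "pathstart (c \<circ> linepath s t) = c s" "pathfinish (c \<circ> linepath s t) = c t"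
proof -
  have im: "path_image (linepath s t) = {s..t}" using assms by (simp add: closed_segment_eq_real_ivl1)
  show "path (c \<circ> linepath s t)"
    using assms(2-4) by (intro path_continuous_image path_linepath continuous_on_subset[OF assms(1)]) (auto simp: closed_segment_eq_real_ivl1)
  show "path_image (c \<circ> linepath s t) = c ` {s..t}" by (simp only: path_image_compose im)
qed (auto simp: pathstart_compose pathfinish_compose)

abbreviation vanishing_along :: "(complex \<Rightarrow> complex) \<Rightarrow> (real \<Rightarrow> complex) \<Rightarrow> bool" where
  "vanishing_along g c \<equiv> ((\<lambda>t. g (c t)) \<longlongrightarrow> 0) (at_left 1)"

text \<open>Any two points of a late tail are joined by an arc of the curve on which \<open>g\<close> is small, hence they
  are close to each other. The limit is not in the disk because \<open>g\<close> has no zero there.\<close>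

lemma small_curve_lands:
  fixes c :: "real \<Rightarrow> complex"
  assumes g: "omitting_01 g" and c: "continuous_on {0..<1} c" "c ` {0..<1} \<subseteq> unit_disk"
    and lim: "vanishing_along g c"
  obtains \<xi> where "\<xi> \<in> sphere 0 1" "(c \<longlongrightarrow> \<xi>) (at_left 1)"
proof -
  have g0: "0 < cmod (g 0)" using g by (auto simp: omitting_01_def)
  have close: "\<exists>T. 0 \<le> T \<and> T < 1 \<and> (\<forall>s t. T \<le> s \<longrightarrow> s < 1 \<longrightarrow> T \<le> t \<longrightarrow> t < 1 \<longrightarrow> dist (c s) (c t) < \<delta>)" if d: "0 < \<delta>" for \<delta>
  proof -
    obtain \<epsilon> where \<epsilon>: "0 < \<epsilon>"
      "\<And>g' q. omitting_01 g' \<Longrightarrow> cmod (g' 0) = cmod (g 0) \<Longrightarrow> path q \<Longrightarrow> path_image q \<subseteq> unit_disk \<Longrightarrow>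
         (\<And>z. z \<in> path_image q \<Longrightarrow> cmod (g' z) \<le> \<epsilon>) \<Longrightarrow> dist (pathstart q) (pathfinish q) < \<delta>"
      using no_long_small_arc[OF g0 d] by metis
    obtain T where T: "0 \<le> T" "T < 1" "\<And>t. T \<le> t \<Longrightarrow> t < 1 \<Longrightarrow> cmod (g (c t)) < \<epsilon>"
      using tendsto_0_at_left_1D[OF lim \<epsilon>(1)] by blast
    have *: "dist (c s) (c t) < \<delta>" if st: "T \<le> s" "s \<le> t" "t < 1" for s t
    proof -
      note p = curve_segment_path[OF c(1), of s t]
      have "dist (pathstart (c \<circ> linepath s t)) (pathfinish (c \<circ> linepath s t)) < \<delta>"
      proof (rule \<epsilon>(2)[OF g refl])
        show "path (c \<circ> linepath s t)" using p st T by auto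
        show "path_image (c \<circ> linepath s t) \<subseteq> unit_disk" using p(2) st T(1) c(2) by fastforce
        show "cmod (g z) \<le> \<epsilon>" if "z \<in> path_image (c \<circ> linepath s t)" for z
          using that p(2) st T by (fastforce intro: less_imp_le)
      qed
      then show ?thesis using p(3,4) st T by simp
    qed
    then have "dist (c s) (c t) < \<delta>" if "T \<le> s" "s < 1" "T \<le> t" "t < 1" for s t
      using that by (metis dist_commute linear)
    with T show ?thesis by blast
  qed
  define x where "x = (\<lambda>n::nat. c (1 - 1 / (real n + 1)))"
  have tn: "(\<lambda>n::nat. 1 - 1 / (real n + 1)) \<longlonglongrightarrow> 1" by real_asymp
  have tn1: "1 - 1 / (real n + 1) < 1" for n by simp
  have late: "\<exists>M. \<forall>n\<ge>M. T \<le> 1 - 1 / (real n + 1)" if "T < 1" for T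
    using order_tendstoD(1)[OF tn that] by (auto simp: eventually_sequentially intro: less_imp_le)
  have "Cauchy x"
    unfolding Cauchy_def
  proof (intro allI impI)
    fix e :: real assume "0 < e"
    with close[OF this] late tn1 show "\<exists>M. \<forall>m\<ge>M. \<forall>n\<ge>M. dist (x m) (x n) < e"
      unfolding x_def by metis
  qed
  then obtain \<xi> where \<xi>: "x \<longlonglongrightarrow> \<xi>" by (auto simp: Cauchy_convergent_iff convergent_def)
  have cx: "(c \<longlongrightarrow> \<xi>) (at_left 1)"
  proof (rule tendstoI)
    fix e :: real assume "0 < e"
    then obtain T where T: "0 \<le> T" "T < 1" "\<And>s t. T \<le> s \<Longrightarrow> s < 1 \<Longrightarrow> T \<le> t \<Longrightarrow> t < 1 \<Longrightarrow> dist (c s) (c t) < e / 2"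
      using close[of "e / 2"] by auto
    have "dist (c t) \<xi> \<le> e / 2" if "T \<le> t" "t < 1" for t
    proof (rule tendsto_upperbound)
      show "(\<lambda>n. dist (c t) (x n)) \<longlonglongrightarrow> dist (c t) \<xi>" by (intro tendsto_intros \<xi>)
      obtain M where "\<forall>n\<ge>M. T \<le> 1 - 1 / (real n + 1)" using late[OF T(2)] by blast
      then show "\<forall>\<^sub>F n in sequentially. dist (c t) (x n) \<le> e / 2"
        unfolding eventually_sequentially x_def using T(3)[OF that] tn1 by (meson less_imp_le)
    qed simp
    then show "\<forall>\<^sub>F t in at_left 1. dist (c t) \<xi> < e"
      using \<open>0 < e\<close> by (intro eventually_at_left_1I[OF T(2)]) force
  qed
  have ev: "\<forall>\<^sub>F t in at_left 1. c t \<in> unit_disk"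
    using c(2) by (intro eventually_at_left_1I[of 0]) force+
  have "cmod \<xi> \<le> 1"
    by (rule tendsto_upperbound[OF tendsto_norm[OF cx]]) (use ev in \<open>auto elim!: eventually_mono\<close>)
  moreover have "\<not> cmod \<xi> < 1"
  proof
    assume "cmod \<xi> < 1"
    then have "isCont g \<xi>"
      using g by (auto simp: omitting_01_def intro!: holomorphic_on_imp_continuous_on continuous_on_interior[of "unit_disk"])
    then have "((\<lambda>t. g (c t)) \<longlongrightarrow> g \<xi>) (at_left 1)" using cx isCont_tendsto_compose by blast
    then have "g \<xi> = 0" using lim tendsto_unique trivial_limit_at_left_real by blast
    then show False using g \<open>cmod \<xi> < 1\<close> by (auto simp: omitting_01_def)
  qed
  ultimately show ?thesis using that cx by auto
qed

text \<open>The joining arcs have ends that come arbitrarily close to each other.\<close>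

lemma joined_small_curves_land_together:
  assumes g: "omitting_01 g"
    and lim: "(c1 \<longlongrightarrow> \<xi>1) (at_left (1::real))" "(c2 \<longlongrightarrow> \<xi>2) (at_left 1)"
    and joined: "\<And>\<epsilon>. 0 < \<epsilon> \<Longrightarrow> \<forall>\<^sub>F t in at_left 1. \<exists>q. path q \<and> path_image q \<subseteq> unit_disk \<and>
        pathstart q = c1 t \<and> pathfinish q = c2 t \<and> (\<forall>z\<in>path_image q. cmod (g z) \<le> \<epsilon>)"
  shows "\<xi>1 = \<xi>2"
proof (rule ccontr)
  assume ne: "\<xi>1 \<noteq> \<xi>2"
  have g0: "0 < cmod (g 0)" using g by (auto simp: omitting_01_def)
  define \<delta> where "\<delta> = dist \<xi>1 \<xi>2 / 2"
  have \<delta>: "0 < \<delta>" "\<delta> < dist \<xi>1 \<xi>2" using ne by (auto simp: \<delta>_def)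
  obtain \<epsilon> where \<epsilon>: "0 < \<epsilon>"
    "\<And>g' q. omitting_01 g' \<Longrightarrow> cmod (g' 0) = cmod (g 0) \<Longrightarrow> path q \<Longrightarrow> path_image q \<subseteq> unit_disk \<Longrightarrow>
       (\<And>z. z \<in> path_image q \<Longrightarrow> cmod (g' z) \<le> \<epsilon>) \<Longrightarrow> dist (pathstart q) (pathfinish q) < \<delta>"
    using no_long_small_arc[OF g0 \<delta>(1)] by metis
  have "((\<lambda>t. dist (c1 t) (c2 t)) \<longlongrightarrow> dist \<xi>1 \<xi>2) (at_left 1)" by (intro tendsto_intros lim)
  then have "\<forall>\<^sub>F t in at_left 1. \<delta> < dist (c1 t) (c2 t)" using \<delta>(2) order_tendstoD(1) by blast
  with joined[OF \<epsilon>(1)] have "\<forall>\<^sub>F t in at_left (1::real). False"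
  proof eventually_elim
    case (elim t)
    then obtain q where "path q" "path_image q \<subseteq> unit_disk"
        "pathstart q = c1 t" "pathfinish q = c2 t" "\<And>z. z\<in>path_image q \<Longrightarrow> cmod (g z) \<le> \<epsilon>"
      by blast
    with \<epsilon>(2)[OF g refl, of q] elim(2) show ?case by simp
  qed
  then show False by (simp add: trivial_limit_at_left_real)
qed

text \<open>Two curves define the same end of the sublevel sets of \<open>|g|\<close>: for each \<open>\<eta>\<close> their tails lie in the
  same component of \<open>{|g| < \<eta>}\<close>. A connected set \<open>V\<close> in place of the component is easier to
  construct and to combine.\<close>

definition same_end :: "(complex \<Rightarrow> complex) \<Rightarrow> (real \<Rightarrow> complex) \<Rightarrow> (real \<Rightarrow> complex) \<Rightarrow> bool" where
  "same_end g c1 c2 \<longleftrightarrow> (\<forall>\<eta>>0. \<exists>T V. 0 \<le> T \<and> T < 1 \<and> connected V \<and> V \<subseteq> unit_disk \<and>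
     (\<forall>z\<in>V. cmod (g z) < \<eta>) \<and> c1 ` {T..<1} \<subseteq> V \<and> c2 ` {T..<1} \<subseteq> V)"

lemma same_end_sym: "same_end g c1 c2 \<Longrightarrow> same_end g c2 c1"
  unfolding same_end_def by meson

lemma same_end_trans:
  assumes "same_end g c1 c2" "same_end g c2 c3"
  shows "same_end g c1 c3"
  unfolding same_end_def
proof (intro allI impI)
  fix \<eta> :: real assume "0 < \<eta>"
  with assms(1) obtain T V where V: "0 \<le> T" "T < 1" "connected V" "V \<subseteq> unit_disk"
     "\<forall>z\<in>V. cmod (g z) < \<eta>" "c1 ` {T..<1} \<subseteq> V" "c2 ` {T..<1} \<subseteq> V"
    unfolding same_end_def by meson
  from \<open>0 < \<eta>\<close> assms(2) obtain T' V' where V': "0 \<le> T'" "T' < 1" "connected V'" "V' \<subseteq> unit_disk"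
     "\<forall>z\<in>V'. cmod (g z) < \<eta>" "c2 ` {T'..<1} \<subseteq> V'" "c3 ` {T'..<1} \<subseteq> V'"
    unfolding same_end_def by meson
  have "c2 (max T T') \<in> V \<inter> V'" using V V' by auto
  then have "connected (V \<union> V')" using V(3) V'(3) connected_Un by blast
  then show "\<exists>T V. 0 \<le> T \<and> T < 1 \<and> connected V \<and> V \<subseteq> unit_disk \<and>
     (\<forall>z\<in>V. cmod (g z) < \<eta>) \<and> c1 ` {T..<1} \<subseteq> V \<and> c3 ` {T..<1} \<subseteq> V"
    using V V' by (intro exI[of _ "max T T'"] exI[of _ "V \<union> V'"]) (auto simp: image_subset_iff)
qed

lemma same_end_imp_small:
  assumes "same_end g c1 c2"
  shows "vanishing_along g c2"
proof (rule tendstoI)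
  fix e :: real assume "0 < e"
  with assms obtain T V where V: "T < 1" "\<forall>z\<in>V. cmod (g z) < e" "c2 ` {T..<1} \<subseteq> V"
    unfolding same_end_def by meson
  then show "\<forall>\<^sub>F t in at_left 1. dist (g (c2 t)) 0 < e"
    by (intro eventually_at_left_1I[of T]) (auto simp: image_subset_iff)
qed

text \<open>A point \<open>z\<close> of a Stolz angle with opening \<open>\<alpha>\<close> lies in a disk that is internally tangent to the
  circle at \<open>\<xi>\<close>, at distance from its centre at most \<open>sin \<alpha>\<close> times its radius. The centre is on the
  radius to \<open>\<xi>\<close>, where \<open>g\<close> is small, and smallness carries over to \<open>z\<close> by Schottky's theorem.\<close>

lemma nontangential_limit:
  assumes g: "omitting_01 g" and \<xi>: "\<xi> \<in> unit_circle"
    and rad: "((\<lambda>r. g (of_real r * \<xi>)) \<longlongrightarrow> 0) (at_left 1)"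
    and c: "lands_nontangentially_at c \<xi>"
  shows "vanishing_along g c"
proof (rule tendstoI)
  fix e :: real assume e: "0 < e"
  obtain \<alpha> \<rho> where \<alpha>: "0 < \<alpha>" "\<alpha> < pi / 2" and stolz: "\<forall>\<^sub>F t in at_left 1. c t \<in> stolz_angle \<xi> \<alpha> \<rho>"
    and land: "(c \<longlongrightarrow> \<xi>) (at_left 1)"
    using c unfolding lands_nontangentially_at_def lands_at_def by blast
  have sc: "0 < sin \<alpha>" "0 < cos \<alpha>" using \<alpha> by (auto intro: sin_gt_zero cos_gt_zero)
  have "(sin \<alpha>)\<^sup>2 < 1" using sin_cos_squared_add[of \<alpha>] zero_less_power[OF sc(2), of 2] by linarith
  then have s1: "sin \<alpha> < 1" using sc(1) by (simp add: power_less_one_iff abs_square_less_1)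
  obtain \<epsilon> where \<epsilon>: "0 < \<epsilon>"
    "\<And>g z. omitting_01 g \<Longrightarrow> cmod z \<le> sin \<alpha> \<Longrightarrow> cmod (g 0) \<le> \<epsilon> \<Longrightarrow> cmod (g z) < e"
    using small_at_0_imp_small_near[OF sc(1) s1 e] by metis
  obtain T where T: "0 \<le> T" "T < 1" "\<And>r. T \<le> r \<Longrightarrow> r < 1 \<Longrightarrow> cmod (g (of_real r * \<xi>)) < \<epsilon>"
    using tendsto_0_at_left_1D[OF rad \<epsilon>(1)] by metis
  have "0 < cos \<alpha> * (1 - T)" using sc T by simp
  from tendstoD[OF land this] stolz
  show "\<forall>\<^sub>F t in at_left 1. dist (g (c t)) 0 < e"
  proof eventually_elim
    case (elim t)
    define z where "z = c t"
    define w where "w = 1 - cnj \<xi> * z"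
    have \<xi>1: "cmod \<xi> = 1" "\<xi> * cnj \<xi> = 1" using \<xi> by (auto simp: complex_norm_square[symmetric])
    have z: "cmod z < 1" "\<bar>Arg w\<bar> < \<alpha>" using elim(2) by (auto simp: stolz_angle_def z_def w_def)
    have "\<xi> * w = \<xi> - z" using \<xi>1(2) by (simp add: w_def algebra_simps)
    then have nw: "cmod w = dist z \<xi>" using \<xi>1(1) by (metis dist_norm mult_1 norm_minus_commute norm_mult)
    have w0: "w \<noteq> 0" using nw z \<xi>1 by auto
    \<comment> \<open>the radius of the tangent disk in which \<open>z\<close> has relative distance at most \<open>sin \<alpha>\<close> from the centre\<close>
    define R where "R = cmod w / cos \<alpha>"
    have "0 < cmod w" using w0 by simp
    then have "0 < R" unfolding R_def using sc(2) by (rule divide_pos_pos)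
    then have R: "0 < R" "R < 1 - T" "cmod w = R * cos \<alpha>"
      using sc elim(1) nw by (simp_all add: R_def z_def divide_less_eq mult.commute)
    define h where "h = (\<lambda>u. g (\<xi> * (of_real (1 - R) + of_real R * u)))"
    have om: "omitting_01 h"
      unfolding h_def
    proof (rule omitting_01_compose[OF g])
      show "(\<lambda>u. \<xi> * (of_real (1 - R) + of_real R * u)) ` unit_disk \<subseteq> unit_disk"
      proof (clarsimp simp: norm_mult \<xi>1 simp del: of_real_diff)
        fix u :: complex assume "cmod u < 1"
        have "cmod (of_real (1 - R) + of_real R * u) \<le> (1 - R) + R * cmod u"
          using norm_triangle_ineq[of "of_real (1 - R)" "of_real R * u"] R T by (simp add: norm_mult del: of_real_diff)
        also have "\<dots> < (1 - R) + R * 1" using R \<open>cmod u < 1\<close> by (intro add_strict_left_mono mult_strict_left_mono) auto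
        finally show "cmod (of_real (1 - R) + of_real R * u) < 1" by simp
      qed
    qed (intro holomorphic_intros)
    define u where "u = (of_real R - w) / of_real R"
    have hu: "h u = g z"
    proof -
      have "\<xi> * (of_real (1 - R) + of_real R * u) = \<xi> * (1 - w)" using R by (simp add: u_def)
      also have "\<dots> = z" using \<xi>1(2) by (simp add: w_def algebra_simps)
      finally show ?thesis by (simp add: h_def)
    qed
    have h0: "cmod (h 0) \<le> \<epsilon>" using T(3)[of "1 - R"] R by (simp add: h_def mult.commute)
    have "cos \<alpha> \<le> cos (Arg w)" using z(2) \<alpha> cos_mono_le_eq[of "\<bar>Arg w\<bar>" \<alpha>] by (simp add: cos_abs_real)
    then have "cmod w * cos \<alpha> \<le> cmod w * cos (Arg w)" by (intro mult_left_mono) auto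
    also have "\<dots> = Re w" by (simp add: cmod_def cos_Arg w0) 
    finally have Rew: "cmod w * cos \<alpha> \<le> Re w" .
    have "(cmod (of_real R - w))\<^sup>2 = R\<^sup>2 - 2 * R * Re w + (cmod w)\<^sup>2"
      unfolding cmod_power2 by (simp add: power2_eq_square algebra_simps)
    also have "\<dots> \<le> R\<^sup>2 - 2 * R * (cmod w * cos \<alpha>) + (cmod w)\<^sup>2"
      using R Rew by (intro add_right_mono diff_left_mono mult_left_mono) auto
    also have "\<dots> = R\<^sup>2 * (1 - (cos \<alpha>)\<^sup>2)" unfolding R(3) by (simp add: power2_eq_square algebra_simps)
    also have "\<dots> = (R * sin \<alpha>)\<^sup>2" by (simp add: power_mult_distrib sin_squared_eq)
    finally have "cmod (of_real R - w) \<le> R * sin \<alpha>" by (rule power2_le_imp_le) (use R sc in simp)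
    then have "cmod u \<le> sin \<alpha>" using R by (simp add: u_def norm_divide divide_le_eq mult.commute)
    from \<epsilon>(2)[OF om this h0] show ?case by (simp add: hu z_def)
  qed
qed

section \<open>Comparison of a landing curve with the radius\<close>

text \<open>The Cayley transform from the upper half-plane to the disk that takes \<open>0\<close> to the boundary point \<open>\<xi>\<close>
  and the imaginary axis to the diameter through \<open>\<xi>\<close>.\<close>

definition half_to_disk :: "complex \<Rightarrow> complex \<Rightarrow> complex" where
  "half_to_disk \<xi> \<zeta> = \<xi> * (1 + \<i> * \<zeta>) / (1 - \<i> * \<zeta>)"

definition disk_to_half :: "complex \<Rightarrow> complex \<Rightarrow> complex" where
  "disk_to_half \<xi> z = \<i> * ((\<xi> - z) / (\<xi> + z))"

lemma half_to_disk_in_disk: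
  assumes "cmod \<xi> = 1" "0 < Im \<zeta>"
  shows "half_to_disk \<xi> \<zeta> \<in> unit_disk"
proof -
  have "(cmod (1 + \<i> * \<zeta>))\<^sup>2 < (cmod (1 - \<i> * \<zeta>))\<^sup>2"
    using assms(2) unfolding cmod_power2 by (simp add: power2_eq_square algebra_simps)
  then have "cmod (1 + \<i> * \<zeta>) < cmod (1 - \<i> * \<zeta>)" using power2_less_imp_less norm_ge_zero by blast
  then show ?thesis using assms(1) by (simp add: half_to_disk_def norm_mult norm_divide divide_less_eq)
qed

lemma half_to_disk_holomorphic: "half_to_disk \<xi> holomorphic_on {\<zeta>. 0 < Im \<zeta>}"
proof -
  have "1 - \<i> * \<zeta> \<noteq> 0" if "0 < Im \<zeta>" for \<zeta> using that by (auto simp: complex_eq_iff)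
  then show ?thesis unfolding half_to_disk_def by (intro holomorphic_intros) auto
qed

lemma half_to_disk_imaginary:
  assumes "t > (-1::real)"
  shows "half_to_disk \<xi> (\<i> * of_real ((1 - t) / (1 + t))) = of_real t * \<xi>"
proof -
  have "(1 + of_real t :: complex) \<noteq> 0" using assms by (auto simp: complex_eq_iff)
  then show ?thesis by (simp add: half_to_disk_def divide_simps)
qed

lemma disk_to_half:
  assumes "cmod \<xi> = 1" "cmod z < 1"
  shows "0 < Im (disk_to_half \<xi> z)" "half_to_disk \<xi> (disk_to_half \<xi> z) = z" "\<xi> + z \<noteq> 0"
proof -
  have "\<xi> \<noteq> - z" using assms by auto
  then show ne: "\<xi> + z \<noteq> 0" by (metis add_eq_0_iff2)
  have "0 < (cmod \<xi>)\<^sup>2 - (cmod z)\<^sup>2" using assms by (simp add: power_less_one_iff)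
  then have "0 < Re (\<xi> - z) * Re (\<xi> + z) + Im (\<xi> - z) * Im (\<xi> + z)"
    unfolding cmod_power2 by (simp add: power2_eq_square algebra_simps)
  moreover have "0 < (Re (\<xi> + z))\<^sup>2 + (Im (\<xi> + z))\<^sup>2"
    using ne by (metis cmod_power2 zero_less_norm_iff zero_less_power)
  ultimately show "0 < Im (disk_to_half \<xi> z)" 
    unfolding disk_to_half_def Im_i_times Re_divide by (rule divide_pos_pos)
  have "\<xi> \<noteq> 0" using assms by auto
  have 1: "1 + \<i> * disk_to_half \<xi> z = 2 * z / (\<xi> + z)" "1 - \<i> * disk_to_half \<xi> z = 2 * \<xi> / (\<xi> + z)"
    using ne by (simp_all add: disk_to_half_def field_simps)
  show "half_to_disk \<xi> (disk_to_half \<xi> z) = z"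
    unfolding half_to_disk_def 1 using ne \<open>\<xi> \<noteq> 0\<close> by simp
qed

text \<open>The map \<open>w \<mapsto> (z - cnj z * w) / (1 - w)\<close> is the conformal map of the disk onto the upper half-plane
  with \<open>0 \<mapsto> z\<close> and \<open>1 \<mapsto> \<infinity>\<close>.\<close>

lemma disk_to_half_recentred:
  assumes "0 < Im z" "cmod w < 1"
  shows "0 < Im ((z - cnj z * w) / (1 - w))"
proof -
  have "1 - w \<noteq> 0" using assms by auto
  then have pos: "0 < (cmod (1 - w))\<^sup>2" by simp
  have "(cmod w)\<^sup>2 < 1" using assms(2) by (simp add: power_less_one_iff)
  then have "0 < Im z * (1 - (cmod w)\<^sup>2)" using assms(1) by simp
  also have "\<dots> = Im (z - cnj z * w) * Re (1 - w) - Re (z - cnj z * w) * Im (1 - w)"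
    unfolding cmod_power2 by (simp add: power2_eq_square algebra_simps)
  finally have "0 < Im (z - cnj z * w) * Re (1 - w) - Re (z - cnj z * w) * Im (1 - w)" .
  then show ?thesis using pos unfolding Im_divide cmod_power2 by (rule divide_pos_pos)
qed

lemma recentring:
  assumes "0 < Im z" "0 < Im \<zeta>"
  shows "cmod ((\<zeta> - z) / (\<zeta> - cnj z)) < 1"
    and "(z - cnj z * ((\<zeta> - z) / (\<zeta> - cnj z))) / (1 - (\<zeta> - z) / (\<zeta> - cnj z)) = \<zeta>"
    and "\<zeta> - cnj z \<noteq> 0"
proof -
  show ne: "\<zeta> - cnj z \<noteq> 0" using assms by (auto simp: complex_eq_iff)
  have "(cmod (\<zeta> - z))\<^sup>2 < (cmod (\<zeta> - cnj z))\<^sup>2"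
    using mult_pos_pos[OF assms] unfolding cmod_power2 by (simp add: power2_eq_square algebra_simps)
  then have "cmod (\<zeta> - z) < cmod (\<zeta> - cnj z)" using power2_less_imp_less norm_ge_zero by blast
  then show "cmod ((\<zeta> - z) / (\<zeta> - cnj z)) < 1" by (simp add: norm_divide divide_less_eq)
  have zz: "z - cnj z \<noteq> 0" using assms by (auto simp: complex_eq_iff)
  have "z - cnj z * ((\<zeta> - z) / (\<zeta> - cnj z)) = \<zeta> * (z - cnj z) / (\<zeta> - cnj z)"
    using ne by (simp add: field_simps)
  moreover have "1 - (\<zeta> - z) / (\<zeta> - cnj z) = (z - cnj z) / (\<zeta> - cnj z)"
    using ne by (simp add: field_simps)
  ultimately show "(z - cnj z * ((\<zeta> - z) / (\<zeta> - cnj z))) / (1 - (\<zeta> - z) / (\<zeta> - cnj z)) = \<zeta>"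
    using ne zz by simp
qed

text \<open>After \<open>z\<close> has been moved to the centre of the disk, the boundary point \<open>0\<close> of the half-plane becomes
  \<open>z / cnj z\<close>. A point \<open>\<zeta>\<close> on the half-circle about \<open>0\<close> through \<open>z\<close>, on the side of \<open>z\<close> away from the
  imaginary axis, keeps a definite distance from it. Consequently a curve that passes through \<open>\<zeta>\<close>
  and lands at \<open>0\<close> looks long when seen from \<open>z\<close>, no matter how tangential it is.\<close>

lemma recentred_far_from_boundary_origin:
  assumes z: "0 < Im z" and \<zeta>: "0 < Im \<zeta>" and same: "cmod \<zeta> = cmod z"
    and s: "Re z = s * Re \<zeta>" "0 \<le> s" "s \<le> 1"
  shows "1 \<le> dist ((\<zeta> - z) / (\<zeta> - cnj z)) (z / cnj z)"
proof -
  have ne: "\<zeta> - cnj z \<noteq> 0" "cnj z \<noteq> 0" "z \<noteq> 0" using z \<zeta> by (auto simp: complex_eq_iff)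
  have sq: "(Re \<zeta>)\<^sup>2 + (Im \<zeta>)\<^sup>2 = (Re z)\<^sup>2 + (Im z)\<^sup>2" using same by (metis cmod_power2)
  have "(s * Re \<zeta>)\<^sup>2 \<le> s * (Re \<zeta>)\<^sup>2"
    using s mult_right_mono[of s 1 "s * (Re \<zeta>)\<^sup>2"] by (simp add: power2_eq_square algebra_simps)
  then have x: "(Re z)\<^sup>2 \<le> Re \<zeta> * Re z" using s(1) by (simp add: power2_eq_square algebra_simps)
  have "s * (Re \<zeta>)\<^sup>2 \<le> 1 * (Re \<zeta>)\<^sup>2" using s by (intro mult_right_mono) auto
  then have "(Re z)\<^sup>2 \<le> (Re \<zeta>)\<^sup>2" using x s(1) by (simp add: power2_eq_square algebra_simps)
  then have "(Im \<zeta>)\<^sup>2 \<le> (Im z)\<^sup>2" using sq by linarith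
  then have y: "Im \<zeta> \<le> Im z" by (rule power2_le_imp_le) (use z in simp)
  then have "Im \<zeta> * Im z \<le> (Im z)\<^sup>2" using z by (simp add: power2_eq_square)
  then have "(cmod (\<zeta> - cnj z))\<^sup>2 \<le> (2 * Im z)\<^sup>2"
    using x sq unfolding cmod_power2 by (simp add: power2_eq_square algebra_simps)
  then have le: "cmod (\<zeta> - cnj z) \<le> 2 * Im z" by (rule power2_le_imp_le) (use z in simp)
  have "(\<zeta> - z) / (\<zeta> - cnj z) - z / cnj z = \<zeta> * (cnj z - z) / (cnj z * (\<zeta> - cnj z))"
    using ne by (simp add: field_simps)
  moreover have "cmod (cnj z - z) = 2 * Im z"
  proof -
    have "cnj z - z = - \<i> * of_real (2 * Im z)" by (simp add: complex_eq_iff)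
    then show ?thesis using z by (simp add: norm_mult)
  qed
  ultimately have "dist ((\<zeta> - z) / (\<zeta> - cnj z)) (z / cnj z) = 2 * Im z / cmod (\<zeta> - cnj z)"
    using same ne by (simp add: dist_norm norm_mult norm_divide)
  then show ?thesis using le ne by (simp add: le_divide_eq)
qed

text \<open>In the half-plane coordinate at \<open>\<xi>\<close> the radius is the imaginary axis and the curve meets every
  small half-circle about \<open>0\<close>. Joining such a point of intersection to the imaginary axis along
  the half-circle, one stays in \<open>{|g| < \<eta> / 2}\<close>: otherwise \<open>|g| = \<eta> / 2\<close> at some point \<open>z\<close> of that arc,
  and after recentring at \<open>z\<close> the tail of the curve would be a long small arc. These arcs tie the
  tail of the radius to the tail of the curve.\<close>

lemma landing_imp_same_end_as_radius:
  assumes g: "omitting_01 g" and \<xi>: "\<xi> \<in> unit_circle"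
    and c: "continuous_on {0..<1::real} c" "c ` {0..<1} \<subseteq> unit_disk"
    and land: "(c \<longlongrightarrow> \<xi>) (at_left 1)" and lim: "vanishing_along g c"
  shows "same_end g c (\<lambda>t. of_real t * \<xi>)"
  unfolding same_end_def
proof (intro allI impI)
  fix \<eta> :: real assume \<eta>: "0 < \<eta>"
  have \<xi>1: "cmod \<xi> = 1" using \<xi> by simp
  obtain \<epsilon> where \<epsilon>: "0 < \<epsilon>"
    "\<And>g q. omitting_01 g \<Longrightarrow> cmod (g 0) = \<eta> / 2 \<Longrightarrow> path q \<Longrightarrow> path_image q \<subseteq> unit_disk \<Longrightarrow>
       (\<And>z. z \<in> path_image q \<Longrightarrow> cmod (g z) \<le> \<epsilon>) \<Longrightarrow> dist (pathstart q) (pathfinish q) < 1 / 2"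
    using no_long_small_arc[of "\<eta> / 2" "1 / 2"] \<eta> by auto
  obtain T where T: "0 \<le> T" "T < 1" "\<And>t. T \<le> t \<Longrightarrow> t < 1 \<Longrightarrow> cmod (g (c t)) < min \<epsilon> (\<eta> / 2)"
    using tendsto_0_at_left_1D[OF lim, of "min \<epsilon> (\<eta> / 2)"] \<epsilon>(1) \<eta> by auto
  define f where "f = (\<lambda>t. disk_to_half \<xi> (c t))"
  have cb: "cmod (c t) < 1" if "0 \<le> t" "t < 1" for t using c(2) that by force
  have f: "0 < Im (f t)" "half_to_disk \<xi> (f t) = c t" if "0 \<le> t" "t < 1" for t
    using disk_to_half(1,2)[OF \<xi>1 cb[OF that]] by (auto simp: f_def)
  have contf: "continuous_on {0..<1} f"
    unfolding f_def disk_to_half_def using disk_to_half(3)[OF \<xi>1 cb]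
    by (intro continuous_intros c(1)) auto
  have "\<xi> + \<xi> \<noteq> 0" using \<xi>1 by auto
  then have "(f \<longlongrightarrow> \<i> * ((\<xi> - \<xi>) / (\<xi> + \<xi>))) (at_left 1)"
    unfolding f_def disk_to_half_def by (intro tendsto_intros land)
  then have flim: "(f \<longlongrightarrow> 0) (at_left 1)" by simp
  define G where "G = (\<lambda>\<zeta>. g (half_to_disk \<xi> \<zeta>))"
  have holG: "G holomorphic_on {\<zeta>. 0 < Im \<zeta>}"
  proof -
    have "(g \<circ> half_to_disk \<xi>) holomorphic_on {\<zeta>. 0 < Im \<zeta>}"
      by (rule holomorphic_on_compose_gen[OF half_to_disk_holomorphic, of g "unit_disk"])
         (use g half_to_disk_in_disk[OF \<xi>1] in \<open>auto simp: omitting_01_def\<close>)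
    then show ?thesis by (simp add: G_def o_def)
  qed
  have Gf: "G (f t) = g (c t)" if "0 \<le> t" "t < 1" for t using f(2)[OF that] by (simp add: G_def)
  define Y where "Y = cmod (f T)"
  have "0 < Y" using f(1)[of T] T by (auto simp: Y_def)
  have arc: "\<exists>K. connected K \<and> (\<forall>\<zeta>\<in>K. 0 < Im \<zeta> \<and> cmod (G \<zeta>) < \<eta> / 2) \<and> \<i> * of_real y \<in> K \<and>
      (\<exists>t. T \<le> t \<and> t < 1 \<and> f t \<in> K)" if y: "0 < y" "y \<le> Y" for y
  proof -
    obtain t1 where t1: "T \<le> t1" "t1 < 1" "cmod (f t1) < y"
      using tendsto_0_at_left_1D[OF flim y(1)] T by (metis linear order.strict_trans2)
    obtain t0 where t0: "T \<le> t0" "t0 \<le> t1" "cmod (f t0) = y"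
    proof -
      have "\<exists>x\<ge>T. x \<le> t1 \<and> cmod (f x) = y"
        using t1 y T by (intro IVT2' continuous_intros continuous_on_subset[OF contf]) (auto simp: Y_def)
      then show ?thesis using that by blast
    qed
    have t01: "0 \<le> t0" "t0 < 1" using t0 t1 T by auto
    define \<zeta> where "\<zeta> = f t0"
    have \<zeta>: "0 < Im \<zeta>" "cmod \<zeta> = y" using f(1)[OF t01] t0 by (auto simp: \<zeta>_def)
    \<comment> \<open>the arc of the half-circle from the imaginary axis (\<open>s = 0\<close>) to \<open>\<zeta>\<close> (\<open>s = 1\<close>)\<close>
    define k where "k = (\<lambda>s::real. Complex (s * Re \<zeta>) (sqrt (y\<^sup>2 - (s * Re \<zeta>)\<^sup>2)))"
    have y2: "y\<^sup>2 = (Re \<zeta>)\<^sup>2 + (Im \<zeta>)\<^sup>2" using \<zeta>(2) cmod_power2 by blast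
    have below: "(s * Re \<zeta>)\<^sup>2 < y\<^sup>2" if "0 \<le> s" "s \<le> 1" for s
    proof -
      have "(s * Re \<zeta>)\<^sup>2 \<le> 1 * (Re \<zeta>)\<^sup>2"
        unfolding power_mult_distrib using that by (intro mult_right_mono power_le_one) auto
      also have "\<dots> < y\<^sup>2" using y2 \<zeta>(1) by simp
      finally show ?thesis .
    qed
    have k: "0 < Im (k s)" "cmod (k s) = y" "Re (k s) = s * Re \<zeta>" if "0 \<le> s" "s \<le> 1" for s
      using below[OF that] y by (auto simp: k_def cmod_def)
    have k1: "k 1 = \<zeta>" using y2 \<zeta>(1) by (simp add: k_def complex_eq_iff)
    have k0: "k 0 = \<i> * of_real y" using y by (simp add: k_def complex_eq_iff)
    have contk: "continuous_on {0..1} k"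
      unfolding k_def by (intro continuous_intros)
    have contGk: "continuous_on {0..1} (\<lambda>s. cmod (G (k s)))"
      using k(1) holG
      by (intro continuous_on_norm continuous_on_compose2[OF holomorphic_on_imp_continuous_on[OF holG] contk]) auto
    have Gk: "cmod (G (k s)) < \<eta> / 2" if s: "0 \<le> s" "s \<le> 1" for s
    proof (rule ccontr)
      assume "\<not> ?thesis"
      moreover have "cmod (G (k 1)) < \<eta> / 2" using T(3)[OF t0(1) t01(2)] Gf[OF t01] by (simp add: k1 \<zeta>_def)
      ultimately have "\<exists>x\<ge>s. x \<le> 1 \<and> cmod (G (k x)) = \<eta> / 2"
        using s by (intro IVT2' continuous_on_subset[OF contGk]) auto
      then obtain s' where "s \<le> s'" "s' \<le> 1" "cmod (G (k s')) = \<eta> / 2" by blast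
      with s have s': "0 \<le> s'" "s' \<le> 1" "cmod (G (k s')) = \<eta> / 2" by auto
      define z where "z = k s'"
      have z: "0 < Im z" "cmod \<zeta> = cmod z" "Re z = s' * Re \<zeta>" using k[OF s'(1,2)] \<zeta> by (auto simp: z_def)
      define h where "h = (\<lambda>w. G ((z - cnj z * w) / (1 - w)))"
      have omh: "omitting_01 h"
        unfolding h_def G_def
      proof (rule omitting_01_compose[OF g])
        have "(half_to_disk \<xi> \<circ> (\<lambda>w. (z - cnj z * w) / (1 - w))) holomorphic_on unit_disk"
          by (rule holomorphic_on_compose_gen[OF _ half_to_disk_holomorphic])
             (use disk_to_half_recentred[OF z(1)] in \<open>auto intro!: holomorphic_intros\<close>)
        then show "(\<lambda>w. half_to_disk \<xi> ((z - cnj z * w) / (1 - w))) holomorphic_on unit_disk"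
          by (simp add: o_def)
        show "(\<lambda>w. half_to_disk \<xi> ((z - cnj z * w) / (1 - w))) ` unit_disk \<subseteq> unit_disk"
          by (rule image_subsetI) (simp only: mem_ball_0 half_to_disk_in_disk[OF \<xi>1 disk_to_half_recentred[OF z(1)], unfolded mem_ball_0])
      qed
      have h0: "cmod (h 0) = \<eta> / 2" using s'(3) by (simp add: h_def z_def)
      define p where "p = (\<lambda>t. (f t - z) / (f t - cnj z))"
      have hp: "h (p t) = g (c t)" "cmod (p t) < 1" if "0 \<le> t" "t < 1" for t
        using recentring[OF z(1) f(1)[OF that]] Gf[OF that] by (auto simp: h_def p_def)
      have contp: "continuous_on {0..<1} p"
        unfolding p_def using recentring(3)[OF z(1) f(1)] by (intro continuous_intros contf) auto
      have near: "dist (p t0) (p t) \<le> 1 / 2" if t: "t0 \<le> t" "t < 1" for t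
      proof -
        note P = curve_segment_path[OF contp t01(1) t]
        have "dist (pathstart (p \<circ> linepath t0 t)) (pathfinish (p \<circ> linepath t0 t)) < 1 / 2"
        proof (rule \<epsilon>(2)[OF omh h0 P(1)])
          show "path_image (p \<circ> linepath t0 t) \<subseteq> unit_disk"
            unfolding P(2) using hp(2) t01 t by auto
          show "cmod (h w) \<le> \<epsilon>" if w: "w \<in> path_image (p \<circ> linepath t0 t)" for w
          proof -
            obtain u where u: "t0 \<le> u" "u \<le> t" "w = p u" using w unfolding P(2) by auto
            then have "cmod (h w) = cmod (g (c u))" using hp(1)[of u] t01 t by simp
            then show ?thesis using T(3)[of u] u t t0 by simp
          qed
        qed
        then show ?thesis using P(3,4) by simp
      qed
      have "cnj z \<noteq> 0" using z by auto
      then have "(p \<longlongrightarrow> (0 - z) / (0 - cnj z)) (at_left 1)"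
        unfolding p_def by (intro tendsto_intros flim) auto
      then have "((\<lambda>t. dist (p t0) (p t)) \<longlongrightarrow> dist (p t0) (z / cnj z)) (at_left 1)"
        by (intro tendsto_intros) simp
      then have "dist (p t0) (z / cnj z) \<le> 1 / 2"
        by (rule tendsto_upperbound)
           (use near t01 in \<open>auto intro!: eventually_at_left_1I[of t0] simp: trivial_limit_at_left_real\<close>)
      moreover have "1 \<le> dist (p t0) (z / cnj z)"
        using recentred_far_from_boundary_origin[OF z(1) \<zeta>(1) z(2,3) s'(1,2)] by (simp add: p_def \<zeta>_def)
      ultimately show False by simp
    qed
    have "k 1 \<in> k ` {0..1}" "k 0 \<in> k ` {0..1}" by auto
    then show ?thesis
      using contk k(1) Gk k0 k1 t0 t01
      by (intro exI[of _ "k ` {0..1}"] conjI connected_continuous_image) (auto simp: \<zeta>_def intro!: exI[of _ t0])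
  qed
  define joins where "joins y K \<longleftrightarrow> connected K \<and> (\<forall>\<zeta>\<in>K. 0 < Im \<zeta> \<and> cmod (G \<zeta>) < \<eta> / 2) \<and>
      \<i> * of_real y \<in> K \<and> (\<exists>t. T \<le> t \<and> t < 1 \<and> f t \<in> K)" for y K
  define K where "K = (\<lambda>y. SOME K. joins y K)"
  have "joins y (K y)" if "0 < y" "y \<le> Y" for y
    unfolding K_def by (rule someI_ex) (use arc[OF that] in \<open>simp add: joins_def\<close>)
  then have K: "connected (K y)" "\<forall>\<zeta>\<in>K y. 0 < Im \<zeta> \<and> cmod (G \<zeta>) < \<eta> / 2" "\<i> * of_real y \<in> K y"
      "\<exists>t. T \<le> t \<and> t < 1 \<and> f t \<in> K y" if "0 < y" "y \<le> Y" for y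
    using that unfolding joins_def by blast+
  define V where "V = (\<Union>y\<in>{0<..Y}. c ` {T..<1} \<union> half_to_disk \<xi> ` K y)"
  have ctail: "connected (c ` {T..<1})"
    using T by (intro connected_continuous_image continuous_on_subset[OF c(1)]) auto
  have conn: "connected (c ` {T..<1} \<union> half_to_disk \<xi> ` K y)" if y: "0 < y" "y \<le> Y" for y
  proof (rule connected_Un[OF ctail])
    have "continuous_on (K y) (half_to_disk \<xi>)"
      by (rule continuous_on_subset[OF holomorphic_on_imp_continuous_on[OF half_to_disk_holomorphic]])
         (use K(2)[OF y] in auto)
    then show "connected (half_to_disk \<xi> ` K y)" by (rule connected_continuous_image[OF _ K(1)[OF y]])
    obtain t where t: "T \<le> t" "t < 1" "f t \<in> K y" using K(4)[OF y] by blast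
    then have "c t \<in> half_to_disk \<xi> ` K y" using f(2)[of t] T by (metis imageI order_trans)
    moreover have "c t \<in> c ` {T..<1}" using t by simp
    ultimately show "c ` {T..<1} \<inter> half_to_disk \<xi> ` K y \<noteq> {}" by blast
  qed
  have "c T \<in> (\<Inter>y\<in>{0<..Y}. c ` {T..<1} \<union> half_to_disk \<xi> ` K y)" using T by auto
  then have connV: "connected V" 
    unfolding V_def by (intro connected_Union) (use conn in auto)
  have Vc: "c ` {T..<1} \<subseteq> V" using \<open>0 < Y\<close> by (auto simp: V_def)
  have Vsmall: "z \<in> unit_disk \<and> cmod (g z) < \<eta>" if zV: "z \<in> V" for z
  proof -
    obtain y where y: "0 < y" "y \<le> Y" "z \<in> c ` {T..<1} \<union> half_to_disk \<xi> ` K y" using zV unfolding V_def by (metis UN_E greaterThanAtMost_iff)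
    then consider t where "T \<le> t" "t < 1" "z = c t" | \<zeta> where "\<zeta> \<in> K y" "z = half_to_disk \<xi> \<zeta>" by auto
    then show ?thesis
    proof cases
      case 1 then show ?thesis using T(3)[of t] cb[of t] T(1) \<eta> by auto
    next
      case 2 then show ?thesis using K(2)[OF y(1,2)] half_to_disk_in_disk[OF \<xi>1, of \<zeta>] \<eta> by (auto simp: G_def)
    qed
  qed
  \<comment> \<open>the point \<open>t \<xi>\<close> of the radius corresponds to \<open>i (1 - t) / (1 + t)\<close>\<close>
  define T2 where "T2 = max T ((1 - Y) / (1 + Y))"
  have T2: "0 \<le> T2" "T2 < 1" "T \<le> T2" using T \<open>0 < Y\<close> by (auto simp: T2_def divide_less_eq)
  have rad: "of_real t * \<xi> \<in> V" if t: "T2 \<le> t" "t < 1" for t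
  proof -
    define y where "y = (1 - t) / (1 + t)"
    have t0: "0 \<le> t" using t T2 by linarith
    have "(1 - Y) / (1 + Y) \<le> t" using t by (simp add: T2_def)
    then have "1 - Y \<le> t * (1 + Y)" using \<open>0 < Y\<close> by (simp add: divide_le_eq)
    then have y: "0 < y" "y \<le> Y" using t t0 by (auto simp: y_def divide_le_eq algebra_simps)
    have "of_real t * \<xi> = half_to_disk \<xi> (\<i> * of_real y)"
      unfolding y_def using t0 by (subst half_to_disk_imaginary) auto
    then show ?thesis using K(3)[OF y] y by (auto simp: V_def)
  qed
  show "\<exists>T V. 0 \<le> T \<and> T < 1 \<and> connected V \<and> V \<subseteq> unit_disk \<and> (\<forall>z\<in>V. cmod (g z) < \<eta>) \<and>
      c ` {T..<1} \<subseteq> V \<and> (\<lambda>t. of_real t * \<xi>) ` {T..<1} \<subseteq> V"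
    using T2 connV Vsmall Vc rad by (intro exI[of _ T2] exI[of _ V]) (auto simp: image_subset_iff)
qed

section \<open>Homotopies inside sublevel sets\<close>

lemma open_holomorphic_sublevel:
  assumes "g holomorphic_on unit_disk"
  shows "open {z \<in> unit_disk. cmod (g z) < \<eta>}"
proof -
  have "continuous_on (unit_disk) (\<lambda>z. cmod (g z))"
    using assms by (intro continuous_on_norm holomorphic_on_imp_continuous_on)
  then have "open (unit_disk \<inter> (\<lambda>z. cmod (g z)) -` {..<\<eta>})"
    by (rule continuous_open_preimage) auto
  moreover have "unit_disk \<inter> (\<lambda>z. cmod (g z)) -` {..<\<eta>} = {z \<in> unit_disk. cmod (g z) < \<eta>}" by auto
  ultimately show ?thesis by simp
qed

text \<open>If a closed path in the component wound around a point, the maximum principle would make \<open>|g| < \<eta>\<close>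
  on the whole region it encloses, so that the point would belong to the component.\<close>

lemma simply_connected_sublevel_component:
  assumes hol: "g holomorphic_on unit_disk"
    and W: "W \<in> components {z \<in> unit_disk. cmod (g z) < \<eta>}"
  shows "simply_connected W"
proof -
  let ?U = "{z \<in> unit_disk. cmod (g z) < \<eta>}"
  have "open W" using open_components[OF open_holomorphic_sublevel[OF hol] W] .
  have WU: "W \<subseteq> ?U" using W by (rule in_components_subset)
  have "winding_number p z = 0" if p: "path p" "path_image p \<subseteq> W" "pathfinish p = pathstart p" and z: "z \<notin> W" for p z
  proof (rule ccontr)
    assume wn: "winding_number p z \<noteq> 0"
    let ?K = "path_image p"
    have zK: "z \<notin> ?K" using p z by auto
    then have "z \<in> inside ?K"
      using winding_number_zero_in_outside[OF p(1,3)] wn zK inside_Un_outside[of ?K] by (metis ComplI UnE)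
    have K: "compact ?K" "closed ?K" "connected ?K" "?K \<noteq> {}"
      using p(1) by (auto simp: closed_path_image compact_path_image connected_path_image)
    have KU: "?K \<subseteq> ?U" using p(2) WU by blast
    have "- unit_disk \<subseteq> outside ?K"
      using convex_in_outside[OF convex_ball] outside_mono[of ?K "unit_disk"] KU by blast
    then have ins: "inside ?K \<subseteq> unit_disk" using inside_Int_outside[of ?K] by blast
    have bins: "bounded (inside ?K)" using K(1) by (intro bounded_inside compact_imp_bounded)
    have oins: "open (inside ?K)" using K(2) by (rule open_inside)
    have fr: "frontier (inside ?K) \<subseteq> ?K" using K(2) by (rule frontier_inside_subset)
    then have cl: "closure (inside ?K) \<subseteq> unit_disk" using ins KU by (auto simp: closure_Un_frontier)
    have contK: "continuous_on ?K (\<lambda>z. cmod (g z))"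
      using KU hol by (intro continuous_on_norm continuous_on_subset[OF holomorphic_on_imp_continuous_on[OF hol]]) auto
    obtain w where w: "w \<in> ?K" "\<forall>u\<in>?K. cmod (g u) \<le> cmod (g w)"
      using continuous_attains_sup[OF K(1,4) contK] by blast
    have small: "cmod (g u) < \<eta>" if u: "u \<in> inside ?K" for u
    proof -
      have "cmod (g u) \<le> cmod (g w)"
      proof (rule maximum_modulus_frontier[OF _ _ bins _ u])
        show "g holomorphic_on interior (inside ?K)"
          using hol ins interior_subset by (meson holomorphic_on_subset order_trans)
        show "continuous_on (closure (inside ?K)) g"
          using hol cl by (meson holomorphic_on_imp_continuous_on continuous_on_subset)
      qed (use w fr in auto)
      also have "\<dots> < \<eta>" using w(1) KU by auto
      finally show ?thesis .
    qed
    have "?K \<union> inside ?K \<subseteq> ?U" using KU ins small by auto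
    moreover have "connected (?K \<union> inside ?K)" using K by (intro connected_with_inside)
    moreover have "W \<inter> (?K \<union> inside ?K) \<noteq> {}" using p(2) K(4) by blast
    ultimately have "?K \<union> inside ?K \<subseteq> W" using components_maximal[OF W] by blast
    then show False using \<open>z \<in> inside ?K\<close> z by blast
  qed
  then show ?thesis
    using simply_connected_eq_winding_number_zero[OF \<open>open W\<close>] in_components_connected[OF W] by blast
qed

text \<open>Being open and contractible, the component is an absolute retract. Continuous functions with values
  in it can therefore be extended from closed subsets.\<close>

lemma sublevel_component_AR:
  assumes "g holomorphic_on unit_disk" "W \<in> components {z \<in> unit_disk. cmod (g z) < \<eta>}"
  shows "AR W"
proof -
  have "open W" using open_components[OF open_holomorphic_sublevel[OF assms(1)] assms(2)] .
  then show ?thesis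
    using simply_connected_sublevel_component[OF assms] in_components_nonempty[OF assms(2)]
    by (simp add: AR_ANR open_imp_ANR contractible_eq_simply_connected_2d)
qed

text \<open>The four prescribed sides define a continuous map on the boundary of the rectangle, which extends to
  the rectangle because \<open>W\<close> is an absolute retract.\<close>

lemma fill_rectangle:
  fixes W :: "complex set" and c1 c2 a b :: "real \<Rightarrow> complex"
  assumes W: "AR W" and "t0 < t1"
    and c1: "continuous_on {t0..t1} c1" "c1 ` {t0..t1} \<subseteq> W"
    and c2: "continuous_on {t0..t1} c2" "c2 ` {t0..t1} \<subseteq> W"
    and a: "path a" "path_image a \<subseteq> W" "pathstart a = c1 t0" "pathfinish a = c2 t0"
    and b: "path b" "path_image b \<subseteq> W" "pathstart b = c1 t1" "pathfinish b = c2 t1"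
  obtains H where "continuous_on ({0..1} \<times> {t0..t1}) H" "H ` ({0..1} \<times> {t0..t1}) \<subseteq> W"
    "\<And>t. t \<in> {t0..t1} \<Longrightarrow> H (0, t) = c1 t" "\<And>t. t \<in> {t0..t1} \<Longrightarrow> H (1, t) = c2 t"
    "\<And>s. s \<in> {0..1} \<Longrightarrow> H (s, t0) = a s" "\<And>s. s \<in> {0..1} \<Longrightarrow> H (s, t1) = b s"
proof -
  define f :: "real \<times> real \<Rightarrow> complex" where
    "f = (\<lambda>(s, t). if s = 0 then c1 t else if s = 1 then c2 t else if t = t0 then a s else b s)"
  define L where "L = {0::real} \<times> {t0..t1}"
  define R where "R = {1::real} \<times> {t0..t1}"
  define B where "B = {0..1::real} \<times> {t0}"
  define U where "U = {0..1::real} \<times> {t1}"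
  have a': "continuous_on {0..1} a" "a ` {0..1} \<subseteq> W" "a 0 = c1 t0" "a 1 = c2 t0"
    and b': "continuous_on {0..1} b" "b ` {0..1} \<subseteq> W" "b 0 = c1 t1" "b 1 = c2 t1"
    using a b by (auto simp: path_def path_image_def pathstart_def pathfinish_def)
  have fL: "f x = c1 (snd x)" if "x \<in> L" for x using that by (auto simp: f_def L_def)
  have fR: "f x = c2 (snd x)" if "x \<in> R" for x using that by (auto simp: f_def R_def)
  have fB: "f x = a (fst x)" if "x \<in> B" for x using that a' by (auto simp: f_def B_def)
  have fU: "f x = b (fst x)" if "x \<in> U" for x using that b' assms(2) by (auto simp: f_def U_def)
  have "continuous_on L f"
  proof (rule continuous_on_eq)
    show "continuous_on L (\<lambda>x. c1 (snd x))"
      by (rule continuous_on_compose2[OF c1(1)]) (auto intro: continuous_intros simp: L_def)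
  qed (simp add: fL)
  moreover have "continuous_on R f"
  proof (rule continuous_on_eq)
    show "continuous_on R (\<lambda>x. c2 (snd x))"
      by (rule continuous_on_compose2[OF c2(1)]) (auto intro: continuous_intros simp: R_def)
  qed (simp add: fR)
  moreover have "continuous_on B f"
  proof (rule continuous_on_eq)
    show "continuous_on B (\<lambda>x. a (fst x))"
      by (rule continuous_on_compose2[OF a'(1)]) (auto intro: continuous_intros simp: B_def)
  qed (simp add: fB)
  moreover have "continuous_on U f"
  proof (rule continuous_on_eq)
    show "continuous_on U (\<lambda>x. b (fst x))"
      by (rule continuous_on_compose2[OF b'(1)]) (auto intro: continuous_intros simp: U_def)
  qed (simp add: fU)
  moreover have cl: "closed L" "closed R" "closed B" "closed U"
    by (auto simp: L_def R_def B_def U_def intro!: closed_Times)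
  ultimately have contf: "continuous_on (L \<union> R \<union> B \<union> U) f"
    by (intro continuous_on_closed_Un closed_Un) auto
  have fW: "f ` (L \<union> R \<union> B \<union> U) \<subseteq> W"
  proof (rule image_subsetI)
    fix x assume "x \<in> L \<union> R \<union> B \<union> U"
    then consider "x \<in> L" | "x \<in> R" | "x \<in> B" | "x \<in> U" by blast
    then show "f x \<in> W"
    proof cases
      case 1
      then have "snd x \<in> {t0..t1}" by (auto simp: L_def)
      then show ?thesis using fL[OF 1] c1(2) by auto
    next
      case 2
      then have "snd x \<in> {t0..t1}" by (auto simp: R_def)
      then show ?thesis using fR[OF 2] c2(2) by auto
    next
      case 3
      then have "fst x \<in> {0..1}" by (auto simp: B_def)
      then show ?thesis using fB[OF 3] a'(2) by auto
    next
      case 4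
      then have "fst x \<in> {0..1}" by (auto simp: U_def)
      then show ?thesis using fU[OF 4] b'(2) by auto
    qed
  qed
  have sub: "L \<union> R \<union> B \<union> U \<subseteq> {0..1} \<times> {t0..t1}" using assms(2) by (auto simp: L_def R_def B_def U_def)
  have "closedin (top_of_set ({0..1} \<times> {t0..t1})) (L \<union> R \<union> B \<union> U)"
    using cl sub by (intro closed_subset) auto
  then obtain H where H: "continuous_on ({0..1} \<times> {t0..t1}) H" "H ` ({0..1} \<times> {t0..t1}) \<subseteq> W"
      "\<And>x. x \<in> L \<union> R \<union> B \<union> U \<Longrightarrow> H x = f x"
    using AR_imp_absolute_extensor[OF W contf fW] by metis
  show ?thesis
  proof (rule that[OF H(1,2)])
    show "H (0, t) = c1 t" if "t \<in> {t0..t1}" for t using that H(3)[of "(0, t)"] fL[of "(0, t)"] by (auto simp: L_def)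
    show "H (1, t) = c2 t" if "t \<in> {t0..t1}" for t using that H(3)[of "(1, t)"] fR[of "(1, t)"] by (auto simp: R_def)
    show "H (s, t0) = a s" if "s \<in> {0..1}" for s using that H(3)[of "(s, t0)"] fB[of "(s, t0)"] by (auto simp: B_def)
    show "H (s, t1) = b s" if "s \<in> {0..1}" for s using that H(3)[of "(s, t1)"] fU[of "(s, t1)"] by (auto simp: U_def)
  qed
qed

lemma glue_strips:
  fixes H :: "nat \<Rightarrow> real \<times> real \<Rightarrow> 'a::topological_space" and r :: "nat \<Rightarrow> real"
  assumes r: "r 0 = 0" "strict_mono r" "r \<longlonglongrightarrow> 1"
    and H: "\<And>n. continuous_on ({0..1} \<times> {r n..r (Suc n)}) (H n)"
    and agree: "\<And>n s. s \<in> {0..1} \<Longrightarrow> H n (s, r (Suc n)) = H (Suc n) (s, r (Suc n))"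
  obtains G where "continuous_on ({0..1} \<times> {0..<1}) G"
    "\<And>n s t. s \<in> {0..1} \<Longrightarrow> t \<in> {r n..r (Suc n)} \<Longrightarrow> G (s, t) = H n (s, t)"
    "\<And>t. t \<in> {0..<1} \<Longrightarrow> \<exists>n. t \<in> {r n..r (Suc n)}"
proof -
  have lt1: "r n < 1" for n
  proof -
    have "r n < r (Suc n)" using r(2) by (simp add: strict_mono_Suc_iff)
    also have "\<dots> \<le> 1" by (rule incseq_le[OF strict_mono_mono[OF r(2)] r(3)])
    finally show ?thesis .
  qed
  have ex: "\<exists>n. t < r (Suc n)" if t1: "t < 1" for t
  proof -
    obtain n where "t < r n" using order_tendstoD(1)[OF r(3) t1] by (auto simp: eventually_sequentially)
    also have "r n < r (Suc n)" using r(2) by (simp add: strict_mono_Suc_iff)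
    finally show ?thesis by blast
  qed
  define k where "k = (\<lambda>t. LEAST n. t < r (Suc n))"
  have k_less: "t < r (Suc (k t))" if "t < 1" for t unfolding k_def using LeastI_ex[OF ex[OF that]] .
  have k_ge: "r (k t) \<le> t" if "0 \<le> t" for t
  proof (cases "k t")
    case 0 then show ?thesis using r(1) that by simp
  next
    case (Suc j)
    then have "\<not> t < r (Suc j)" using not_less_Least[of j] by (metis k_def lessI)
    then show ?thesis using Suc by simp
  qed
  define G where "G = (\<lambda>(s, t). H (k t) (s, t))"
  have G: "G (s, t) = H n (s, t)" if st: "s \<in> {0..1}" "t \<in> {r n..r (Suc n)}" for n s t
  proof (cases "t = r (Suc n)")
    case False
    have "k t = n"
      unfolding k_def
    proof (rule Least_equality)
      show "t < r (Suc n)" using st(2) False by auto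
      fix m assume "t < r (Suc m)"
      then have "r n < r (Suc m)" using st(2) by auto
      then show "n \<le> m" using r(2) by (simp add: strict_mono_less)
    qed
    then show ?thesis by (simp add: G_def)
  next
    case True
    have "k t = Suc n"
      unfolding k_def True using r(2) by (intro Least_equality) (auto simp: strict_mono_less)
    then show ?thesis using agree[OF st(1), of n] True by (simp add: G_def)
  qed
  have cover: "\<exists>n. t \<in> {r n..r (Suc n)}" if "t \<in> {0..<1}" for t
    using k_ge[of t] k_less[of t] that by (auto intro!: exI[of _ "k t"])
  have upto: "continuous_on ({0..1} \<times> {0..r n}) G" for n
  proof (induction n)
    case 0
    have "continuous_on ({0..1} \<times> {r 0..r (Suc 0)}) G"
      by (rule continuous_on_eq[OF H[of 0]]) (auto simp: G)
    moreover have "0 < r (Suc 0)" using r(1,2) by (metis lessI strict_mono_less)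
    ultimately show ?case by (rule_tac continuous_on_subset) (auto simp: r(1))
  next
    case (Suc n)
    have "continuous_on ({0..1} \<times> {r n..r (Suc n)}) G"
      by (rule continuous_on_eq[OF H[of n]]) (auto simp: G)
    with Suc have "continuous_on ({0..1} \<times> {0..r n} \<union> {0..1} \<times> {r n..r (Suc n)}) G"
      by (intro continuous_on_closed_Un closed_Times) auto
    moreover have "0 \<le> r n" "r n \<le> r (Suc n)" using r(1,2) by (metis le0 strict_mono_less_eq, metis le_SucI order_refl strict_mono_less_eq)
    ultimately show ?case by (rule_tac continuous_on_subset) auto
  qed
  have "continuous_on ({0..1} \<times> {0..<1}) G"
    unfolding continuous_on_eq_continuous_within
  proof
    fix x assume x: "x \<in> {0..1::real} \<times> {0..<1::real}"
    obtain n where n: "snd x < r (Suc n)" using ex[of "snd x"] x by auto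
    have "continuous (at x within ({0..1} \<times> {0..r (Suc n)})) G"
    proof -
      have "x \<in> {0..1} \<times> {0..r (Suc n)}" using x n by (cases x) auto
      then show ?thesis using upto[of "Suc n"] unfolding continuous_on_eq_continuous_within by blast
    qed
    moreover have "at x within ({0..1} \<times> {0..r (Suc n)}) = at x within ({0..1} \<times> {0..<1})"
    proof (rule at_within_nhd[of _ "UNIV \<times> {..<r (Suc n)}"])
      show "x \<in> UNIV \<times> {..<r (Suc n)}" using n by (auto simp: mem_Times_iff)
      show "open (UNIV \<times> {..<r (Suc n)} :: (real \<times> real) set)" by (intro open_Times) auto
    qed (use lt1[of "Suc n"] in auto)
    ultimately show "continuous (at x within ({0..1} \<times> {0..<1})) G" by simp
  qed
  then show ?thesis using that G cover by blast
qed

text \<open>A ladder: at times \<open>r n\<close> tending to \<open>1\<close> the curves are joined by a rung inside the component of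
  \<open>{|g| < 1 / n}\<close> that contains both tails. The cell between two consecutive rungs has its boundary in
  one of these components and is filled there. Since the components shrink, \<open>g\<close> tends to \<open>0\<close>
  uniformly along the homotopy.\<close>

lemma same_end_homotopy:
  fixes c1 c2 :: "real \<Rightarrow> complex"
  assumes hol: "g holomorphic_on unit_disk"
    and c1: "continuous_on {0..<1} c1" "c1 ` {0..<1} \<subseteq> unit_disk"
    and c2: "continuous_on {0..<1} c2" "c2 ` {0..<1} \<subseteq> unit_disk"
    and same: "same_end g c1 c2"
  obtains H :: "real \<times> real \<Rightarrow> complex" where "continuous_on ({0..1} \<times> {0..<1}) H" "H ` ({0..1} \<times> {0..<1}) \<subseteq> unit_disk"
    "\<And>t. t \<in> {0..<1} \<Longrightarrow> H (0, t) = c1 t" "\<And>t. t \<in> {0..<1} \<Longrightarrow> H (1, t) = c2 t"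
    "\<And>\<eta>. 0 < \<eta> \<Longrightarrow> \<exists>T<1. \<forall>s\<in>{0..1}. \<forall>t\<in>{T..<1}. cmod (g (H (s, t))) < \<eta>"
proof -
  let ?U = "\<lambda>n::nat. {z \<in> unit_disk. cmod (g z) < 1 / Suc n}"
  define captures where "captures n T W \<longleftrightarrow> 0 \<le> T \<and> T < 1 \<and> W \<in> components (?U n) \<and>
      c1 ` {T..<1} \<subseteq> W \<and> c2 ` {T..<1} \<subseteq> W" for n T W
  have "\<exists>T W. captures n T W" for n
  proof -
    have "0 < 1 / real (Suc n)" by simp
    then obtain T V where V: "0 \<le> T" "T < 1" "connected V" "V \<subseteq> unit_disk"
      "\<forall>z\<in>V. cmod (g z) < 1 / Suc n" "c1 ` {T..<1} \<subseteq> V" "c2 ` {T..<1} \<subseteq> V"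
      using same unfolding same_end_def by meson
    have cT: "c1 T \<in> V" using V by auto
    then have "c1 T \<in> ?U n" using V by auto
    then have "connected_component_set (?U n) (c1 T) \<in> components (?U n)" by (auto simp: components_def)
    moreover have "V \<subseteq> connected_component_set (?U n) (c1 T)"
      using V cT by (intro connected_component_maximal) auto
    ultimately show ?thesis unfolding captures_def using V by blast
  qed
  then obtain T W where "\<And>n. captures n (T n) (W n)" by metis
  then have T: "0 \<le> T n" "T n < 1" and W: "W n \<in> components (?U n)"
    and tails: "c1 ` {T n..<1} \<subseteq> W n" "c2 ` {T n..<1} \<subseteq> W n" for n
    unfolding captures_def by blast+
  have Wprop: "AR (W n)" "open (W n)" "connected (W n)" "W n \<subseteq> ?U n" for n
    using sublevel_component_AR[OF hol W] open_components[OF open_holomorphic_sublevel[OF hol] W]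
      in_components_connected[OF W] in_components_subset[OF W] by blast+
  have Wdec: "W (Suc n) \<subseteq> W n" for n
  proof (rule components_maximal[OF W Wprop(3)])
    have "1 / real (Suc (Suc n)) \<le> 1 / real (Suc n)" by (simp add: field_simps)
    then show "W (Suc n) \<subseteq> ?U n" using Wprop(4)[of "Suc n"] by force
    have "max (T n) (T (Suc n)) < 1" using T by simp
    then have "c1 (max (T n) (T (Suc n))) \<in> W n \<inter> W (Suc n)" using tails(1)[of n] tails(1)[of "Suc n"]
      by (simp add: image_subset_iff)
    then show "W n \<inter> W (Suc n) \<noteq> {}" by blast
  qed
  \<comment> \<open>the initial cell may use the whole disk, because nothing is required there\<close>
  define W' where "W' = (\<lambda>n. case n of 0 \<Rightarrow> unit_disk | Suc m \<Rightarrow> W m)"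
  define r where "r = rec_nat 0 (\<lambda>n t. max (T n) ((t + 1) / 2))"
  have r0: "r 0 = 0" and rSuc: "r (Suc n) = max (T n) ((r n + 1) / 2)" for n by (auto simp: r_def)
  have r1: "r n < 1" for n by (induction n) (use T(2) in \<open>auto simp: r0 rSuc\<close>)
  have mono: "strict_mono r" unfolding strict_mono_Suc_iff using r1 by (auto simp: rSuc less_max_iff_disj)
  have "1 - r n \<le> (1/2) ^ n" for n
  proof (induction n)
    case (Suc n)
    have "(r n + 1) / 2 \<le> r (Suc n)" by (simp add: rSuc)
    then show ?case using Suc by simp
  qed (simp add: r0)
  then have "1 - (1/2) ^ n \<le> r n" for n by (simp add: algebra_simps)
  moreover have "(\<lambda>n. 1 - (1/2::real) ^ n) \<longlonglongrightarrow> 1 - 0" by (intro tendsto_intros LIMSEQ_power_zero) auto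
  ultimately have rlim: "r \<longlonglongrightarrow> 1"
    using r1 by (intro tendsto_sandwich[of "\<lambda>n. 1 - (1/2) ^ n" r sequentially "\<lambda>_. 1"]) (auto intro!: always_eventually less_imp_le)
  have rnn: "0 \<le> r n" for n using mono r0 by (metis le0 strict_mono_less_eq)
  have Wdisk: "W n \<subseteq> unit_disk" for n using Wprop(4)[of n] by blast
  have W': "AR (W' n)" "path_connected (W' n)" "W' n \<subseteq> unit_disk" "W' (Suc n) \<subseteq> W' n" for n
    using Wprop(1-3) Wdisk Wdec by (auto simp: W'_def convex_imp_AR convex_imp_path_connected connected_open_path_connected split: nat.split)
  have tails': "c1 ` {r n..<1} \<subseteq> W' n" "c2 ` {r n..<1} \<subseteq> W' n" for n
    using c1(2) c2(2) tails by (auto simp: W'_def r0 rSuc image_subset_iff split: nat.split)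
  have "\<exists>a. path a \<and> path_image a \<subseteq> W' n \<and> pathstart a = c1 (r n) \<and> pathfinish a = c2 (r n)" for n
    using W'(2)[of n] tails'[of n] r1[of n] unfolding path_connected_def by (auto simp: image_subset_iff)
  then obtain a where a: "\<And>n. path (a n)" "\<And>n. path_image (a n) \<subseteq> W' n"
    "\<And>n. pathstart (a n) = c1 (r n)" "\<And>n. pathfinish (a n) = c2 (r n)" by metis
  have "\<exists>H. continuous_on ({0..1} \<times> {r n..r (Suc n)}) H \<and> H ` ({0..1} \<times> {r n..r (Suc n)}) \<subseteq> W' n \<and>
     (\<forall>t\<in>{r n..r (Suc n)}. H (0, t) = c1 t \<and> H (1, t) = c2 t) \<and>
     (\<forall>s\<in>{0..1}. H (s, r n) = a n s \<and> H (s, r (Suc n)) = a (Suc n) s)" for n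
  proof -
    have sub: "{r n..r (Suc n)} \<subseteq> {0..<1}" "{r n..r (Suc n)} \<subseteq> {r n..<1}"
      using rnn[of n] r1[of "Suc n"] by auto
    have "c1 ` {r n..r (Suc n)} \<subseteq> W' n" "c2 ` {r n..r (Suc n)} \<subseteq> W' n"
      using tails'[of n] sub(2) by blast+
    moreover have "r n < r (Suc n)" using mono by (simp add: strict_mono_Suc_iff)
    ultimately obtain H where "continuous_on ({0..1} \<times> {r n..r (Suc n)}) H" "H ` ({0..1} \<times> {r n..r (Suc n)}) \<subseteq> W' n"
      "\<And>t. t \<in> {r n..r (Suc n)} \<Longrightarrow> H (0, t) = c1 t" "\<And>t. t \<in> {r n..r (Suc n)} \<Longrightarrow> H (1, t) = c2 t"
      "\<And>s. s \<in> {0..1} \<Longrightarrow> H (s, r n) = a n s" "\<And>s. s \<in> {0..1} \<Longrightarrow> H (s, r (Suc n)) = a (Suc n) s"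
      using fill_rectangle[OF W'(1)[of n], of "r n" "r (Suc n)" c1 c2 "a n" "a (Suc n)"]
        continuous_on_subset[OF c1(1) sub(1)] continuous_on_subset[OF c2(1) sub(1)]
        a[of n] a[of "Suc n"] order_trans[OF a(2)[of "Suc n"] W'(4)[of n]] by metis
    then show ?thesis by blast
  qed
  then obtain H where H: "\<And>n. continuous_on ({0..1} \<times> {r n..r (Suc n)}) (H n)"
     "\<And>n. H n ` ({0..1} \<times> {r n..r (Suc n)}) \<subseteq> W' n"
     "\<And>n t. t\<in>{r n..r (Suc n)} \<Longrightarrow> H n (0, t) = c1 t \<and> H n (1, t) = c2 t"
     "\<And>n s. s\<in>{0..1} \<Longrightarrow> H n (s, r n) = a n s \<and> H n (s, r (Suc n)) = a (Suc n) s" by metis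
  obtain G where G: "continuous_on ({0..1} \<times> {0..<1}) G"
    "\<And>n s t. s \<in> {0..1} \<Longrightarrow> t \<in> {r n..r (Suc n)} \<Longrightarrow> G (s, t) = H n (s, t)"
    "\<And>t. t \<in> {0..<1} \<Longrightarrow> \<exists>n. t \<in> {r n..r (Suc n)}"
    using glue_strips[OF r0 mono rlim H(1)] H(4) by metis
  have late: "G (s, t) \<in> W' n" if st: "s \<in> {0..1}" "t \<in> {r n..<1}" for s t n
  proof -
    obtain m where m: "t \<in> {r m..r (Suc m)}" using G(3)[of t] st(2) rnn[of n] by auto
    have dec: "W' j \<subseteq> W' i" if "i \<le> j" for i j using lift_Suc_antimono_le[of W', OF W'(4) that] .
    show ?thesis
    proof (cases "n \<le> m")
      case True
      have "G (s, t) \<in> W' m" using G(2)[OF st(1) m] H(2)[of m] st(1) m by (auto simp: image_subset_iff)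
      then show ?thesis using dec[OF True] by blast
    next
      case False
      then have "r (Suc m) \<le> r n" using mono by (simp add: strict_mono_less_eq)
      then have t: "t = r n" using st(2) m by auto
      then have m': "t \<in> {r n..r (Suc n)}" using mono by (simp add: strict_mono_less_eq)
      show ?thesis using G(2)[OF st(1) m'] H(2)[of n] st(1) m' by (auto simp: image_subset_iff)
    qed
  qed
  show ?thesis
  proof (rule that[OF G(1)])
    show "G ` ({0..1} \<times> {0..<1}) \<subseteq> unit_disk"
      using late[of _ _ 0] by (auto simp: r0 W'_def)
    show "G (0, t) = c1 t" "G (1, t) = c2 t" if t: "t \<in> {0..<1}" for t
    proof -
      obtain m where m: "t \<in> {r m..r (Suc m)}" using G(3)[OF t] by blast
      show "G (0, t) = c1 t" "G (1, t) = c2 t" using G(2)[OF _ m] H(3)[OF m] by auto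
    qed
    fix \<eta> :: real assume "0 < \<eta>"
    then obtain n where n: "1 / real (Suc n) < \<eta>" using nat_approx_posE by blast
    have "cmod (g (G (s, t))) < \<eta>" if "s \<in> {0..1}" "t \<in> {r (Suc n)..<1}" for s t
    proof -
      have "G (s, t) \<in> ?U n" using late[OF that] Wprop(4)[of n] by (auto simp: W'_def)
      then show ?thesis using n by auto
    qed
    then show "\<exists>T<1. \<forall>s\<in>{0..1}. \<forall>t\<in>{T..<1}. cmod (g (G (s, t))) < \<eta>"
      using r1[of "Suc n"] by blast
  qed
qed

section \<open>Automorphisms of the disk and deck transformations\<close>

lemma disk_automorphism_inverse:
  assumes "\<gamma> \<in> disk_automorphisms"
  obtains \<delta> where "\<delta> \<in> disk_automorphisms"
    "\<And>z. z \<in> unit_disk \<Longrightarrow> \<delta> (\<gamma> z) = z" "\<And>z. z \<in> unit_disk \<Longrightarrow> \<gamma> (\<delta> z) = z"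
proof -
  have hol: "\<gamma> holomorphic_on unit_disk" and bij: "bij_betw \<gamma> unit_disk unit_disk"
    using assms by (auto simp: disk_automorphisms_def)
  obtain \<delta> where \<delta>: "\<delta> holomorphic_on (\<gamma> ` unit_disk)" "\<And>z. z \<in> unit_disk \<Longrightarrow> \<delta> (\<gamma> z) = z"
    using holomorphic_has_inverse[OF hol open_ball bij_betw_imp_inj_on[OF bij]] by metis
  have im: "\<gamma> ` unit_disk = unit_disk" using bij by (simp add: bij_betw_def)
  have right: "\<gamma> (\<delta> z) = z \<and> \<delta> z \<in> unit_disk" if "z \<in> unit_disk" for z
  proof -
    have "z \<in> \<gamma> ` unit_disk" using im that by simp
    then obtain u where "u \<in> unit_disk" "z = \<gamma> u" by (rule imageE)
    then show ?thesis using \<delta>(2) by simp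
  qed
  have "bij_betw \<delta> unit_disk unit_disk"
    by (rule bij_betwI[where g = \<gamma>]) (use \<delta>(2) right im in auto)
  then have "\<delta> \<in> disk_automorphisms" using \<delta>(1) im by (simp add: disk_automorphisms_def)
  then show ?thesis using that \<delta>(2) right by blast
qed

lemma disk_automorphism_into: "\<gamma> \<in> disk_automorphisms \<Longrightarrow> z \<in> unit_disk \<Longrightarrow> \<gamma> z \<in> unit_disk"
  unfolding disk_automorphisms_def by (auto dest: bij_betwE)

text \<open>After composition with a Moebius automorphism the map fixes \<open>0\<close>. The Schwarz lemma for it and for its
  inverse shows that it preserves the modulus, so it is a rotation.\<close>

lemma disk_automorphism_eq_Moebius:
  assumes "\<gamma> \<in> disk_automorphisms"
  obtains \<alpha> a where "cmod \<alpha> = 1" "cmod a < 1"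
    "\<And>z. z \<in> unit_disk \<Longrightarrow> \<gamma> z = \<alpha> * ((z - a) / (1 - cnj a * z))"
proof -
  obtain \<delta> where \<delta>: "\<delta> \<in> disk_automorphisms"
    "\<And>z. z \<in> unit_disk \<Longrightarrow> \<delta> (\<gamma> z) = z" "\<And>z. z \<in> unit_disk \<Longrightarrow> \<gamma> (\<delta> z) = z"
    using disk_automorphism_inverse[OF assms] by metis
  define a where "a = \<delta> 0"
  have a: "cmod a < 1" "cmod (- a) < 1" using disk_automorphism_into[OF \<delta>(1), of 0] by (auto simp: a_def)
  have \<gamma>a: "\<gamma> a = 0" using \<delta>(3)[of 0] by (simp add: a_def)
  let ?M = "Moebius_function 0 a" and ?N = "Moebius_function 0 (- a)"
  define F where "F = (\<lambda>z. \<gamma> (?N z))"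
  define E where "E = (\<lambda>z. ?M (\<delta> z))"
  have dN: "cmod (?N z) < 1" if "cmod z < 1" for z using Moebius_function_norm_lt_1[OF a(2) that] .
  have dM: "cmod (?M z) < 1" if "cmod z < 1" for z using Moebius_function_norm_lt_1[OF a(1) that] .
  have d\<gamma>: "cmod (\<gamma> z) < 1" if "cmod z < 1" for z using disk_automorphism_into[OF assms, of z] that by simp
  have d\<delta>: "cmod (\<delta> z) < 1" if "cmod z < 1" for z using disk_automorphism_into[OF \<delta>(1), of z] that by simp
  have hol: "\<gamma> holomorphic_on unit_disk" "\<delta> holomorphic_on unit_disk"
    using assms \<delta>(1) by (auto simp: disk_automorphisms_def)
  have holF: "F holomorphic_on unit_disk"
    using holomorphic_on_compose_gen[OF Moebius_function_holomorphic[OF a(2), of 0] hol(1)] dN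
    by (simp add: F_def o_def image_subset_iff)
  have holE: "E holomorphic_on unit_disk"
    using holomorphic_on_compose_gen[OF hol(2) Moebius_function_holomorphic[OF a(1), of 0]] d\<delta>
    by (simp add: E_def o_def image_subset_iff)
  have F0: "F 0 = 0" by (simp add: F_def Moebius_function_of_zero \<gamma>a)
  have E0: "E 0 = 0" by (simp add: E_def a_def[symmetric] Moebius_function_eq_zero)
  have EF: "E (F z) = z" if z: "cmod z < 1" for z
    using \<delta>(2)[of "?N z"] dN[OF z] Moebius_function_compose[of a "- a" z] a z by (simp add: E_def F_def)
  have rot: "cmod (F z) = cmod z" if z: "cmod z < 1" for z
  proof (rule antisym)
    show "cmod (F z) \<le> cmod z"
      using Schwarz_Lemma(1)[OF holF F0 _ z] d\<gamma> dN by (simp add: F_def)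
    have "cmod (E (F z)) \<le> cmod (F z)"
      using Schwarz_Lemma(1)[OF holE E0] d\<gamma> dN dM d\<delta> z by (simp add: E_def F_def)
    then show "cmod z \<le> cmod (F z)" using EF[OF z] by simp
  qed
  have "\<exists>z. cmod z < 1 \<and> z \<noteq> 0 \<and> cmod (F z) = cmod z" using rot[of "1/2"] by (intro exI[of _ "1/2"]) auto
  then obtain \<alpha> where \<alpha>: "\<And>z. cmod z < 1 \<Longrightarrow> F z = \<alpha> * z" "cmod \<alpha> = 1"
    using Schwarz_Lemma(3)[OF holF F0, of 0] d\<gamma> dN by (auto simp: F_def)
  have "\<gamma> z = \<alpha> * ((z - a) / (1 - cnj a * z))" if z: "z \<in> unit_disk" for z
  proof -
    have "F (?M z) = \<gamma> z" using Moebius_function_compose[of "- a" a z] a z by (simp add: F_def)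
    then show ?thesis using \<alpha>(1)[OF dM[of z]] z by (simp add: Moebius_function_simple)
  qed
  then show ?thesis using that \<alpha>(2) a(1) by blast
qed

lemma at_within_unit_disk_nontrivial:
  assumes "\<xi> \<in> unit_circle"
  shows "at \<xi> within unit_disk \<noteq> bot"
proof -
  have "\<xi> islimpt unit_disk" using assms by (simp add: islimpt_ball)
  then show ?thesis by (simp add: trivial_limit_within)
qed

lemma boundary_action_limit:
  assumes "\<gamma> \<in> disk_automorphisms" "\<xi> \<in> unit_circle"
  shows "(\<gamma> \<longlongrightarrow> boundary_action \<gamma> \<xi>) (at \<xi> within unit_disk)" "boundary_action \<gamma> \<xi> \<in> unit_circle"
proof -
  obtain \<alpha> a where \<alpha>: "cmod \<alpha> = 1" "cmod a < 1"
    "\<And>z. z \<in> unit_disk \<Longrightarrow> \<gamma> z = \<alpha> * ((z - a) / (1 - cnj a * z))"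
    using disk_automorphism_eq_Moebius[OF assms(1)] by metis
  have \<xi>: "cmod \<xi> = 1" "\<xi> * cnj \<xi> = 1" using assms(2) by (auto simp: complex_norm_square[symmetric])
  have "cmod (cnj a * \<xi>) < 1" using \<alpha>(2) \<xi>(1) by (simp add: norm_mult)
  then have ne: "1 - cnj a * \<xi> \<noteq> 0" by (metis norm_one order_less_irrefl right_minus_eq)
  let ?l = "\<alpha> * ((\<xi> - a) / (1 - cnj a * \<xi>))"
  have "((\<lambda>z. \<alpha> * ((z - a) / (1 - cnj a * z))) \<longlongrightarrow> ?l) (at \<xi> within unit_disk)"
    by (intro tendsto_intros ne)
  then have lim: "(\<gamma> \<longlongrightarrow> ?l) (at \<xi> within unit_disk)"
    by (rule Lim_transform_eventually) (auto simp: eventually_at_filter \<alpha>(3))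
  have eq: "boundary_action \<gamma> \<xi> = ?l"
    unfolding boundary_action_def by (rule tendsto_Lim[OF at_within_unit_disk_nontrivial[OF assms(2)] lim])
  show "(\<gamma> \<longlongrightarrow> boundary_action \<gamma> \<xi>) (at \<xi> within unit_disk)" using lim eq by simp
  have "1 - cnj a * \<xi> = \<xi> * cnj (\<xi> - a)" using \<xi>(2) by (simp add: algebra_simps)
  then have "cmod (1 - cnj a * \<xi>) = cmod (\<xi> - a)" using \<xi>(1) by (metis complex_mod_cnj mult_1 norm_mult)
  moreover have "cmod (1 - cnj a * \<xi>) \<noteq> 0" using ne by simp
  ultimately have "cmod (\<xi> - a) / cmod (1 - cnj a * \<xi>) = 1" by (metis divide_self)
  then have "cmod ?l = 1" unfolding norm_mult norm_divide using \<alpha>(1) by (simp only: mult_1)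
  then show "boundary_action \<gamma> \<xi> \<in> unit_circle" unfolding eq by simp
qed

text \<open>The boundary action is the one that is compatible with landing of curves; the group laws for it are
  derived from this along radii.\<close>

lemma boundary_action_landing:
  assumes "\<gamma> \<in> disk_automorphisms" "\<xi> \<in> unit_circle"
    and "(c \<longlongrightarrow> \<xi>) (at_left (1::real))" "c ` {0..<1} \<subseteq> unit_disk"
  shows "((\<lambda>t. \<gamma> (c t)) \<longlongrightarrow> boundary_action \<gamma> \<xi>) (at_left 1)"
proof (rule filterlim_compose[OF boundary_action_limit(1)[OF assms(1,2)]])
  have "\<forall>\<^sub>F t in at_left 1. c t \<in> unit_disk \<and> c t \<noteq> \<xi>"
  proof (rule eventually_at_left_1I[of 0])
    fix t :: real assume "0 \<le> t" "t < 1"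
    then have "c t \<in> unit_disk" using assms(4) by (auto simp: image_subset_iff)
    then show "c t \<in> unit_disk \<and> c t \<noteq> \<xi>" using assms(2) by auto
  qed simp
  then show "filterlim c (at \<xi> within unit_disk) (at_left 1)"
    using assms(3) by (simp add: filterlim_at)
qed

lemma radius_curve:
  assumes "\<xi> \<in> unit_circle"
  shows "continuous_on {0..<1} (\<lambda>t::real. of_real t * \<xi>)" "(\<lambda>t::real. of_real t * \<xi>) ` {0..<1} \<subseteq> unit_disk"
    "((\<lambda>t::real. of_real t * \<xi>) \<longlongrightarrow> \<xi>) (at_left 1)"
proof -
  show "continuous_on {0..<1} (\<lambda>t::real. of_real t * \<xi>)" by (intro continuous_intros)
  show "(\<lambda>t::real. of_real t * \<xi>) ` {0..<1} \<subseteq> unit_disk" using assms by (auto simp: norm_mult)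
  have "((\<lambda>t::real. of_real t * \<xi>) \<longlongrightarrow> of_real 1 * \<xi>) (at_left 1)" by (intro tendsto_intros)
  then show "((\<lambda>t::real. of_real t * \<xi>) \<longlongrightarrow> \<xi>) (at_left 1)" by simp
qed

lemma boundary_action_eqI:
  assumes "\<gamma> \<in> disk_automorphisms" "\<xi> \<in> unit_circle"
    and "(c \<longlongrightarrow> \<xi>) (at_left (1::real))" "c ` {0..<1} \<subseteq> unit_disk"
    and "((\<lambda>t. \<gamma> (c t)) \<longlongrightarrow> \<zeta>) (at_left 1)"
  shows "boundary_action \<gamma> \<xi> = \<zeta>"
  using boundary_action_landing[OF assms(1-4)] assms(5) tendsto_unique trivial_limit_at_left_real by blast

lemma boundary_action_compose:
  assumes \<gamma>: "\<gamma> \<in> disk_automorphisms" and \<delta>: "\<delta> \<in> disk_automorphisms" and \<epsilon>: "\<epsilon> \<in> disk_automorphisms"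
    and eq: "\<And>z. z \<in> unit_disk \<Longrightarrow> \<epsilon> z = \<gamma> (\<delta> z)" and \<xi>: "\<xi> \<in> unit_circle"
  shows "boundary_action \<epsilon> \<xi> = boundary_action \<gamma> (boundary_action \<delta> \<xi>)"
proof (rule boundary_action_eqI[OF \<epsilon> \<xi> radius_curve(3)[OF \<xi>] radius_curve(2)[OF \<xi>]])
  let ?r = "\<lambda>t::real. of_real t * \<xi>"
  have r: "?r t \<in> unit_disk" if "0 \<le> t" "t < 1" for t using radius_curve(2)[OF \<xi>] that by (auto simp: image_subset_iff)
  have "((\<lambda>t. \<gamma> (\<delta> (?r t))) \<longlongrightarrow> boundary_action \<gamma> (boundary_action \<delta> \<xi>)) (at_left 1)"
    using boundary_action_landing[OF \<delta> \<xi> radius_curve(3)[OF \<xi>] radius_curve(2)[OF \<xi>]] r disk_automorphism_into[OF \<delta>]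
    by (intro boundary_action_landing[OF \<gamma> boundary_action_limit(2)[OF \<delta> \<xi>]]) auto
  then show "((\<lambda>t. \<epsilon> (?r t)) \<longlongrightarrow> boundary_action \<gamma> (boundary_action \<delta> \<xi>)) (at_left 1)"
    by (rule Lim_transform_eventually) (use r eq in \<open>auto intro!: eventually_at_left_1I[of 0]\<close>)
qed

lemma disk_automorphism_id: "(\<lambda>z. z) \<in> disk_automorphisms"
  by (auto simp: disk_automorphisms_def bij_betw_def)

lemma boundary_action_id:
  assumes "\<xi> \<in> unit_circle"
  shows "boundary_action (\<lambda>z. z) \<xi> = \<xi>"
  by (rule boundary_action_eqI[OF disk_automorphism_id assms radius_curve(3)[OF assms] radius_curve(2)[OF assms] radius_curve(3)[OF assms]])

lemma deck_group_id: "(\<lambda>z. z) \<in> deck_group \<pi>"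
  by (simp add: deck_group_def disk_automorphism_id)

lemma deck_group_compose:
  assumes "\<gamma> \<in> deck_group \<pi>" "\<delta> \<in> deck_group \<pi>"
  shows "\<gamma> \<circ> \<delta> \<in> deck_group \<pi>"
proof -
  have "\<gamma> \<circ> \<delta> holomorphic_on unit_disk"
    by (rule holomorphic_on_compose_gen[where t = unit_disk])
       (use assms disk_automorphism_into in \<open>auto simp: deck_group_def disk_automorphisms_def bij_betw_def\<close>)
  moreover have "bij_betw (\<gamma> \<circ> \<delta>) unit_disk unit_disk"
    using assms by (intro bij_betw_trans[of \<delta> unit_disk unit_disk]) (auto simp: deck_group_def disk_automorphisms_def)
  ultimately show ?thesis
    using assms disk_automorphism_into[of \<delta>] unfolding deck_group_def by (auto simp: disk_automorphisms_def)
qed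

lemma deck_group_inverse:
  assumes "\<gamma> \<in> deck_group \<pi>"
  obtains \<delta> where "\<delta> \<in> deck_group \<pi>"
    "\<And>z. z \<in> unit_disk \<Longrightarrow> \<delta> (\<gamma> z) = z" "\<And>z. z \<in> unit_disk \<Longrightarrow> \<gamma> (\<delta> z) = z"
proof -
  obtain \<delta> where \<delta>: "\<delta> \<in> disk_automorphisms"
    "\<And>z. z \<in> unit_disk \<Longrightarrow> \<delta> (\<gamma> z) = z" "\<And>z. z \<in> unit_disk \<Longrightarrow> \<gamma> (\<delta> z) = z"
    using disk_automorphism_inverse assms unfolding deck_group_def by auto
  have "\<pi> (\<delta> z) = \<pi> z" if "z \<in> unit_disk" for z
    using assms disk_automorphism_into[OF \<delta>(1) that] \<delta>(3)[OF that] unfolding deck_group_def by force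
  then have "\<delta> \<in> deck_group \<pi>" using \<delta>(1) by (simp add: deck_group_def)
  then show ?thesis using that \<delta>(2,3) by blast
qed

lemma deck_group_circle:
  assumes "\<gamma> \<in> deck_group \<pi>" "\<xi> \<in> unit_circle"
  shows "boundary_action \<gamma> \<xi> \<in> unit_circle"
  using boundary_action_limit(2) assms unfolding deck_group_def by blast

lemma deck_group_action_compose:
  assumes "\<gamma> \<in> deck_group \<pi>" "\<delta> \<in> deck_group \<pi>" "\<xi> \<in> unit_circle"
  shows "boundary_action (\<gamma> \<circ> \<delta>) \<xi> = boundary_action \<gamma> (boundary_action \<delta> \<xi>)"
  using boundary_action_compose[of \<gamma> \<delta> "\<gamma> \<circ> \<delta>" \<xi>] deck_group_compose[OF assms(1,2)] assms
  unfolding deck_group_def by auto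

lemma deck_group_action_inverse:
  assumes "\<gamma> \<in> deck_group \<pi>" "\<delta> \<in> deck_group \<pi>" "\<And>z. z \<in> unit_disk \<Longrightarrow> \<delta> (\<gamma> z) = z" "\<xi> \<in> unit_circle"
  shows "boundary_action \<delta> (boundary_action \<gamma> \<xi>) = \<xi>"
  using boundary_action_compose[of \<delta> \<gamma> "\<lambda>z. z" \<xi>] boundary_action_id[OF assms(4)] disk_automorphism_id assms
  unfolding deck_group_def by auto

text \<open>Locally \<open>\<gamma>\<close> is \<open>g\<close> followed by the holomorphic inverse of a branch of \<open>g\<close>.\<close>

lemma continuous_self_lift_holomorphic:
  assumes cov: "covering_space unit_disk g S" and hol: "g holomorphic_on unit_disk"
    and cont: "continuous_on unit_disk \<gamma>" and into: "\<gamma> ` unit_disk \<subseteq> unit_disk"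
    and lift: "\<And>z. z \<in> unit_disk \<Longrightarrow> g (\<gamma> z) = g z"
  shows "\<gamma> holomorphic_on unit_disk"
  unfolding holomorphic_on_def
proof
  fix z assume z: "z \<in> unit_disk"
  then have "\<gamma> z \<in> unit_disk" using into by blast
  then obtain T U q where T: "\<gamma> z \<in> T" "openin (top_of_set unit_disk) T" "homeomorphism T U g q"
    using covering_space_local_homeomorphism[OF cov] by metis
  have oT: "open T" "T \<subseteq> unit_disk" using T(2) openin_open_trans[OF _ open_ball] openin_imp_subset by blast+
  have inj: "inj_on g T" using T(3) by (metis homeomorphism_def inj_on_inverseI)
  obtain h where h: "h holomorphic_on (g ` T)" "\<And>w. w \<in> T \<Longrightarrow> h (g w) = w"
    using holomorphic_has_inverse[OF holomorphic_on_subset[OF hol oT(2)] oT(1) inj] by metis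
  define N where "N = unit_disk \<inter> \<gamma> -` T"
  have N: "open N" "z \<in> N" "N \<subseteq> unit_disk"
    unfolding N_def using continuous_open_preimage[OF cont open_ball oT(1)] z T(1) by auto
  have "(h \<circ> g) holomorphic_on N"
  proof (rule holomorphic_on_compose_gen[OF _ h(1)])
    show "g holomorphic_on N" using hol N(3) by (rule holomorphic_on_subset)
    show "g ` N \<subseteq> g ` T"
    proof (rule image_subsetI)
      fix w assume "w \<in> N"
      then have "w \<in> unit_disk" "\<gamma> w \<in> T" unfolding N_def by blast+
      then show "g w \<in> g ` T" using lift[of w] by (metis imageI)
    qed
  qed
  then have "\<gamma> holomorphic_on N"
  proof (rule holomorphic_transform)
    fix x assume "x \<in> N"
    then have "x \<in> unit_disk" "\<gamma> x \<in> T" unfolding N_def by blast+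
    then show "(h \<circ> g) x = \<gamma> x" using lift[of x] h(2)[of "\<gamma> x"] by simp
  qed
  then have "\<gamma> field_differentiable at z" using N(1,2) by (rule holomorphic_on_imp_differentiable_at)
  then show "\<gamma> field_differentiable at z within unit_disk" by (rule field_differentiable_at_within)
qed

text \<open>The disk is simply connected, so the covering lifts through itself, once with \<open>a \<mapsto> b\<close> and once with
  \<open>b \<mapsto> a\<close>. By uniqueness of lifts the two maps are inverse to each other.\<close>

lemma deck_transformations_transitive:
  fixes \<pi> :: "complex \<Rightarrow> complex"
  assumes cov: "covering_space unit_disk \<pi> S" and hol: "\<pi> holomorphic_on unit_disk"
    and ab: "a \<in> unit_disk" "b \<in> unit_disk" "\<pi> a = \<pi> b"
  obtains \<gamma> where "\<gamma> \<in> disk_automorphisms" "\<And>z. z \<in> unit_disk \<Longrightarrow> \<pi> (\<gamma> z) = \<pi> z" "\<gamma> a = b"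
proof -
  have cont: "continuous_on unit_disk \<pi>" and im: "\<pi> \<in> unit_disk \<rightarrow> S"
    using cov by (auto simp: covering_space_def)
  have sc: "simply_connected unit_disk" "locally path_connected unit_disk"
    by (auto intro: convex_imp_simply_connected convex_imp_locally_path_connected)
  have ex: "\<exists>\<gamma>. continuous_on unit_disk \<gamma> \<and> \<gamma> \<in> unit_disk \<rightarrow> unit_disk \<and> \<gamma> a = b \<and> (\<forall>z\<in>unit_disk. \<pi> (\<gamma> z) = \<pi> z)"
    if "a \<in> unit_disk" "b \<in> unit_disk" "\<pi> a = \<pi> b" for a b
    using covering_space_lift_strong[OF cov that(2,1) sc cont im that(3)] by metis
  obtain \<gamma> where \<gamma>: "continuous_on unit_disk \<gamma>" "\<gamma> \<in> unit_disk \<rightarrow> unit_disk" "\<gamma> a = b"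
      "\<And>z. z \<in> unit_disk \<Longrightarrow> \<pi> (\<gamma> z) = \<pi> z" using ex[OF ab] by blast
  obtain \<delta> where \<delta>: "continuous_on unit_disk \<delta>" "\<delta> \<in> unit_disk \<rightarrow> unit_disk" "\<delta> b = a"
      "\<And>z. z \<in> unit_disk \<Longrightarrow> \<pi> (\<delta> z) = \<pi> z" using ex[OF ab(2,1) ab(3)[symmetric]] by blast
  have inv: "\<delta> (\<gamma> z) = z"
    if "continuous_on unit_disk \<gamma>" "\<gamma> \<in> unit_disk \<rightarrow> unit_disk" "\<And>z. z \<in> unit_disk \<Longrightarrow> \<pi> (\<gamma> z) = \<pi> z"
      "continuous_on unit_disk \<delta>" "\<delta> \<in> unit_disk \<rightarrow> unit_disk" "\<And>z. z \<in> unit_disk \<Longrightarrow> \<pi> (\<delta> z) = \<pi> z"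
      "\<delta> (\<gamma> a) = a" "a \<in> unit_disk" "z \<in> unit_disk" for \<gamma> \<delta> a z
  proof (rule covering_space_lift_unique[OF cov, of "\<lambda>z. \<delta> (\<gamma> z)" a "\<lambda>z. z" unit_disk \<pi>])
    show "continuous_on unit_disk (\<lambda>z. \<delta> (\<gamma> z))"
      using that by (intro continuous_on_compose2[OF that(4,1)]) auto
    show "\<pi> x = \<pi> (\<delta> (\<gamma> x))" if "x \<in> unit_disk" for x
      using that \<open>\<And>z. z \<in> unit_disk \<Longrightarrow> \<pi> (\<gamma> z) = \<pi> z\<close> \<open>\<And>z. z \<in> unit_disk \<Longrightarrow> \<pi> (\<delta> z) = \<pi> z\<close>
        \<open>\<gamma> \<in> unit_disk \<rightarrow> unit_disk\<close> by (metis PiE)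
  qed (use that cont im in \<open>auto intro: continuous_on_id\<close>)
  have "bij_betw \<gamma> unit_disk unit_disk"
  proof (rule bij_betwI[where g = \<delta>])
    show "\<delta> (\<gamma> z) = z" if "z \<in> unit_disk" for z
      by (rule inv[OF \<gamma>(1,2,4) \<delta>(1,2,4), of a]) (use that ab \<gamma>(3) \<delta>(3) in auto)
    show "\<gamma> (\<delta> z) = z" if "z \<in> unit_disk" for z
      by (rule inv[OF \<delta>(1,2,4) \<gamma>(1,2,4), of b]) (use that ab \<gamma>(3) \<delta>(3) in auto)
  qed (use \<gamma>(2) \<delta>(2) in auto)
  moreover have "\<gamma> holomorphic_on unit_disk"
    using \<gamma> by (intro continuous_self_lift_holomorphic[OF cov hol]) auto
  ultimately show ?thesis using that \<gamma>(3,4) by (simp add: disk_automorphisms_def)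
qed

section \<open>Moebius coordinates on the sphere\<close>

lemma open_riemann_sphere_iff:
  "open S \<longleftrightarrow> open (Finite -` S) \<and> (Infinity \<in> S \<longrightarrow> (\<exists>R. \<forall>z. R < cmod z \<longrightarrow> Finite z \<in> S))"
proof -
  have Some_iff: "Some z \<in> option_of_sphere ` S \<longleftrightarrow> Finite z \<in> S" for z
    by (metis bij_option_of_sphere bij_is_inj inj_image_mem_iff option_of_sphere.simps(1))
  have None_iff: "None \<in> option_of_sphere ` S \<longleftrightarrow> Infinity \<in> S"
    by (metis bij_option_of_sphere bij_is_inj inj_image_mem_iff option_of_sphere.simps(2))
  have "open S \<longleftrightarrow> (\<exists>U. open U \<and> option_of_sphere ` S = Some ` U) \<or>
      (\<exists>C. compact C \<and> option_of_sphere ` S = insert None (Some ` (- C)))"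
    unfolding open_riemann_sphere_def openin_Alexandroff_compactification
    by (auto simp: compactin_euclidean_iff Compl_eq_Diff_UNIV intro: compact_imp_closed)
  also have "\<dots> \<longleftrightarrow> open (Finite -` S) \<and> (Infinity \<in> S \<longrightarrow> (\<exists>R. \<forall>z. R < cmod z \<longrightarrow> Finite z \<in> S))"
  proof (intro iffI, elim disjE exE conjE)
    fix U assume U: "open U" "option_of_sphere ` S = Some ` U"
    have "Finite -` S = U" using Some_iff U(2) by auto
    moreover have "Infinity \<notin> S" using None_iff U(2) by auto
    ultimately show "open (Finite -` S) \<and> (Infinity \<in> S \<longrightarrow> (\<exists>R. \<forall>z. R < cmod z \<longrightarrow> Finite z \<in> S))"
      using U(1) by simp
  next
    fix C assume C: "compact C" "option_of_sphere ` S = insert None (Some ` (- C))"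
    have "Finite -` S = - C" using Some_iff C(2) by auto
    moreover obtain R where R: "\<And>z. z \<in> C \<Longrightarrow> cmod z \<le> R"
      using compact_imp_bounded[OF C(1)] by (auto simp: bounded_iff)
    moreover have "Finite z \<in> S" if "R < cmod z" for z
    proof -
      have "z \<notin> C" using R[of z] that by auto
      then have "z \<in> Finite -` S" using \<open>Finite -` S = - C\<close> by blast
      then show ?thesis by simp
    qed
    ultimately show "open (Finite -` S) \<and> (Infinity \<in> S \<longrightarrow> (\<exists>R. \<forall>z. R < cmod z \<longrightarrow> Finite z \<in> S))"
      using compact_imp_closed[OF C(1)] by (auto simp: open_Compl)
  next
    assume R: "open (Finite -` S) \<and> (Infinity \<in> S \<longrightarrow> (\<exists>R. \<forall>z. R < cmod z \<longrightarrow> Finite z \<in> S))"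
    show "(\<exists>U. open U \<and> option_of_sphere ` S = Some ` U) \<or>
        (\<exists>C. compact C \<and> option_of_sphere ` S = insert None (Some ` (- C)))"
    proof (cases "Infinity \<in> S")
      case True
      then obtain R where R': "\<And>z. R < cmod z \<Longrightarrow> Finite z \<in> S" using R by auto
      have "bounded (- (Finite -` S))"
        unfolding bounded_iff using R' by (intro exI[of _ R]) (auto simp: not_le[symmetric])
      then have "compact (- (Finite -` S))" using R by (simp add: compact_eq_bounded_closed closed_Compl)
      moreover have "option_of_sphere ` S = insert None (Some ` (- (- (Finite -` S))))"
      proof (rule set_eqI)
        show "x \<in> option_of_sphere ` S \<longleftrightarrow> x \<in> insert None (Some ` (- (- (Finite -` S))))" for x
          using Some_iff None_iff True by (cases x) auto
      qed
      ultimately show ?thesis by (intro disjI2 exI conjI)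
    next
      case False
      have "option_of_sphere ` S = Some ` (Finite -` S)"
      proof (rule set_eqI)
        show "x \<in> option_of_sphere ` S \<longleftrightarrow> x \<in> Some ` (Finite -` S)" for x
          using Some_iff None_iff False by (cases x) auto
      qed
      then show ?thesis using R by (intro disjI1 exI conjI) auto
    qed
  qed
  finally show ?thesis .
qed

text \<open>Homogeneous coordinates \<open>(z : 1)\<close> of a finite point and \<open>(1 : 0)\<close> of \<open>\<infinity>\<close>. They spare case
  distinctions in formulas for Moebius transformations.\<close>

fun hcoord1 :: "riemann_sphere \<Rightarrow> complex" where
  "hcoord1 (Finite z) = z" | "hcoord1 Infinity = 1"

fun hcoord2 :: "riemann_sphere \<Rightarrow> complex" where
  "hcoord2 (Finite z) = 1" | "hcoord2 Infinity = 0"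

text \<open>The determinant of the homogeneous coordinates, which replaces the difference \<open>v - w\<close>.\<close>

definition bracket :: "riemann_sphere \<Rightarrow> riemann_sphere \<Rightarrow> complex" where
  "bracket v w = hcoord1 v * hcoord2 w - hcoord1 w * hcoord2 v"

lemma bracket_eq_0_iff: "bracket v w = 0 \<longleftrightarrow> v = w"
  by (cases v; cases w) (auto simp: bracket_def)

definition point_of_ratio :: "complex \<Rightarrow> complex \<Rightarrow> riemann_sphere" where
  "point_of_ratio x y = (if y = 0 then Infinity else Finite (x / y))"

lemma point_of_ratio_eqI: "x * hcoord2 w = hcoord1 w * y \<Longrightarrow> x \<noteq> 0 \<or> y \<noteq> 0 \<Longrightarrow> point_of_ratio x y = w"
  by (cases w) (auto simp: point_of_ratio_def)

lemma continuous_on_point_of_ratio: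
  fixes f h :: "'a::topological_space \<Rightarrow> complex"
  assumes "continuous_on S f" "continuous_on S h" "\<And>x. x \<in> S \<Longrightarrow> f x \<noteq> 0 \<or> h x \<noteq> 0"
  shows "continuous_on S (\<lambda>x. point_of_ratio (f x) (h x))"
  unfolding continuous_on_def
proof
  fix x assume x: "x \<in> S"
  have f: "(f \<longlongrightarrow> f x) (at x within S)" and h: "(h \<longlongrightarrow> h x) (at x within S)"
    using assms(1,2) x by (auto simp: continuous_on_def)
  show "((\<lambda>x. point_of_ratio (f x) (h x)) \<longlongrightarrow> point_of_ratio (f x) (h x)) (at x within S)"
  proof (rule topological_tendstoI)
    fix U assume U: "open U" "point_of_ratio (f x) (h x) \<in> U"
    show "\<forall>\<^sub>F y in at x within S. point_of_ratio (f y) (h y) \<in> U"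
    proof (cases "h x = 0")
      case False
      have "\<forall>\<^sub>F y in at x within S. h y \<noteq> 0" using tendsto_imp_eventually_ne[OF h False] .
      moreover have "((\<lambda>y. f y / h y) \<longlongrightarrow> f x / h x) (at x within S)" by (intro tendsto_divide f h False)
      then have "\<forall>\<^sub>F y in at x within S. f y / h y \<in> Finite -` U"
        by (rule topological_tendstoD) (use U False in \<open>auto simp: open_riemann_sphere_iff point_of_ratio_def\<close>)
      ultimately show ?thesis by eventually_elim (simp add: point_of_ratio_def)
    next
      case True
      then have "Infinity \<in> U" using U(2) by (simp add: point_of_ratio_def)
      then obtain R where R: "\<And>z. R < cmod z \<Longrightarrow> Finite z \<in> U" using U(1) unfolding open_riemann_sphere_iff by blast
      have "((\<lambda>y. cmod (f y) - R * cmod (h y)) \<longlongrightarrow> cmod (f x) - R * cmod (h x)) (at x within S)"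
        by (intro tendsto_intros f h)
      then have "\<forall>\<^sub>F y in at x within S. 0 < cmod (f y) - R * cmod (h y)"
        by (rule order_tendstoD(1)) (use True assms(3)[OF x] in auto)
      then show ?thesis
      proof eventually_elim
        case (elim y)
        show ?case
        proof (cases "h y = 0")
          case False
          then have "R < cmod (f y / h y)" using elim by (simp add: norm_divide less_divide_eq)
          then show ?thesis using R False by (simp add: point_of_ratio_def)
        qed (simp add: point_of_ratio_def \<open>Infinity \<in> U\<close>)
      qed
    qed
  qed
qed

text \<open>For distinct points, the Moebius transformation with \<open>p, a, b \<mapsto> 0, \<infinity>, 1\<close>. Division by zero gives it the meaningless
  value \<open>0\<close> at \<open>a\<close>.\<close>

definition cross_ratio_map :: "riemann_sphere \<Rightarrow> riemann_sphere \<Rightarrow> riemann_sphere \<Rightarrow> riemann_sphere \<Rightarrow> complex" where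
  "cross_ratio_map p a b w = bracket w p * bracket b a / (bracket w a * bracket b p)"

definition cross_ratio_inv :: "riemann_sphere \<Rightarrow> riemann_sphere \<Rightarrow> riemann_sphere \<Rightarrow> complex \<Rightarrow> riemann_sphere" where
  "cross_ratio_inv p a b u = point_of_ratio (u * hcoord1 a * bracket b p - hcoord1 p * bracket b a) (u * hcoord2 a * bracket b p - hcoord2 p * bracket b a)"

context
  fixes p a b :: riemann_sphere
  assumes distinct: "a \<noteq> p" "b \<noteq> p" "a \<noteq> b"
begin

lemma cross_ratio_map_p: "cross_ratio_map p a b p = 0"
  by (simp add: cross_ratio_map_def bracket_def)

lemma cross_ratio_inv_nondegenerate:
  "u * hcoord1 a * bracket b p - hcoord1 p * bracket b a \<noteq> 0 \<or> u * hcoord2 a * bracket b p - hcoord2 p * bracket b a \<noteq> 0"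
proof (rule ccontr)
  assume "\<not> ?thesis"
  then have 1: "u * bracket b p * hcoord1 a = hcoord1 p * bracket b a" "u * bracket b p * hcoord2 a = hcoord2 p * bracket b a"
    by (auto simp: algebra_simps)
  have "bracket b a * bracket a p = hcoord1 a * (hcoord2 p * bracket b a) - hcoord2 a * (hcoord1 p * bracket b a)"
    by (simp add: bracket_def[of a p] algebra_simps)
  also have "\<dots> = 0" unfolding 1[symmetric] by simp
  finally show False using distinct by (simp add: bracket_eq_0_iff)
qed

lemma cross_ratio_inv_map: "w \<noteq> a \<Longrightarrow> cross_ratio_inv p a b (cross_ratio_map p a b w) = w"
  unfolding cross_ratio_inv_def
proof (rule point_of_ratio_eqI[OF _ cross_ratio_inv_nondegenerate])
  assume "w \<noteq> a"
  define u where "u = cross_ratio_map p a b w"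
  have nz: "bracket w a \<noteq> 0" "bracket b p \<noteq> 0" using distinct \<open>w \<noteq> a\<close> by (auto simp: bracket_eq_0_iff)
  then have "u * (bracket w a * bracket b p) = bracket w p * bracket b a"
    by (simp add: u_def cross_ratio_map_def)
  then have "u * bracket b p * (hcoord1 w * hcoord2 a - hcoord1 a * hcoord2 w) = bracket b a * (hcoord1 w * hcoord2 p - hcoord1 p * hcoord2 w)"
    by (simp add: bracket_def[of w] mult_ac)
  then show "(u * hcoord1 a * bracket b p - hcoord1 p * bracket b a) * hcoord2 w = hcoord1 w * (u * hcoord2 a * bracket b p - hcoord2 p * bracket b a)"
    by (simp add: algebra_simps)
qed

lemma cross_ratio_map_b: "cross_ratio_map p a b b = 1"
  using distinct by (simp add: cross_ratio_map_def bracket_eq_0_iff)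

lemma cross_ratio_map_eq_1_iff: "w \<noteq> a \<Longrightarrow> cross_ratio_map p a b w = 1 \<longleftrightarrow> w = b"
  using cross_ratio_inv_map cross_ratio_map_b distinct by metis

lemma continuous_on_cross_ratio_inv: "continuous_on S (cross_ratio_inv p a b)"
  unfolding cross_ratio_inv_def
  by (intro continuous_on_point_of_ratio continuous_intros cross_ratio_inv_nondegenerate)

lemma cross_ratio_map_chart:
  "cross_ratio_map p a b w = (hcoord1 p * chart_infinity w - hcoord2 p) * bracket b a / ((hcoord1 a * chart_infinity w - hcoord2 a) * bracket b p)"
  if "w \<noteq> Finite 0"
proof (cases w)
  case (Finite z)
  then have "z \<noteq> 0" using that by auto
  have "bracket w v = - z * (hcoord1 v * chart_infinity w - hcoord2 v)" for v
    using Finite \<open>z \<noteq> 0\<close> by (simp add: bracket_def algebra_simps)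
  then show ?thesis using \<open>z \<noteq> 0\<close> by (simp add: cross_ratio_map_def)
qed (simp add: cross_ratio_map_def bracket_def)

lemma continuous_on_cross_ratio_map: "continuous_on (- {a}) (cross_ratio_map p a b)"
proof -
  have cl: "open (- {a})"
    unfolding open_riemann_sphere_iff
  proof (intro conjI impI)
    show "open (Finite -` (- {a}))"
    proof (cases a)
      case (Finite z)
      then have "Finite -` (- {a}) = - {z}" by auto
      then show ?thesis by (simp only: open_Compl closed_singleton)
    qed (simp add: vimage_def)
    show "\<exists>R. \<forall>z. R < cmod z \<longrightarrow> Finite z \<in> - {a}"
      by (cases a) auto
  qed
  have "open (cross_ratio_map p a b -` V \<inter> - {a})" if V: "open V" for V
    unfolding open_riemann_sphere_iff
  proof (intro conjI impI)
    have "continuous_on (Finite -` (- {a})) (\<lambda>z. cross_ratio_map p a b (Finite z))"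
    proof -
      have "bracket (Finite z) a * bracket b p \<noteq> 0" if "z \<in> Finite -` (- {a})" for z
        using that distinct by (auto simp: bracket_eq_0_iff)
      then show ?thesis
        unfolding cross_ratio_map_def bracket_def by (intro continuous_intros) (auto simp: bracket_def)
    qed
    then have "open (Finite -` (- {a}) \<inter> (\<lambda>z. cross_ratio_map p a b (Finite z)) -` V)"
      using cl V by (intro continuous_open_preimage) (auto simp: open_riemann_sphere_iff)
    moreover have "Finite -` (- {a}) \<inter> (\<lambda>z. cross_ratio_map p a b (Finite z)) -` V = Finite -` (cross_ratio_map p a b -` V \<inter> - {a})"
      by auto
    ultimately show "open (Finite -` (cross_ratio_map p a b -` V \<inter> - {a}))" by simp
    assume inf: "Infinity \<in> cross_ratio_map p a b -` V \<inter> - {a}"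
    then obtain a0 where a0: "a = Finite a0" by (cases a) auto
    have "((\<lambda>z. (hcoord1 p * inverse z - hcoord2 p) * bracket b a / ((hcoord1 a * inverse z - hcoord2 a) * bracket b p)) \<longlongrightarrow>
        (hcoord1 p * 0 - hcoord2 p) * bracket b a / ((hcoord1 a * 0 - hcoord2 a) * bracket b p)) at_infinity"
      using distinct by (intro tendsto_intros tendsto_inverse_0) (auto simp: a0 bracket_eq_0_iff)
    also have "(hcoord1 p * 0 - hcoord2 p) * bracket b a / ((hcoord1 a * 0 - hcoord2 a) * bracket b p) = cross_ratio_map p a b Infinity"
      by (subst cross_ratio_map_chart) auto
    finally have "\<forall>\<^sub>F z in at_infinity. (hcoord1 p * inverse z - hcoord2 p) * bracket b a / ((hcoord1 a * inverse z - hcoord2 a) * bracket b p) \<in> V"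
      by (rule topological_tendstoD) (use V inf in auto)
    then obtain R where R: "\<And>z. R \<le> cmod z \<Longrightarrow> (hcoord1 p * inverse z - hcoord2 p) * bracket b a / ((hcoord1 a * inverse z - hcoord2 a) * bracket b p) \<in> V"
      unfolding eventually_at_infinity by blast
    show "\<exists>R. \<forall>z. R < cmod z \<longrightarrow> Finite z \<in> cross_ratio_map p a b -` V \<inter> - {a}"
    proof (intro exI[of _ "max (max R 0) (cmod a0)"] allI impI)
      fix z assume z: "max (max R 0) (cmod a0) < cmod z"
      then have "z \<noteq> 0" "z \<noteq> a0" by auto
      have "cross_ratio_map p a b (Finite z) = (hcoord1 p * inverse z - hcoord2 p) * bracket b a / ((hcoord1 a * inverse z - hcoord2 a) * bracket b p)"
        by (subst cross_ratio_map_chart) (use \<open>z \<noteq> 0\<close> in auto)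
      then have "cross_ratio_map p a b (Finite z) \<in> V" using R[of z] z by simp
      moreover have "Finite z \<noteq> a" using \<open>z \<noteq> a0\<close> a0 by simp
      ultimately show "Finite z \<in> cross_ratio_map p a b -` V \<inter> - {a}" by simp
    qed
  qed
  then show ?thesis using continuous_on_open_vimage[OF cl] by blast
qed

lemma cross_ratio_map_holomorphic:
  assumes "sphere_holomorphic_on f A" "open A" "\<And>z. z \<in> A \<Longrightarrow> f z \<noteq> a"
  shows "(\<lambda>z. cross_ratio_map p a b (f z)) holomorphic_on A"
proof -
  have cont: "continuous_on A f"
    and hol1: "(chart_finite \<circ> f) holomorphic_on {z \<in> A. f z \<noteq> Infinity}"
    and hol2: "(chart_infinity \<circ> f) holomorphic_on {z \<in> A. f z \<noteq> Finite 0}"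
    using assms(1) by (auto simp: sphere_holomorphic_on_def)
  have opn: "open {z \<in> A. f z \<noteq> v}" if "open (- {v})" for v
  proof -
    have "open (A \<inter> f -` (- {v}))" using cont assms(2) that by (rule continuous_open_preimage)
    moreover have "A \<inter> f -` (- {v}) = {z \<in> A. f z \<noteq> v}" by auto
    ultimately show ?thesis by simp
  qed
  have o1: "open {z \<in> A. f z \<noteq> Infinity}" by (rule opn) (auto simp: open_riemann_sphere_iff vimage_def)
  have o2: "open {z \<in> A. f z \<noteq> Finite 0}"
  proof (rule opn)
    have "Finite -` (- {Finite 0}) = - {0}" by auto
    then have "open (Finite -` (- {Finite 0}))" by (simp only: open_Compl closed_singleton)
    moreover have "\<exists>R. \<forall>z. R < cmod z \<longrightarrow> z \<noteq> 0" by (rule exI[of _ 0]) auto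
    ultimately show "open (- {Finite 0})" by (simp add: open_riemann_sphere_iff)
  qed
  have "(\<lambda>z. cross_ratio_map p a b (f z)) holomorphic_on {z \<in> A. f z \<noteq> Infinity}"
  proof (rule holomorphic_transform)
    have fin: "hcoord1 (f z) = chart_finite (f z)" "hcoord2 (f z) = 1" if "f z \<noteq> Infinity" for z
      using that by (cases "f z"; simp)+
    have "(chart_finite (f z) * hcoord2 a - hcoord1 a) * bracket b p \<noteq> 0" if "z \<in> A" "f z \<noteq> Infinity" for z
      using assms(3)[OF that(1)] fin[OF that(2)] distinct bracket_eq_0_iff[of "f z" a] by (auto simp: bracket_eq_0_iff bracket_def[of "f z"])
    then show "(\<lambda>z. (chart_finite (f z) * hcoord2 p - hcoord1 p) * bracket b a / ((chart_finite (f z) * hcoord2 a - hcoord1 a) * bracket b p))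
        holomorphic_on {z \<in> A. f z \<noteq> Infinity}"
      using hol1 unfolding o_def by (intro holomorphic_intros) auto
    show "(chart_finite (f z) * hcoord2 p - hcoord1 p) * bracket b a / ((chart_finite (f z) * hcoord2 a - hcoord1 a) * bracket b p)
        = cross_ratio_map p a b (f z)" if "z \<in> {z \<in> A. f z \<noteq> Infinity}" for z
      using fin[of z] that by (simp add: cross_ratio_map_def bracket_def[of "f z"])
  qed
  moreover have "(\<lambda>z. cross_ratio_map p a b (f z)) holomorphic_on {z \<in> A. f z \<noteq> Finite 0}"
  proof (rule holomorphic_transform)
    have "(hcoord1 a * chart_infinity (f z) - hcoord2 a) * bracket b p \<noteq> 0" if "z \<in> A" "f z \<noteq> Finite 0" for z
      using assms(3)[OF that(1)] that(2) distinct by (cases "f z"; cases a) (auto simp: bracket_eq_0_iff field_simps)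
    then show "(\<lambda>z. (hcoord1 p * chart_infinity (f z) - hcoord2 p) * bracket b a / ((hcoord1 a * chart_infinity (f z) - hcoord2 a) * bracket b p))
        holomorphic_on {z \<in> A. f z \<noteq> Finite 0}"
      using hol2 unfolding o_def by (intro holomorphic_intros) auto
  qed (simp add: cross_ratio_map_chart)
  ultimately have "(\<lambda>z. cross_ratio_map p a b (f z)) holomorphic_on {z \<in> A. f z \<noteq> Infinity} \<union> {z \<in> A. f z \<noteq> Finite 0}"
    using o1 o2 by (simp add: holomorphic_on_Un)
  moreover have "{z \<in> A. f z \<noteq> Infinity} \<union> {z \<in> A. f z \<noteq> Finite 0} = A" by auto
  ultimately show ?thesis by simp
qed

end

lemma covering_space_homeomorphism_compose:
  assumes cov: "covering_space C f S" and hom: "homeomorphism S T m n"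
  shows "covering_space C (\<lambda>z. m (f z)) T"
proof
  have f: "continuous_on C f" "f ` C = S" using cov by (auto simp: covering_space_def)
  have m: "continuous_on S m" "m ` S = T" "\<And>x. x \<in> S \<Longrightarrow> n (m x) = x" using hom by (auto simp: homeomorphism_def)
  show "continuous_on C (\<lambda>z. m (f z))" using f m by (intro continuous_on_compose2[OF m(1) f(1)]) auto
  show "(\<lambda>z. m (f z)) ` C = T" using f(2) m(2) by (metis image_image)
  fix y assume "y \<in> T"
  then obtain x where x: "x \<in> S" "y = m x" using m(2) by blast
  obtain U v where U: "x \<in> U" "openin (top_of_set S) U" "\<Union>v = C \<inter> f -` U" "\<forall>u\<in>v. openin (top_of_set C) u"
      "pairwise disjnt v" "\<forall>u\<in>v. \<exists>q. homeomorphism u U f q"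
    using cov x(1) unfolding covering_space_def by metis
  have US: "U \<subseteq> S" using U(2) openin_imp_subset by blast
  show "\<exists>U'. y \<in> U' \<and> openin (top_of_set T) U' \<and> (\<exists>v. \<Union>v = C \<inter> (\<lambda>z. m (f z)) -` U' \<and>
      (\<forall>u\<in>v. openin (top_of_set C) u) \<and> pairwise disjnt v \<and> (\<forall>u\<in>v. \<exists>q. homeomorphism u U' (\<lambda>z. m (f z)) q))"
  proof (intro exI[of _ "m ` U"] conjI exI[of _ v] U(4,5))
    show "y \<in> m ` U" using x U(1) by blast
    show "openin (top_of_set T) (m ` U)" by (rule homeomorphism_imp_open_map[OF hom U(2)])
    have "f z \<in> U" if z: "z \<in> C" "m (f z) \<in> m ` U" for z
    proof -
      obtain x' where "x' \<in> U" "m (f z) = m x'" using z(2) by blast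
      moreover have "f z \<in> S" using z(1) f(2) by blast
      ultimately show ?thesis using m(3) US by (metis subsetD)
    qed
    then show "\<Union>v = C \<inter> (\<lambda>z. m (f z)) -` m ` U" unfolding U(3) by blast
    show "\<forall>u\<in>v. \<exists>q. homeomorphism u (m ` U) (\<lambda>z. m (f z)) q"
    proof
      fix u assume "u \<in> v"
      then obtain q where q: "homeomorphism u U f q" using U(6) by blast
      have "homeomorphism U (m ` U) m n"
        by (rule homeomorphism_of_subsets[OF hom US subset_refl refl])
      from homeomorphism_compose[OF q this] show "\<exists>q. homeomorphism u (m ` U) (\<lambda>z. m (f z)) q"
        unfolding o_def by blast
    qed
  qed
qed

section \<open>Accesses and landing points of lifts\<close>

text \<open>A covering by the disk of a domain that omits \<open>p\<close>, together with a coordinate \<open>m\<close> on the domain and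
  \<open>p\<close>, with continuous left inverse \<open>n\<close>, in which the domain is planar and omits \<open>0\<close> and \<open>1\<close>, and \<open>p\<close> is
  \<open>0\<close>. Everything about the covering is deduced from the planar covering \<open>g = m \<circ> \<pi>\<close>.\<close>

locale access_covering =
  fixes \<Omega> :: "riemann_sphere set" and z\<^sub>0 p :: riemann_sphere and \<pi> :: "complex \<Rightarrow> riemann_sphere"
    and m :: "riemann_sphere \<Rightarrow> complex" and n :: "complex \<Rightarrow> riemann_sphere"
  assumes covering: "covering_space unit_disk \<pi> \<Omega>" and base: "\<pi> 0 = z\<^sub>0" and p_omitted: "p \<notin> \<Omega>"
    and m_cont: "continuous_on (insert p \<Omega>) m" and n_cont: "continuous_on UNIV n"
    and n_m: "\<And>w. w \<in> insert p \<Omega> \<Longrightarrow> n (m w) = w"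
    and m_p: "m p = 0" and m_ne_1: "\<And>w. w \<in> \<Omega> \<Longrightarrow> m w \<noteq> 1"
    and m_\<pi>_holomorphic: "(\<lambda>z. m (\<pi> z)) holomorphic_on unit_disk"
begin

abbreviation curves where "curves \<equiv> landing_curves \<Omega> z\<^sub>0 p"
abbreviation homotopic where "homotopic \<equiv> access_rel \<Omega> z\<^sub>0 p"
abbreviation all_accesses where "all_accesses \<equiv> accesses \<Omega> z\<^sub>0 p"
abbreviation radial_points where "radial_points \<equiv> radial_preimage \<pi> p"
abbreviation orbit_rel where "orbit_rel \<equiv> deck_orbit_rel \<pi> p"
abbreviation deck where "deck \<equiv> deck_group \<pi>"

definition g :: "complex \<Rightarrow> complex" where "g z = m (\<pi> z)"

lemma \<pi>_in: "z \<in> unit_disk \<Longrightarrow> \<pi> z \<in> \<Omega>"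
  using covering by (auto simp: covering_space_def)

lemma n_g: "z \<in> unit_disk \<Longrightarrow> n (g z) = \<pi> z"
  using n_m \<pi>_in by (simp add: g_def)

lemma n_0: "n 0 = p"
  using n_m[of p] m_p by simp

lemma g_eq_iff: "z \<in> unit_disk \<Longrightarrow> w \<in> \<Omega> \<Longrightarrow> g z = m w \<longleftrightarrow> \<pi> z = w"
  by (metis n_g n_m g_def insertCI)

lemma g_holomorphic: "g holomorphic_on unit_disk"
  using m_\<pi>_holomorphic by (simp add: g_def[abs_def])

lemma omitting_g: "omitting_01 g"
  unfolding omitting_01_def
proof (intro conjI ballI g_holomorphic)
  fix z assume z: "z \<in> unit_disk"
  show "g z \<noteq> 0" using n_g[OF z] n_0 \<pi>_in[OF z] p_omitted by metis
  show "g z \<noteq> 1" using m_ne_1[OF \<pi>_in[OF z]] by (simp add: g_def)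
qed

lemma covering_g: "covering_space unit_disk g (m ` \<Omega>)"
proof -
  have "homeomorphism \<Omega> (m ` \<Omega>) m n"
    using n_m by (intro homeomorphismI continuous_on_subset[OF m_cont] continuous_on_subset[OF n_cont]) auto
  from covering_space_homeomorphism_compose[OF covering this] show ?thesis by (simp add: g_def[abs_def])
qed

lemma tendsto_p_iff:
  assumes "\<forall>\<^sub>F x in F. f x \<in> \<Omega>"
  shows "(f \<longlongrightarrow> p) F \<longleftrightarrow> ((\<lambda>x. m (f x)) \<longlongrightarrow> 0) F"
proof
  assume "(f \<longlongrightarrow> p) F"
  then have "((\<lambda>x. m (f x)) \<longlongrightarrow> m p) F"
    by (intro continuous_on_tendsto_compose[OF m_cont]) (use assms in \<open>auto elim: eventually_mono\<close>)
  then show "((\<lambda>x. m (f x)) \<longlongrightarrow> 0) F" by (simp add: m_p)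
next
  assume "((\<lambda>x. m (f x)) \<longlongrightarrow> 0) F"
  then have "((\<lambda>x. n (m (f x))) \<longlongrightarrow> n 0) F"
    by (intro continuous_on_tendsto_compose[OF n_cont]) auto
  then have "((\<lambda>x. n (m (f x))) \<longlongrightarrow> p) F" by (simp add: n_0)
  moreover have "\<forall>\<^sub>F x in F. n (m (f x)) = f x" using assms by eventually_elim (simp add: n_m)
  ultimately show "(f \<longlongrightarrow> p) F" by (rule Lim_transform_eventually)
qed

lemma tendsto_p_disk_curve:
  assumes "c ` {0..<1::real} \<subseteq> unit_disk"
  shows "((\<lambda>t. \<pi> (c t)) \<longlongrightarrow> p) (at_left 1) \<longleftrightarrow> vanishing_along g c"
  unfolding g_def
  by (rule tendsto_p_iff, rule eventually_at_left_1I[of 0]) (use assms \<pi>_in in \<open>auto simp: image_subset_iff\<close>)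

lemma radial_preimage_iff:
  "\<xi> \<in> radial_points \<longleftrightarrow> \<xi> \<in> unit_circle \<and> ((\<lambda>t. g (of_real t * \<xi>)) \<longlongrightarrow> 0) (at_left 1)"
  using tendsto_p_disk_curve[OF radius_curve(2)] by (auto simp: radial_preimage_def)

lemma deck_group_g:
  assumes "\<gamma> \<in> deck" "z \<in> unit_disk"
  shows "\<gamma> z \<in> unit_disk" "g (\<gamma> z) = g z"
  using assms disk_automorphism_into unfolding deck_group_def g_def by auto

lemma deck_group_disk_automorphism: "\<gamma> \<in> deck \<Longrightarrow> \<gamma> \<in> disk_automorphisms"
  by (simp add: deck_group_def)

lemma deck_group_transitive:
  assumes "z \<in> unit_disk" "w \<in> unit_disk" "\<pi> z = \<pi> w"
  obtains \<gamma> where "\<gamma> \<in> deck" "\<gamma> z = w"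
proof -
  have "g z = g w" using assms(3) by (simp add: g_def)
  then obtain \<gamma> where \<gamma>: "\<gamma> \<in> disk_automorphisms" "\<And>u. u \<in> unit_disk \<Longrightarrow> g (\<gamma> u) = g u" "\<gamma> z = w"
    using deck_transformations_transitive[OF covering_g g_holomorphic assms(1,2)] by metis
  have "\<pi> (\<gamma> u) = \<pi> u" if "u \<in> unit_disk" for u
    using \<gamma>(2)[OF that] n_g[OF that] n_g[OF disk_automorphism_into[OF \<gamma>(1) that]] by metis
  then have "\<gamma> \<in> deck" using \<gamma>(1) by (simp add: deck_group_def)
  then show ?thesis using that \<gamma>(3) by blast
qed

lemma deck_curve:
  assumes \<gamma>: "\<gamma> \<in> deck" and \<xi>: "\<xi> \<in> unit_circle"
    and c: "continuous_on {0..<1::real} c" "c ` {0..<1} \<subseteq> unit_disk" "(c \<longlongrightarrow> \<xi>) (at_left 1)"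
  shows "continuous_on {0..<1} (\<lambda>t. \<gamma> (c t))" "(\<lambda>t. \<gamma> (c t)) ` {0..<1} \<subseteq> unit_disk"
    "((\<lambda>t. \<gamma> (c t)) \<longlongrightarrow> boundary_action \<gamma> \<xi>) (at_left 1)"
    "vanishing_along g c \<Longrightarrow> ((\<lambda>t. g (\<gamma> (c t))) \<longlongrightarrow> 0) (at_left 1)"
proof -
  have "continuous_on unit_disk \<gamma>"
    using \<gamma> by (auto simp: deck_group_def disk_automorphisms_def holomorphic_on_imp_continuous_on)
  then show "continuous_on {0..<1} (\<lambda>t. \<gamma> (c t))" using c(1,2) by (rule continuous_on_compose2)
  show "(\<lambda>t. \<gamma> (c t)) ` {0..<1} \<subseteq> unit_disk"
    by (rule image_subsetI) (rule deck_group_g(1)[OF \<gamma>], use c(2) in blast)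
  show "((\<lambda>t. \<gamma> (c t)) \<longlongrightarrow> boundary_action \<gamma> \<xi>) (at_left 1)"
    by (rule boundary_action_landing[OF deck_group_disk_automorphism[OF \<gamma>] \<xi> c(3,2)])
  assume "vanishing_along g c"
  then show "((\<lambda>t. g (\<gamma> (c t))) \<longlongrightarrow> 0) (at_left 1)"
  proof (rule Lim_transform_eventually)
    show "\<forall>\<^sub>F t in at_left 1. g (c t) = g (\<gamma> (c t))"
      by (rule eventually_at_left_1I[of 0]) (use deck_group_g(2)[OF \<gamma>] c(2) in \<open>auto simp: image_subset_iff\<close>)
  qed
qed

lemma landing_point_radial:
  assumes "\<xi> \<in> unit_circle" "continuous_on {0..<1::real} c" "c ` {0..<1} \<subseteq> unit_disk"
    "(c \<longlongrightarrow> \<xi>) (at_left 1)" "vanishing_along g c"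
  shows "\<xi> \<in> radial_points"
  using same_end_imp_small[OF landing_imp_same_end_as_radius[OF omitting_g assms]] assms(1)
  by (simp add: radial_preimage_iff)

lemma radial_preimage_deck_invariant:
  assumes "\<xi> \<in> radial_points" "\<gamma> \<in> deck"
  shows "boundary_action \<gamma> \<xi> \<in> radial_points"
proof -
  have \<xi>: "\<xi> \<in> unit_circle" and lim: "((\<lambda>t. g (of_real t * \<xi>)) \<longlongrightarrow> 0) (at_left 1)"
    using assms(1) by (auto simp: radial_preimage_iff)
  note d = deck_curve[OF assms(2) \<xi> radius_curve[OF \<xi>]]
  show ?thesis by (rule landing_point_radial[OF deck_group_circle[OF assms(2) \<xi>] d(1-3) d(4)[OF lim]])
qed

definition lift_lands :: "(real \<Rightarrow> riemann_sphere) \<Rightarrow> complex \<Rightarrow> bool" where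
  "lift_lands \<eta> \<xi> \<longleftrightarrow> \<xi> \<in> unit_circle \<and> (\<exists>c. lift_from \<pi> 0 \<eta> c \<and> lands_at c \<xi>)"

lemma lift_unique:
  assumes "lift_from \<pi> a \<eta> c" "lift_from \<pi> a \<eta> c'" "t \<in> {0..<1}"
  shows "c t = c' t"
proof -
  have c: "continuous_on {0..<1} c" "c \<in> {0..<1} \<rightarrow> unit_disk" "c 0 = a" "\<And>t. t \<in> {0..<1} \<Longrightarrow> \<pi> (c t) = \<eta> t"
    using assms(1) unfolding lift_from_def curve_from_def by auto
  have c': "continuous_on {0..<1} c'" "c' \<in> {0..<1} \<rightarrow> unit_disk" "c' 0 = a" "\<And>t. t \<in> {0..<1} \<Longrightarrow> \<pi> (c' t) = \<eta> t"
    using assms(2) unfolding lift_from_def curve_from_def by auto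
  have "continuous_on {0..<1} (\<lambda>t. \<pi> (c t))"
    using c(2) by (intro continuous_on_compose2[OF covering_space_imp_continuous[OF covering] c(1)]) auto
  then have \<eta>: "continuous_on {0..<1} \<eta>" by (rule continuous_on_eq) (rule c(4))
  have "\<eta> \<in> {0..<1} \<rightarrow> \<Omega>"
  proof
    fix t :: real assume t: "t \<in> {0..<1}"
    show "\<eta> t \<in> \<Omega>" using \<pi>_in[of "c t"] c(2,4) t by (metis PiE)
  qed
  show ?thesis
  proof (rule covering_space_lift_unique[OF covering, of c 0 c' "{0..<1}" \<eta> t])
    show "connected {0..<1::real}" by (intro convex_connected convex_real_interval)
    show "c 0 = c' 0" using c(3) c'(3) by simp
  qed (fact \<eta> \<open>\<eta> \<in> {0..<1} \<rightarrow> \<Omega>\<close> c c' c(4)[symmetric] c'(4)[symmetric] assms(3) | simp)+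
qed

text \<open>The lifting theorem for coverings of the plane is applied to \<open>m \<circ> \<eta>\<close>.\<close>

lemma lift_exists:
  assumes "\<eta> \<in> curves"
  obtains c where "lift_from \<pi> 0 \<eta> c" "vanishing_along g c"
proof -
  have \<eta>: "continuous_on {0..<1} \<eta>" "\<And>t. t \<in> {0..<1} \<Longrightarrow> \<eta> t \<in> \<Omega>" "\<eta> 0 = z\<^sub>0" "(\<eta> \<longlongrightarrow> p) (at_left 1)"
    using assms by (auto simp: landing_curves_def curve_from_def lands_at_def image_subset_iff)
  have cm: "continuous_on {0..<1} (\<lambda>t. m (\<eta> t))"
    using \<eta>(2) by (intro continuous_on_compose2[OF m_cont \<eta>(1)]) auto
  obtain c where c: "continuous_on {0..<1} c" "c \<in> {0..<1} \<rightarrow> unit_disk" "c 0 = 0" "\<And>t. t \<in> {0..<1} \<Longrightarrow> g (c t) = m (\<eta> t)"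
  proof (rule covering_space_lift_strong[OF covering_g, of 0 "0::real" "{0..<1}" "\<lambda>t. m (\<eta> t)"])
    show "simply_connected {0..<1::real}" "locally path_connected {0..<1::real}"
      by (auto intro: convex_imp_simply_connected convex_imp_locally_path_connected)
  qed (use cm \<eta> base in \<open>auto simp: g_def\<close>)
  have eq: "\<pi> (c t) = \<eta> t" if "t \<in> {0..<1}" for t
    using c(2,4) \<eta>(2) that g_eq_iff by blast
  then have lift: "lift_from \<pi> 0 \<eta> c" using c unfolding lift_from_def curve_from_def by auto
  have "((\<lambda>t. m (\<eta> t)) \<longlongrightarrow> 0) (at_left 1)"
    using \<eta>(4) by (subst tendsto_p_iff[symmetric]) (auto intro!: eventually_at_left_1I[of 0] \<eta>(2))
  then have "vanishing_along g c"
    by (rule Lim_transform_eventually) (use c(4) in \<open>auto intro!: eventually_at_left_1I[of 0]\<close>)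
  then show ?thesis using that lift by blast
qed

lemma lift_small:
  assumes "\<eta> \<in> curves" "lift_from \<pi> 0 \<eta> c"
  shows "vanishing_along g c"
proof -
  obtain c' where c': "lift_from \<pi> 0 \<eta> c'" "vanishing_along g c'"
    using lift_exists[OF assms(1)] .
  from c'(2) show ?thesis
    by (rule Lim_transform_eventually) (use lift_unique[OF c'(1) assms(2)] in \<open>auto intro!: eventually_at_left_1I[of 0]\<close>)
qed

lemma lift_lands_exists:
  assumes "\<eta> \<in> curves"
  obtains \<xi> where "lift_lands \<eta> \<xi>"
proof -
  obtain c where c: "lift_from \<pi> 0 \<eta> c" "vanishing_along g c"
    using lift_exists[OF assms] .
  then obtain \<xi> where "\<xi> \<in> unit_circle" "(c \<longlongrightarrow> \<xi>) (at_left 1)"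
    using small_curve_lands[OF omitting_g, of c] unfolding lift_from_def curve_from_def by metis
  then show ?thesis using that c(1) unfolding lift_lands_def lands_at_def by blast
qed

lemma lift_lands_radial:
  assumes "\<eta> \<in> curves" "lift_lands \<eta> \<xi>"
  shows "\<xi> \<in> radial_points"
proof -
  obtain c where c: "\<xi> \<in> unit_circle" "lift_from \<pi> 0 \<eta> c" "(c \<longlongrightarrow> \<xi>) (at_left 1)"
    using assms(2) unfolding lift_lands_def lands_at_def by blast
  then show ?thesis
    using landing_point_radial[of \<xi> c] lift_small[OF assms(1) c(2)] unfolding lift_from_def curve_from_def by blast
qed

lemma disk_curve_projects:
  assumes "curve_from unit_disk 0 c" "lands_at c \<xi>" "\<xi> \<in> unit_circle" "vanishing_along g c"
  shows "\<pi> \<circ> c \<in> curves" "lift_lands (\<pi> \<circ> c) \<xi>"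
proof -
  have c: "continuous_on {0..<1} c" "c ` {0..<1} \<subseteq> unit_disk" "c 0 = 0" using assms(1) by (auto simp: curve_from_def)
  have "continuous_on {0..<1} (\<pi> \<circ> c)"
    unfolding o_def by (rule continuous_on_compose2[OF covering_space_imp_continuous[OF covering] c(1,2)])
  moreover have "(\<pi> \<circ> c) ` {0..<1} \<subseteq> \<Omega>" using c(2) \<pi>_in by (auto simp: image_subset_iff)
  moreover have "((\<pi> \<circ> c) \<longlongrightarrow> p) (at_left 1)" unfolding o_def using tendsto_p_disk_curve[OF c(2)] assms(4) by blast
  ultimately show "\<pi> \<circ> c \<in> curves"
    using base c(3) by (auto simp: landing_curves_def curve_from_def lands_at_def)
  have "lift_from \<pi> 0 (\<pi> \<circ> c) c" using assms(1) by (simp add: lift_from_def)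
  then show "lift_lands (\<pi> \<circ> c) \<xi>" using assms(2,3) unfolding lift_lands_def by blast
qed

text \<open>Lift the homotopy to the disk, starting at \<open>0\<close>. One side is the lift of \<open>\<eta>1\<close>; the other starts at
  some point over \<open>z\<^sub>0\<close>, so it is the image of the lift of \<open>\<eta>2\<close> under a deck transformation. The
  transversal arcs of the lifted homotopy show that both sides land at the same point.\<close>

lemma access_rel_imp_deck_related:
  assumes rel: "(\<eta>1, \<eta>2) \<in> homotopic" and l1: "lift_lands \<eta>1 \<xi>1" and l2: "lift_lands \<eta>2 \<xi>2"
  obtains \<gamma> where "\<gamma> \<in> deck" "\<xi>2 = boundary_action \<gamma> \<xi>1"
proof -
  have lc: "\<eta>1 \<in> curves" "\<eta>2 \<in> curves" using rel by (auto simp: access_rel_def)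
  obtain H :: "real \<times> real \<Rightarrow> riemann_sphere" where H: "continuous_on ({0..1} \<times> {0..1}) H"
      "H ` ({0..1} \<times> {0..<1}) \<subseteq> \<Omega>" "\<forall>s\<in>{0..1}. H (s, 1) = p"
      "\<forall>t\<in>{0..<1}. H (0, t) = \<eta>1 t \<and> H (1, t) = \<eta>2 t"
    using rel unfolding access_rel_def by blast
  obtain c1 where c1: "lift_from \<pi> 0 \<eta>1 c1" "lands_at c1 \<xi>1" and \<xi>1: "\<xi>1 \<in> unit_circle"
    using l1 unfolding lift_lands_def by blast
  obtain c2 where c2: "lift_from \<pi> 0 \<eta>2 c2" "lands_at c2 \<xi>2" and \<xi>2: "\<xi>2 \<in> unit_circle"
    using l2 unfolding lift_lands_def by blast
  have H\<Omega>: "H x \<in> \<Omega>" if "x \<in> {0..1} \<times> {0..<1}" for x using H(2) that by blast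
  have Hin: "H x \<in> insert p \<Omega>" if "x \<in> {0..1} \<times> {0..1}" for x
  proof (cases "snd x = 1")
    case True
    then show ?thesis using H(3) that by (cases x) auto
  next
    case False
    then have "x \<in> {0..1} \<times> {0..<1}" using that by (cases x) auto
    then show ?thesis using H\<Omega> by blast
  qed
  define M where "M = (\<lambda>x. m (H x))"
  have M: "continuous_on ({0..1} \<times> {0..1}) M"
    unfolding M_def using Hin by (intro continuous_on_compose2[OF m_cont H(1)]) blast
  let ?U = "{0..1::real} \<times> {0..<1::real}"
  obtain K where K: "continuous_on ?U K" "K \<in> ?U \<rightarrow> unit_disk" "K (0, 0) = 0" "\<And>x. x \<in> ?U \<Longrightarrow> g (K x) = M x"
  proof (rule covering_space_lift_strong[OF covering_g, of 0 "(0, 0)" ?U M])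
    have "convex ?U" by (intro convex_Times convex_real_interval)
    then show "simply_connected ?U" "locally path_connected ?U"
      by (auto intro: convex_imp_simply_connected convex_imp_locally_path_connected)
    show "continuous_on ?U M" by (rule continuous_on_subset[OF M]) auto
    show "M \<in> ?U \<rightarrow> m ` \<Omega>" unfolding M_def using H\<Omega> by blast
    show "M (0, 0) = g 0" using H(4) lc(1) base by (auto simp: M_def g_def landing_curves_def curve_from_def)
  qed auto
  have \<pi>K: "\<pi> (K x) = H x" if "x \<in> ?U" for x
    using K(2) K(4)[OF that] that H\<Omega>[OF that] g_eq_iff unfolding M_def by blast
  have KU: "K x \<in> unit_disk" if "x \<in> ?U" for x using K(2) that by blast
  have "lift_from \<pi> 0 \<eta>1 (\<lambda>t. K (0, t))"
    unfolding lift_from_def curve_from_def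
  proof (intro conjI ballI)
    show "continuous_on {0..<1} (\<lambda>t. K (0, t))" by (rule continuous_on_compose2[OF K(1)]) (auto intro!: continuous_intros)
    show "(\<lambda>t. K (0, t)) ` {0..<1} \<subseteq> unit_disk" by (rule image_subsetI, rule KU) auto
    show "\<pi> (K (0, t)) = \<eta>1 t" if "t \<in> {0..<1}" for t using \<pi>K[of "(0, t)"] H(4) that by auto
  qed (rule K(3))
  then have K0: "K (0, t) = c1 t" if "t \<in> {0..<1}" for t using lift_unique[OF _ c1(1) that] by blast
  have z\<eta>2: "\<eta>2 0 = z\<^sub>0" using lc(2) by (auto simp: landing_curves_def curve_from_def)
  have "\<pi> 0 = \<pi> (K (1, 0))" using \<pi>K[of "(1, 0)"] H(4) z\<eta>2 base by auto
  then obtain \<gamma> where \<gamma>: "\<gamma> \<in> deck" "\<gamma> 0 = K (1, 0)"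
    using deck_group_transitive[of 0 "K (1, 0)"] KU[of "(1, 0)"] by auto
  have c2': "continuous_on {0..<1} c2" "c2 ` {0..<1} \<subseteq> unit_disk" "c2 0 = 0" "\<And>t. t \<in> {0..<1} \<Longrightarrow> \<pi> (c2 t) = \<eta>2 t"
    using c2(1) by (auto simp: lift_from_def curve_from_def)
  note d = deck_curve[OF \<gamma>(1) \<xi>2 c2'(1,2) c2(2)[unfolded lands_at_def]]
  have l2a: "lift_from \<pi> (K (1, 0)) \<eta>2 (\<lambda>t. K (1, t))"
    unfolding lift_from_def curve_from_def
  proof (intro conjI ballI)
    show "continuous_on {0..<1} (\<lambda>t. K (1, t))" by (rule continuous_on_compose2[OF K(1)]) (auto intro!: continuous_intros)
    show "(\<lambda>t. K (1, t)) ` {0..<1} \<subseteq> unit_disk" by (rule image_subsetI, rule KU) auto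
    show "\<pi> (K (1, t)) = \<eta>2 t" if "t \<in> {0..<1}" for t using \<pi>K[of "(1, t)"] H(4) that by auto
  qed simp
  have l2b: "lift_from \<pi> (K (1, 0)) \<eta>2 (\<lambda>t. \<gamma> (c2 t))"
    unfolding lift_from_def curve_from_def
  proof (intro conjI ballI d(1,2))
    show "\<pi> (\<gamma> (c2 t)) = \<eta>2 t" if "t \<in> {0..<1}" for t
      using \<gamma>(1) c2'(2) c2'(4)[OF that] that by (auto simp: deck_group_def image_subset_iff)
  qed (simp add: c2'(3) \<gamma>(2))
  have K1: "K (1, t) = \<gamma> (c2 t)" if "t \<in> {0..<1}" for t using lift_unique[OF l2a l2b that] .
  have "\<xi>1 = boundary_action \<gamma> \<xi>2"
  proof (rule joined_small_curves_land_together[OF omitting_g c1(2)[unfolded lands_at_def] d(3)])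
    fix \<epsilon> :: real assume "0 < \<epsilon>"
    have "uniformly_continuous_on ({0..1} \<times> {0..1}) M"
      by (intro compact_uniformly_continuous M compact_Times compact_Icc)
    then obtain \<delta> where \<delta>: "0 < \<delta>" "\<And>x y. x \<in> {0..1} \<times> {0..1} \<Longrightarrow> y \<in> {0..1} \<times> {0..1} \<Longrightarrow> dist y x < \<delta> \<Longrightarrow> dist (M y) (M x) < \<epsilon>"
      using \<open>0 < \<epsilon>\<close> unfolding uniformly_continuous_on_def by metis
    show "\<forall>\<^sub>F t in at_left 1. \<exists>q. path q \<and> path_image q \<subseteq> unit_disk \<and>
        pathstart q = c1 t \<and> pathfinish q = \<gamma> (c2 t) \<and> (\<forall>z\<in>path_image q. cmod (g z) \<le> \<epsilon>)"
    proof (rule eventually_at_left_1I[of "max 0 (1 - \<delta> / 2)"])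
      fix t assume t: "max 0 (1 - \<delta> / 2) \<le> t" "t < 1"
      then have t': "t \<in> {0..<1}" by auto
      define q where "q = (\<lambda>s. K (s, t))"
      have "path q" unfolding path_def q_def
        by (rule continuous_on_compose2[OF K(1)]) (use t' in \<open>auto intro!: continuous_intros\<close>)
      moreover have "path_image q \<subseteq> unit_disk" unfolding path_image_def q_def
        by (rule image_subsetI, rule KU) (use t' in auto)
      moreover have "cmod (g z) \<le> \<epsilon>" if z: "z \<in> path_image q" for z
      proof -
        obtain s where s: "s \<in> {0..1}" "z = K (s, t)" using z unfolding path_image_def q_def by blast
        have "dist (s, t) (s, 1) < \<delta>" using t \<delta>(1) by (simp add: dist_Pair_Pair dist_real_def)
        then have "dist (M (s, t)) (M (s, 1)) < \<epsilon>" using \<delta>(2)[of "(s, 1)" "(s, t)"] s(1) t' by auto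
        then show ?thesis using K(4)[of "(s, t)"] s t' H(3) by (simp add: M_def m_p)
      qed
      moreover have "pathstart q = c1 t" "pathfinish q = \<gamma> (c2 t)"
        using K0[OF t'] K1[OF t'] by (auto simp: pathstart_def pathfinish_def q_def)
      ultimately show "\<exists>q. path q \<and> path_image q \<subseteq> unit_disk \<and>
        pathstart q = c1 t \<and> pathfinish q = \<gamma> (c2 t) \<and> (\<forall>z\<in>path_image q. cmod (g z) \<le> \<epsilon>)" by blast
    qed (use \<delta>(1) in auto)
  qed
  moreover obtain \<delta> where \<delta>: "\<delta> \<in> deck" "\<And>z. z \<in> unit_disk \<Longrightarrow> \<delta> (\<gamma> z) = z"
    by (rule deck_group_inverse[OF \<gamma>(1)]) blast
  ultimately have "\<xi>2 = boundary_action \<delta> \<xi>1"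
    using deck_group_action_inverse[OF \<gamma>(1) \<delta> \<xi>2] by simp
  then show ?thesis using that \<delta>(1) by blast
qed

text \<open>After application of a deck transformation both lifts land at the same point. Both have the same end
  as the radius to it, and a homotopy between them projects to \<open>\<Omega>\<close>. The transformed lift does not start
  at \<open>0\<close>; this is allowed because the initial points of the homotopy may move.\<close>

lemma deck_related_imp_access_rel:
  assumes lc: "\<eta>1 \<in> curves" "\<eta>2 \<in> curves"
    and l1: "lift_lands \<eta>1 \<xi>1" and l2: "lift_lands \<eta>2 \<xi>2"
    and \<gamma>: "\<gamma> \<in> deck" "\<xi>2 = boundary_action \<gamma> \<xi>1"
  shows "(\<eta>1, \<eta>2) \<in> homotopic"
proof -
  obtain c1 where c1: "lift_from \<pi> 0 \<eta>1 c1" "(c1 \<longlongrightarrow> \<xi>1) (at_left 1)" and \<xi>1: "\<xi>1 \<in> unit_circle"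
    using l1 unfolding lift_lands_def lands_at_def by blast
  obtain c2 where c2: "lift_from \<pi> 0 \<eta>2 c2" "(c2 \<longlongrightarrow> \<xi>2) (at_left 1)" and \<xi>2: "\<xi>2 \<in> unit_circle"
    using l2 unfolding lift_lands_def lands_at_def by blast
  have c1': "continuous_on {0..<1} c1" "c1 ` {0..<1} \<subseteq> unit_disk" "\<And>t. t \<in> {0..<1} \<Longrightarrow> \<pi> (c1 t) = \<eta>1 t"
    using c1(1) by (auto simp: lift_from_def curve_from_def)
  have c2': "continuous_on {0..<1} c2" "c2 ` {0..<1} \<subseteq> unit_disk" "\<And>t. t \<in> {0..<1} \<Longrightarrow> \<pi> (c2 t) = \<eta>2 t"
    using c2(1) by (auto simp: lift_from_def curve_from_def)
  note d = deck_curve[OF \<gamma>(1) \<xi>1 c1'(1,2) c1(2)]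
  have "same_end g (\<lambda>t. \<gamma> (c1 t)) (\<lambda>t. of_real t * \<xi>2)"
    using landing_imp_same_end_as_radius[OF omitting_g \<xi>2 d(1,2)] d(3) d(4)[OF lift_small[OF lc(1) c1(1)]] \<gamma>(2) by simp
  moreover have "same_end g c2 (\<lambda>t. of_real t * \<xi>2)"
    by (rule landing_imp_same_end_as_radius[OF omitting_g \<xi>2 c2'(1,2) c2(2) lift_small[OF lc(2) c2(1)]])
  ultimately have same: "same_end g (\<lambda>t. \<gamma> (c1 t)) c2" using same_end_sym same_end_trans by blast
  obtain K :: "real \<times> real \<Rightarrow> complex" where K: "continuous_on ({0..1} \<times> {0..<1}) K" "K ` ({0..1} \<times> {0..<1}) \<subseteq> unit_disk"
    "\<And>t. t \<in> {0..<1} \<Longrightarrow> K (0, t) = \<gamma> (c1 t)" "\<And>t. t \<in> {0..<1} \<Longrightarrow> K (1, t) = c2 t"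
    "\<And>\<eta>. 0 < \<eta> \<Longrightarrow> \<exists>T<1. \<forall>s\<in>{0..1}. \<forall>t\<in>{T..<1}. cmod (g (K (s, t))) < \<eta>"
    by (rule same_end_homotopy[OF g_holomorphic d(1,2) c2'(1,2) same], rule that) simp_all
  let ?Q = "{0..1::real} \<times> {0..1::real}"
  \<comment> \<open>continuity at the side \<open>t = 1\<close> is easier to see in the plane than on the sphere\<close>
  define M where "M = (\<lambda>x::real \<times> real. if snd x < 1 then g (K x) else 0)"
  have gK: "continuous_on ({0..1} \<times> {0..<1}) (\<lambda>x. g (K x))"
    by (rule continuous_on_compose2[OF holomorphic_on_imp_continuous_on[OF g_holomorphic] K(1,2)])
  have M: "continuous_on ?Q M"
    unfolding continuous_on_eq_continuous_within
  proof
    fix x assume x: "x \<in> ?Q"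
    show "continuous (at x within ?Q) M"
    proof (cases "snd x < 1")
      case True
      have "continuous_on ({0..1} \<times> {0..<1}) M"
        by (rule continuous_on_eq[OF gK]) (auto simp: M_def)
      moreover have "x \<in> {0..1} \<times> {0..<1}" using x True by (cases x) auto
      ultimately have "continuous (at x within ({0..1} \<times> {0..<1})) M"
        unfolding continuous_on_eq_continuous_within by blast
      moreover have "at x within ({0..1} \<times> {0..<1}) = at x within ?Q"
      proof (rule at_within_nhd[of _ "UNIV \<times> {..<1}"])
        show "x \<in> UNIV \<times> {..<1}" using True by (cases x) auto
        show "open (UNIV \<times> {..<1} :: (real \<times> real) set)" by (intro open_Times) auto
      qed auto
      ultimately show ?thesis by simp
    next
      case False
      show ?thesis
        unfolding continuous_within
      proof (rule tendstoI)
        fix e :: real assume e: "0 < e"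
        then obtain T where T: "T < 1" "\<forall>s\<in>{0..1}. \<forall>t\<in>{T..<1}. cmod (g (K (s, t))) < e" using K(5) by blast
        have "open (UNIV \<times> {T<..} :: (real \<times> real) set)" by (intro open_Times) auto
        moreover have "x \<in> UNIV \<times> {T<..}" using False T(1) by (cases x) auto
        ultimately have "\<forall>\<^sub>F y in at x within ?Q. y \<in> UNIV \<times> {T<..}" by (rule eventually_at_in_open'[THEN filter_leD[OF at_le[OF subset_UNIV]]])
        moreover have "\<forall>\<^sub>F y in at x within ?Q. y \<in> ?Q" by (simp add: eventually_at_filter)
        ultimately show "\<forall>\<^sub>F y in at x within ?Q. dist (M y) (M x) < e"
        proof eventually_elim
          case (elim y)
          have "M x = 0" using False by (simp add: M_def)
          then show ?case using T(2) e elim by (cases y) (auto simp: M_def)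
        qed
      qed
    qed
  qed
  define H where "H = (\<lambda>x. n (M x))"
  have HK: "H (s, t) = \<pi> (K (s, t))" if "s \<in> {0..1}" "t \<in> {0..<1}" for s t
  proof -
    have "K (s, t) \<in> unit_disk" using K(2) that by blast
    then show ?thesis using that by (simp add: H_def M_def n_g)
  qed
  have "continuous_on ?Q H" unfolding H_def by (rule continuous_on_compose2[OF n_cont M]) auto
  moreover have "H ` ({0..1} \<times> {0..<1}) \<subseteq> \<Omega>"
  proof (rule image_subsetI)
    fix x :: "real \<times> real" assume x: "x \<in> {0..1} \<times> {0..<1}"
    then have "K x \<in> unit_disk" using K(2) by blast
    then show "H x \<in> \<Omega>" using HK[of "fst x" "snd x"] x \<pi>_in by (cases x) auto
  qed
  moreover have "\<forall>s\<in>{0..1}. H (s, 1) = p" by (simp add: H_def M_def n_0)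
  moreover have "H (0, t) = \<eta>1 t \<and> H (1, t) = \<eta>2 t" if t: "t \<in> {0..<1}" for t
  proof -
    have "c1 t \<in> unit_disk" using c1'(2) t by blast
    then have "\<pi> (\<gamma> (c1 t)) = \<pi> (c1 t)" using \<gamma>(1) by (simp add: deck_group_def)
    then show ?thesis using HK[of 0 t] HK[of 1 t] K(3,4)[OF t] c1'(3)[OF t] c2'(3)[OF t] t by simp
  qed
  ultimately show ?thesis unfolding access_rel_def using lc by blast
qed

section \<open>The correspondence between orbits and accesses\<close>

lemma access_rel_iff:
  assumes "\<eta>1 \<in> curves" "\<eta>2 \<in> curves" "lift_lands \<eta>1 \<xi>1" "lift_lands \<eta>2 \<xi>2"
  shows "(\<eta>1, \<eta>2) \<in> homotopic \<longleftrightarrow> (\<exists>\<gamma>\<in>deck. \<xi>2 = boundary_action \<gamma> \<xi>1)"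
  using access_rel_imp_deck_related[OF _ assms(3,4)] deck_related_imp_access_rel[OF assms] by blast

lemma deck_orbit_rel_iff:
  "(\<xi>, \<zeta>) \<in> orbit_rel \<longleftrightarrow> \<xi> \<in> radial_points \<and> (\<exists>\<gamma>\<in>deck. \<zeta> = boundary_action \<gamma> \<xi>)"
  using radial_preimage_deck_invariant by (auto simp: deck_orbit_rel_def)

lemma radial_preimage_circle: "\<xi> \<in> radial_points \<Longrightarrow> \<xi> \<in> unit_circle"
  by (simp add: radial_preimage_def)

lemma equiv_deck_orbit_rel: "equiv radial_points orbit_rel"
proof (rule equivI)
  show "orbit_rel \<subseteq> radial_points \<times> radial_points" by (auto simp: deck_orbit_rel_def)
  show "refl_on radial_points orbit_rel"
  proof (rule refl_onI)
    fix \<xi> assume \<xi>: "\<xi> \<in> radial_points"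
    then have "\<xi> = boundary_action (\<lambda>z. z) \<xi>" using boundary_action_id[OF radial_preimage_circle] by simp
    then show "(\<xi>, \<xi>) \<in> orbit_rel" using \<xi> deck_group_id unfolding deck_orbit_rel_iff by blast
  qed
  show "sym orbit_rel"
  proof (rule symI)
    fix \<xi> \<zeta> assume rel: "(\<xi>, \<zeta>) \<in> orbit_rel"
    then obtain \<gamma> where \<gamma>: "\<gamma> \<in> deck" "\<zeta> = boundary_action \<gamma> \<xi>" "\<xi> \<in> radial_points"
      unfolding deck_orbit_rel_iff by blast
    obtain \<delta> where \<delta>: "\<delta> \<in> deck" "\<And>z. z \<in> unit_disk \<Longrightarrow> \<delta> (\<gamma> z) = z"
      by (rule deck_group_inverse[OF \<gamma>(1)]) blast
    have "\<xi> = boundary_action \<delta> \<zeta>"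
      using deck_group_action_inverse[OF \<gamma>(1) \<delta> radial_preimage_circle[OF \<gamma>(3)]] \<gamma>(2) by simp
    moreover have "\<zeta> \<in> radial_points" using rel by (auto simp: deck_orbit_rel_def)
    ultimately show "(\<zeta>, \<xi>) \<in> orbit_rel" using \<delta>(1) unfolding deck_orbit_rel_iff by blast
  qed
  show "trans orbit_rel"
  proof (rule transI)
    fix \<xi> \<zeta> \<omega> assume "(\<xi>, \<zeta>) \<in> orbit_rel" "(\<zeta>, \<omega>) \<in> orbit_rel"
    then obtain \<gamma> \<delta> where \<gamma>: "\<gamma> \<in> deck" "\<zeta> = boundary_action \<gamma> \<xi>" "\<xi> \<in> radial_points"
      and \<delta>: "\<delta> \<in> deck" "\<omega> = boundary_action \<delta> \<zeta>"
      unfolding deck_orbit_rel_iff by blast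
    have "\<omega> = boundary_action (\<delta> \<circ> \<gamma>) \<xi>"
      using deck_group_action_compose[OF \<delta>(1) \<gamma>(1) radial_preimage_circle[OF \<gamma>(3)]] \<gamma>(2) \<delta>(2) by simp
    then show "(\<xi>, \<omega>) \<in> orbit_rel"
      using \<gamma>(3) deck_group_compose[OF \<delta>(1) \<gamma>(1)] unfolding deck_orbit_rel_iff by blast
  qed
qed

lemma access_rel_iff_orbit:
  assumes "\<eta>1 \<in> curves" "\<eta>2 \<in> curves" "lift_lands \<eta>1 \<xi>1" "lift_lands \<eta>2 \<xi>2"
  shows "(\<eta>1, \<eta>2) \<in> homotopic \<longleftrightarrow> (\<xi>1, \<xi>2) \<in> orbit_rel"
  using access_rel_iff[OF assms] lift_lands_radial[OF assms(1,3)] by (simp add: deck_orbit_rel_iff)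

text \<open>The relation is the pull-back of the orbit relation by the map that takes a curve to the landing point
  of its lift, so no homotopies have to be composed.\<close>

lemma equiv_access_rel: "equiv curves homotopic"
proof -
  have "\<forall>\<eta>\<in>curves. \<exists>\<xi>. lift_lands \<eta> \<xi>" using lift_lands_exists by metis
  then obtain e where e: "\<And>\<eta>. \<eta> \<in> curves \<Longrightarrow> lift_lands \<eta> (e \<eta>)" by metis
  have rel: "(\<eta>1, \<eta>2) \<in> homotopic \<longleftrightarrow>
      \<eta>1 \<in> curves \<and> \<eta>2 \<in> curves \<and> (e \<eta>1, e \<eta>2) \<in> orbit_rel" for \<eta>1 \<eta>2
  proof (cases "\<eta>1 \<in> curves \<and> \<eta>2 \<in> curves")
    case True
    then show ?thesis using access_rel_iff_orbit e by blast
  qed (auto simp: access_rel_def)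
  note eq = equiv_deck_orbit_rel
  show ?thesis
  proof (rule equivI)
    show "refl_on curves homotopic"
      using e lift_lands_radial eq by (auto simp: rel refl_on_def equiv_def)
    show "sym homotopic"
      using eq by (auto simp: rel sym_def equiv_def)
    show "trans homotopic"
      by (rule transI) (use eq in \<open>auto simp: rel equiv_def dest: transD\<close>)
  qed (auto simp: access_rel_def)
qed

definition access_of :: "complex \<Rightarrow> (real \<Rightarrow> riemann_sphere) set" where
  "access_of \<xi> = homotopic `` {\<pi> \<circ> (\<lambda>t. of_real t * \<xi>)}"

lemma radius_projects:
  assumes "\<xi> \<in> radial_points"
  shows "\<pi> \<circ> (\<lambda>t. of_real t * \<xi>) \<in> curves" "lift_lands (\<pi> \<circ> (\<lambda>t. of_real t * \<xi>)) \<xi>"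
proof -
  have \<xi>: "\<xi> \<in> unit_circle" and lim: "((\<lambda>t. g (of_real t * \<xi>)) \<longlongrightarrow> 0) (at_left 1)"
    using assms by (auto simp: radial_preimage_iff)
  have "curve_from unit_disk 0 (\<lambda>t. of_real t * \<xi>)" "lands_at (\<lambda>t. of_real t * \<xi>) \<xi>"
    using radius_curve[OF \<xi>] by (auto simp: curve_from_def lands_at_def)
  from disk_curve_projects[OF this \<xi> lim]
  show "\<pi> \<circ> (\<lambda>t. of_real t * \<xi>) \<in> curves" "lift_lands (\<pi> \<circ> (\<lambda>t. of_real t * \<xi>)) \<xi>" .
qed

lemma in_access_of_iff:
  assumes "\<xi> \<in> radial_points" "\<eta> \<in> curves" "lift_lands \<eta> \<zeta>"
  shows "\<eta> \<in> access_of \<xi> \<longleftrightarrow> (\<exists>\<gamma>\<in>deck. \<zeta> = boundary_action \<gamma> \<xi>)"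
  using access_rel_iff[OF radius_projects(1)[OF assms(1)] assms(2) radius_projects(2)[OF assms(1)] assms(3)]
  by (simp add: access_of_def)

lemma access_of_in_accesses: "\<xi> \<in> radial_points \<Longrightarrow> access_of \<xi> \<in> all_accesses"
  unfolding access_of_def accesses_def by (intro quotientI radius_projects)

lemma access_of_landing: "\<eta> \<in> access_of \<xi> \<Longrightarrow> \<eta> \<in> curves"
  by (auto simp: access_of_def access_rel_def)

lemma access_of_eq_iff:
  assumes "\<xi> \<in> radial_points" "\<zeta> \<in> radial_points"
  shows "access_of \<xi> = access_of \<zeta> \<longleftrightarrow> (\<xi>, \<zeta>) \<in> orbit_rel"
  using eq_equiv_class_iff[OF equiv_access_rel radius_projects(1)[OF assms(1)] radius_projects(1)[OF assms(2)]]
    access_rel_iff_orbit[OF radius_projects(1)[OF assms(1)] radius_projects(1)[OF assms(2)] radius_projects(2)[OF assms(1)] radius_projects(2)[OF assms(2)]]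
  by (simp add: access_of_def)

lemma access_is_access_of:
  assumes "A \<in> all_accesses"
  obtains \<xi> where "\<xi> \<in> radial_points" "A = access_of \<xi>"
proof -
  obtain \<eta> where \<eta>: "\<eta> \<in> curves" "A = homotopic `` {\<eta>}"
    using assms unfolding accesses_def by (rule quotientE)
  obtain \<xi> where l: "lift_lands \<eta> \<xi>" using lift_lands_exists[OF \<eta>(1)] .
  have \<xi>: "\<xi> \<in> radial_points" by (rule lift_lands_radial[OF \<eta>(1) l])
  have "(\<xi>, \<xi>) \<in> orbit_rel" using equiv_deck_orbit_rel \<xi> by (auto simp: equiv_def refl_on_def)
  then have "(\<eta>, \<pi> \<circ> (\<lambda>t. of_real t * \<xi>)) \<in> homotopic"
    using access_rel_iff_orbit[OF \<eta>(1) radius_projects(1)[OF \<xi>] l radius_projects(2)[OF \<xi>]] by simp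
  then have "A = access_of \<xi>" unfolding \<eta>(2) access_of_def by (rule equiv_class_eq[OF equiv_access_rel])
  then show ?thesis using that \<xi> by blast
qed

lemma nontangential_curves_project_into_access_of:
  assumes \<xi>: "\<xi> \<in> radial_points" and \<gamma>: "\<gamma> \<in> deck"
  shows "nontangential_curves_project_into \<pi> (boundary_action \<gamma> \<xi>) (access_of \<xi>)"
  unfolding nontangential_curves_project_into_def
proof (intro allI impI, elim conjE)
  fix c assume c: "curve_from unit_disk 0 c" and nt: "lands_nontangentially_at c (boundary_action \<gamma> \<xi>)"
  have z: "boundary_action \<gamma> \<xi> \<in> radial_points" by (rule radial_preimage_deck_invariant[OF \<xi> \<gamma>])
  then have "vanishing_along g c"
    using nontangential_limit[OF omitting_g _ _ nt] by (simp add: radial_preimage_iff)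
  moreover have "lands_at c (boundary_action \<gamma> \<xi>)" using nt by (simp add: lands_nontangentially_at_def)
  ultimately have "\<pi> \<circ> c \<in> curves" "lift_lands (\<pi> \<circ> c) (boundary_action \<gamma> \<xi>)"
    using disk_curve_projects[OF c _ radial_preimage_circle[OF z]] by blast+
  then show "\<pi> \<circ> c \<in> access_of \<xi>" using in_access_of_iff[OF \<xi>] \<gamma> by blast
qed

lemma corresponding_point_access_of:
  assumes \<xi>: "\<xi> \<in> radial_points"
  shows "corresponding_point \<pi> (access_of \<xi>) \<xi>"
  unfolding corresponding_point_def
proof (intro conjI ballI radial_preimage_circle[OF \<xi>])
  fix \<eta> assume \<eta>: "\<eta> \<in> access_of \<xi>"
  then have lc: "\<eta> \<in> curves" by (rule access_of_landing)
  obtain \<zeta> where l: "lift_lands \<eta> \<zeta>" using lift_lands_exists[OF lc] .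
  then obtain c where c: "lift_from \<pi> 0 \<eta> c" "lands_at c \<zeta>" unfolding lift_lands_def by blast
  obtain \<gamma> where "\<gamma> \<in> deck" "\<zeta> = boundary_action \<gamma> \<xi>" using in_access_of_iff[OF \<xi> lc l] \<eta> by blast
  with c show "\<exists>\<eta>'. lift_from \<pi> 0 \<eta> \<eta>' \<and> (\<forall>\<eta>''. lift_from \<pi> 0 \<eta> \<eta>'' \<longrightarrow> (\<forall>t\<in>{0..<1}. \<eta>'' t = \<eta>' t)) \<and>
      (\<exists>\<gamma>\<in>deck. lands_at \<eta>' (boundary_action \<gamma> \<xi>))"
    using lift_unique[OF _ c(1)] by blast
qed

text \<open>A point corresponding to \<open>B\<close> determines \<open>B\<close>, since the lifts of curves in \<open>B\<close> land in the orbit of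
  that point.\<close>

lemma corresponding_points_separate:
  assumes \<xi>: "\<xi> \<in> radial_points" and B: "B \<in> all_accesses"
    and cp: "corresponding_point \<pi> B (boundary_action \<gamma> \<xi>)" and \<gamma>: "\<gamma> \<in> deck"
  shows "B = access_of \<xi>"
proof -
  obtain \<omega> where \<omega>: "\<omega> \<in> radial_points" "B = access_of \<omega>" using access_is_access_of[OF B] .
  let ?\<beta> = "\<pi> \<circ> (\<lambda>t. of_real t * \<omega>)"
  have \<beta>: "?\<beta> \<in> curves" "lift_lands ?\<beta> \<omega>" using radius_projects[OF \<omega>(1)] by auto
  have "?\<beta> \<in> B" using equiv_class_self[OF equiv_access_rel \<beta>(1)] by (simp add: \<omega>(2) access_of_def)
  then obtain c \<delta> where c: "lift_from \<pi> 0 ?\<beta> c" and \<delta>: "\<delta> \<in> deck"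
      and land: "lands_at c (boundary_action \<delta> (boundary_action \<gamma> \<xi>))"
    using cp unfolding corresponding_point_def by blast
  have \<xi>1: "\<xi> \<in> unit_circle" by (rule radial_preimage_circle[OF \<xi>])
  have eq: "boundary_action \<delta> (boundary_action \<gamma> \<xi>) = boundary_action (\<delta> \<circ> \<gamma>) \<xi>"
    using deck_group_action_compose[OF \<delta> \<gamma> \<xi>1] by simp
  have \<delta>\<gamma>: "\<delta> \<circ> \<gamma> \<in> deck" by (rule deck_group_compose[OF \<delta> \<gamma>])
  have "lift_lands ?\<beta> (boundary_action (\<delta> \<circ> \<gamma>) \<xi>)"
    unfolding lift_lands_def using deck_group_circle[OF \<delta>\<gamma> \<xi>1] c land eq by auto
  then have "?\<beta> \<in> access_of \<xi>" using in_access_of_iff[OF \<xi> \<beta>(1)] \<delta>\<gamma> by blast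
  then have "homotopic `` {?\<beta>} = access_of \<xi>"
    unfolding access_of_def using equiv_class_eq[OF equiv_access_rel] by blast
  then show ?thesis by (simp add: \<omega>(2) access_of_def)
qed

lemma correspondence:
  obtains \<Phi> where "bij_betw \<Phi> (radial_points // orbit_rel) (all_accesses)"
    "\<And>X \<xi>. X \<in> radial_points // orbit_rel \<Longrightarrow> \<xi> \<in> X \<Longrightarrow> \<xi> \<in> radial_points \<and> \<Phi> X = access_of \<xi>"
proof -
  define \<Phi> where "\<Phi> X = access_of (SOME \<xi>. \<xi> \<in> X)" for X
  have val: "\<xi> \<in> radial_points \<and> \<Phi> X = access_of \<xi>"
    if X: "X \<in> radial_points // orbit_rel" and \<xi>: "\<xi> \<in> X" for X \<xi>
  proof -
    have some: "(SOME \<xi>. \<xi> \<in> X) \<in> X" using \<xi> by (rule someI)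
    have rel: "(SOME \<xi>. \<xi> \<in> X, \<xi>) \<in> orbit_rel"
      using quotient_eq_iff[OF equiv_deck_orbit_rel X X some \<xi>] by simp
    then have "(SOME \<xi>. \<xi> \<in> X) \<in> radial_points" "\<xi> \<in> radial_points"
      by (auto simp: deck_orbit_rel_def)
    then show ?thesis using access_of_eq_iff rel by (simp add: \<Phi>_def)
  qed
  have nonempty: "\<exists>\<xi>. \<xi> \<in> X" if "X \<in> radial_points // orbit_rel" for X
    using in_quotient_imp_non_empty[OF equiv_deck_orbit_rel that] by blast
  have "bij_betw \<Phi> (radial_points // orbit_rel) (all_accesses)"
    unfolding bij_betw_def
  proof
    show "inj_on \<Phi> (radial_points // orbit_rel)"
    proof (rule inj_onI)
      fix X Y assume X: "X \<in> radial_points // orbit_rel" and Y: "Y \<in> radial_points // orbit_rel"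
        and eq: "\<Phi> X = \<Phi> Y"
      obtain \<xi> \<zeta> where \<xi>: "\<xi> \<in> X" and \<zeta>: "\<zeta> \<in> Y" using nonempty[OF X] nonempty[OF Y] by blast
      have "(\<xi>, \<zeta>) \<in> orbit_rel" using val[OF X \<xi>] val[OF Y \<zeta>] eq access_of_eq_iff by metis
      then show "X = Y" using quotient_eq_iff[OF equiv_deck_orbit_rel X Y \<xi> \<zeta>] by simp
    qed
    show "\<Phi> ` (radial_points // orbit_rel) = all_accesses"
    proof (intro equalityI subsetI)
      fix A assume "A \<in> \<Phi> ` (radial_points // orbit_rel)"
      then obtain X where X: "X \<in> radial_points // orbit_rel" "A = \<Phi> X" by blast
      obtain \<xi> where "\<xi> \<in> X" using nonempty[OF X(1)] by blast
      then show "A \<in> all_accesses" using val[OF X(1)] X(2) access_of_in_accesses by metis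
    next
      fix A assume "A \<in> all_accesses"
      then obtain \<xi> where \<xi>: "\<xi> \<in> radial_points" "A = access_of \<xi>" by (rule access_is_access_of)
      have "\<xi> \<in> orbit_rel `` {\<xi>}" by (rule equiv_class_self[OF equiv_deck_orbit_rel \<xi>(1)])
      then show "A \<in> \<Phi> ` (radial_points // orbit_rel)"
        using val[OF quotientI[OF \<xi>(1)]] quotientI[OF \<xi>(1)] \<xi>(2) by blast
    qed
  qed
  then show ?thesis using that val by blast
qed

end

lemma access_covering_exists:
  assumes "hyperbolic_domain \<Omega>" "p \<in> frontier \<Omega>" "holomorphic_universal_covering \<pi> \<Omega>" "\<pi> 0 = z\<^sub>0"
  obtains m n where "access_covering \<Omega> z\<^sub>0 p \<pi> m n"
proof -
  have "open \<Omega>" using assms(1) by (simp add: hyperbolic_domain_def sphere_domain_def)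
  then have p: "p \<notin> \<Omega>" using assms(2) by (simp add: frontier_def interior_open)
  obtain x y z where xyz: "x \<noteq> y" "x \<noteq> z" "y \<noteq> z" "x \<notin> \<Omega>" "y \<notin> \<Omega>" "z \<notin> \<Omega>"
    using assms(1) unfolding hyperbolic_domain_def by auto
  \<comment> \<open>at least two of the three omitted points differ from \<open>p\<close>\<close>
  obtain a b where ab: "a \<noteq> p" "b \<noteq> p" "a \<noteq> b" "a \<notin> \<Omega>" "b \<notin> \<Omega>"
  proof (cases "x = p")
    case True
    then show ?thesis using that[of y z] xyz by auto
  next
    case False
    then show ?thesis using that[of x y] that[of x z] xyz by (cases "y = p") auto
  qed
  have cov: "covering_space unit_disk \<pi> \<Omega>" and hol: "sphere_holomorphic_on \<pi> unit_disk"
    using assms(3) by (auto simp: holomorphic_universal_covering_def)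
  have into: "\<pi> z \<in> \<Omega>" if "z \<in> unit_disk" for z using cov that by (auto simp: covering_space_def)
  have "access_covering \<Omega> z\<^sub>0 p \<pi> (cross_ratio_map p a b) (cross_ratio_inv p a b)"
  proof
    show "continuous_on (insert p \<Omega>) (cross_ratio_map p a b)"
      by (rule continuous_on_subset[OF continuous_on_cross_ratio_map[OF ab(1-3)]]) (use ab in auto)
    show "continuous_on UNIV (cross_ratio_inv p a b)" by (rule continuous_on_cross_ratio_inv[OF ab(1-3)])
    show "cross_ratio_inv p a b (cross_ratio_map p a b w) = w" if "w \<in> insert p \<Omega>" for w
      by (rule cross_ratio_inv_map[OF ab(1-3)]) (use that ab in auto)
    show "cross_ratio_map p a b p = 0" by (rule cross_ratio_map_p[OF ab(1-3)])
    show "cross_ratio_map p a b w \<noteq> 1" if "w \<in> \<Omega>" for w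
      using cross_ratio_map_eq_1_iff[OF ab(1-3), of w] that ab by auto
    show "(\<lambda>z. cross_ratio_map p a b (\<pi> z)) holomorphic_on unit_disk"
      by (rule cross_ratio_map_holomorphic[OF ab(1-3) hol open_ball]) (use into ab in auto)
  qed (fact cov assms(4) p)+
  then show ?thesis using that by blast
qed

theorem theorem5p9:
  fixes \<Omega> :: "riemann_sphere set" and z\<^sub>0 p :: riemann_sphere
    and \<pi> :: "complex \<Rightarrow> riemann_sphere"
  assumes "hyperbolic_domain \<Omega>" and "\<not> simply_connected \<Omega>"
    and "z\<^sub>0 \<in> \<Omega>" and "p \<in> frontier \<Omega>"
    and "holomorphic_universal_covering \<pi> \<Omega>" and "\<pi> 0 = z\<^sub>0"
  shows
    "(\<exists>\<Phi>. bij_betw \<Phi> (radial_preimage \<pi> p // deck_orbit_rel \<pi> p) (accesses \<Omega> z\<^sub>0 p) \<and>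
          (\<forall>X \<in> radial_preimage \<pi> p // deck_orbit_rel \<pi> p. \<forall>\<xi>\<in>X.
             nontangential_curves_project_into \<pi> \<xi> (\<Phi> X) \<and> corresponding_point \<pi> (\<Phi> X) \<xi>)) \<and>
     (\<forall>\<xi>\<in>radial_preimage \<pi> p. \<forall>\<gamma>\<in>deck_group \<pi>. boundary_action \<gamma> \<xi> \<in> radial_preimage \<pi> p) \<and>
     (\<forall>\<xi>\<in>radial_preimage \<pi> p. \<exists>A\<in>accesses \<Omega> z\<^sub>0 p. \<forall>\<gamma>\<in>deck_group \<pi>.
        nontangential_curves_project_into \<pi> (boundary_action \<gamma> \<xi>) A) \<and>
     (\<forall>A\<in>accesses \<Omega> z\<^sub>0 p. \<exists>\<xi>\<in>unit_circle.
        corresponding_point \<pi> A \<xi> \<and>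
        (\<forall>B\<in>accesses \<Omega> z\<^sub>0 p. B \<noteq> A \<longrightarrow>
           (\<forall>\<zeta>\<in>unit_circle. corresponding_point \<pi> B \<zeta> \<longrightarrow>
              \<not> (\<exists>\<gamma>\<in>deck_group \<pi>. boundary_action \<gamma> \<xi> = \<zeta>))))"

proof -
  obtain m n where "access_covering \<Omega> z\<^sub>0 p \<pi> m n"
    using access_covering_exists[OF assms(1,4,5,6)] .
  then interpret access_covering \<Omega> z\<^sub>0 p \<pi> m n .
  obtain \<Phi> where bij: "bij_betw \<Phi> (radial_preimage \<pi> p // deck_orbit_rel \<pi> p) (accesses \<Omega> z\<^sub>0 p)"
    and \<Phi>: "\<And>X \<xi>. X \<in> radial_preimage \<pi> p // deck_orbit_rel \<pi> p \<Longrightarrow> \<xi> \<in> X \<Longrightarrow>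
        \<xi> \<in> radial_preimage \<pi> p \<and> \<Phi> X = access_of \<xi>"
    by (rule correspondence) (rule that; blast)
  have "nontangential_curves_project_into \<pi> \<xi> (\<Phi> X) \<and> corresponding_point \<pi> (\<Phi> X) \<xi>"
    if "X \<in> radial_preimage \<pi> p // deck_orbit_rel \<pi> p" "\<xi> \<in> X" for X \<xi>
  proof -
    have \<xi>: "\<xi> \<in> radial_preimage \<pi> p" "\<Phi> X = access_of \<xi>" using \<Phi>[OF that] by auto
    have "nontangential_curves_project_into \<pi> \<xi> (access_of \<xi>)"
      using nontangential_curves_project_into_access_of[OF \<xi>(1) deck_group_id]
        boundary_action_id[OF radial_preimage_circle[OF \<xi>(1)]] by simp
    then show ?thesis using corresponding_point_access_of[OF \<xi>(1)] \<xi>(2) by simp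
  qed
  moreover have "\<exists>\<xi>\<in>unit_circle. corresponding_point \<pi> A \<xi> \<and>
        (\<forall>B\<in>accesses \<Omega> z\<^sub>0 p. B \<noteq> A \<longrightarrow>
           (\<forall>\<zeta>\<in>unit_circle. corresponding_point \<pi> B \<zeta> \<longrightarrow>
              \<not> (\<exists>\<gamma>\<in>deck_group \<pi>. boundary_action \<gamma> \<xi> = \<zeta>)))" if A: "A \<in> accesses \<Omega> z\<^sub>0 p" for A
  proof -
    obtain \<xi> where \<xi>: "\<xi> \<in> radial_preimage \<pi> p" "A = access_of \<xi>" using access_is_access_of[OF A] .
    show ?thesis
      using radial_preimage_circle[OF \<xi>(1)] corresponding_point_access_of[OF \<xi>(1)]
        corresponding_points_separate[OF \<xi>(1)] \<xi>(2) by blast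
  qed
  moreover have "\<exists>A\<in>accesses \<Omega> z\<^sub>0 p. \<forall>\<gamma>\<in>deck_group \<pi>.
        nontangential_curves_project_into \<pi> (boundary_action \<gamma> \<xi>) A" if "\<xi> \<in> radial_preimage \<pi> p" for \<xi>
    using access_of_in_accesses[OF that] nontangential_curves_project_into_access_of[OF that] by blast
  ultimately show ?thesis
    using bij radial_preimage_deck_invariant by (intro conjI exI[of _ \<Phi>]) auto
qed

end
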